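(* Let $k$ be a field, $P=k[x_1,\dots,x_n]$ a standard graded polynomial ring, and let $h=(1,2,\ldots,d,h_d,\ldots,h_s)$ be an $O$-sequence. Define $\mathcal I:=\{j\ge 1 \mid \triangle^2h(j)\leq -1\}$ and $\mathcal J:=\{j\ge 1\mid \triangle^2h(j)\geq 1\}$. Let $J$ be a perfect homogeneous ideal of height two of $P$ such that $h$ is the $h$-vector of $G=P/J$. Then: (1) $\displaystyle \nu(J)\geq \sum_{i\in\mathcal I}|\triangle^2h(i)|$. (2) If equality holds in (1), then the graded Betti numbers of $J$ are uniquely determined by the Hilbert function, namely $$\beta_{0j}(J)=\begin{cases}|\triangle^2h(j)| & \text{for } j\in\mathcal I\\ 0&\text{otherwise,}\end{cases}\qquad \beta_{1j}(J)=\begin{cases}|\triangle^2h(j)| & \text{for } j\in\mathcal J\\ 0&\text{otherwise.}\end{cases}$$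
   Context: An $O$-sequence (in this codimension two setting) is a finite sequence of integers $h=(1,2,\ldots,d,h_d,\ldots,h_s)$, with $h(j)=j+1$ for $0\le j\le d-1$ and $h(j)=h_j$ for $d\le j\le s$, satisfying $d\geq h_d\geq h_{d+1}\geq\cdots\geq h_s\geq 1$; it is regarded as a function with $h(j)=0$ for $j>s$ and for $j<0$. First and second differences: $\triangle h(j)=h(j)-h(j-1)$, $\triangle^2h(j)=\triangle h(j)-\triangle h(j-1)=h(j)-2h(j-1)+h(j-2)$. $\nu(J)$ is the minimal number of generators of $J$. A homogeneous ideal $J$ of height two is perfect if $P/J$ is Cohen-Macaulay (equivalently $P/J$ has projective dimension $2$). The $h$-vector of $P/J$ is $h$ if the Hilbert series of $P/J$ equals $\left(\sum_{j}h(j)t^j\right)/(1-t)^{n-2}$. The graded Betti numbers $\beta_{ij}(J)$ are defined by the minimal graded free resolution $0\to\bigoplus_{j\ge0}P(-j)^{\beta_{1j}(J)}\to\bigoplus_{j\ge0}P(-j)^{\beta_{0j}(J)}\to J\to0$. *)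

theory Defs
  imports
    "HOL-Library.Poly_Mapping"
    "HOL-Library.Extended_Nat"
    "HOL-Library.Cardinality"
    "HOL-Computational_Algebra.Formal_Power_Series"
begin

section \<open>Ideals, height and the Cohen-Macaulay property\<close>

lemma module_mult: "module ((*) :: 'a::comm_ring_1 \<Rightarrow> 'a \<Rightarrow> 'a)"
  by unfold_locales (simp_all add: algebra_simps)

definition is_ideal :: "'a::comm_ring_1 set \<Rightarrow> bool"
  where "is_ideal I \<longleftrightarrow> module.subspace (*) I"

definition ideal_gen :: "'a::comm_ring_1 set \<Rightarrow> 'a set"
  where "ideal_gen S = module.span (*) S"

definition min_num_gens :: "'a::comm_ring_1 set \<Rightarrow> nat"
  where "min_num_gens I = (LEAST m. \<exists>S. finite S \<and> card S = m \<and> ideal_gen S = I)"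

definition prime_ideal :: "'a::comm_ring_1 set \<Rightarrow> bool"
  where "prime_ideal p \<longleftrightarrow> is_ideal p \<and> p \<noteq> UNIV \<and> (\<forall>a b. a * b \<in> p \<longrightarrow> a \<in> p \<or> b \<in> p)"

definition maximal_ideal :: "'a::comm_ring_1 set \<Rightarrow> bool"
  where "maximal_ideal M \<longleftrightarrow>
    is_ideal M \<and> M \<noteq> UNIV \<and> (\<forall>I. is_ideal I \<and> M \<subseteq> I \<and> I \<noteq> UNIV \<longrightarrow> I = M)"

definition prime_chain :: "nat \<Rightarrow> (nat \<Rightarrow> 'a::comm_ring_1 set) \<Rightarrow> bool"
  where "prime_chain l c \<longleftrightarrow> (\<forall>i\<le>l. prime_ideal (c i)) \<and> (\<forall>i<l. c i \<subset> c (Suc i))"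

definition prime_height :: "'a::comm_ring_1 set \<Rightarrow> enat"
  where "prime_height p = (SUP l \<in> {l. \<exists>c. prime_chain l c \<and> c l = p}. enat l)"

definition ideal_height :: "'a::comm_ring_1 set \<Rightarrow> enat"
  where "ideal_height I = (INF p \<in> {p. prime_ideal p \<and> I \<subseteq> p}. prime_height p)"

text \<open>
  Let \<open>J \<subseteq> M\<close> be ideals of a ring \<open>R\<close>, with \<open>M\<close> maximal. The local ring \<open>(R/J)\<^sub>M\<close> is described
  inside \<open>R\<close>. Its prime ideals are the prime ideals \<open>p\<close> of \<open>R\<close> with \<open>J \<subseteq> p \<subseteq> M\<close>, so
  \<open>local_dim J M\<close> is its Krull dimension. Up to units, the elements of its maximal ideal are the
  images of elements of \<open>M\<close>, and \<open>contracted M I\<close> is the preimage in \<open>R\<close> of the extension of an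
  ideal \<open>I\<close> to \<open>R\<^sub>M\<close>. Hence \<open>regular_sequence_at J M\<close> says that the images of the \<open>fs\<close> form a
  regular sequence in the maximal ideal of \<open>(R/J)\<^sub>M\<close>. The quotient by a sequence in \<open>M\<close> is
  automatically nonzero.
\<close>

definition local_dim :: "'a::comm_ring_1 set \<Rightarrow> 'a set \<Rightarrow> enat"
  where "local_dim J M = (SUP l \<in> {l. \<exists>c. prime_chain l c \<and> J \<subseteq> c 0 \<and> c l \<subseteq> M}. enat l)"

definition contracted :: "'a::comm_ring_1 set \<Rightarrow> 'a set \<Rightarrow> 'a set"
  where "contracted M I = {p. \<exists>s. s \<notin> M \<and> s * p \<in> I}"

definition regular_sequence_at :: "'a::comm_ring_1 set \<Rightarrow> 'a set \<Rightarrow> 'a list \<Rightarrow> bool"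
  where "regular_sequence_at J M fs \<longleftrightarrow> set fs \<subseteq> M \<and>
    (\<forall>i<length fs. \<forall>p. fs ! i * p \<in> contracted M (ideal_gen (J \<union> set (take i fs)))
       \<longrightarrow> p \<in> contracted M (ideal_gen (J \<union> set (take i fs))))"

definition local_depth :: "'a::comm_ring_1 set \<Rightarrow> 'a set \<Rightarrow> enat"
  where "local_depth J M = (SUP fs \<in> {fs. regular_sequence_at J M fs}. enat (length fs))"

text \<open>The quotient ring \<open>R/J\<close> of a Noetherian ring \<open>R\<close> is Cohen-Macaulay.\<close>

definition cohen_macaulay_quotient :: "'a::comm_ring_1 set \<Rightarrow> bool"
  where "cohen_macaulay_quotient J \<longleftrightarrow>
    (\<forall>M. maximal_ideal M \<and> J \<subseteq> M \<longrightarrow> local_depth J M = local_dim J M)"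


section \<open>The standard graded polynomial ring\<close>

text \<open>
  The type \<open>('x, 'k) mpoly\<close> is the polynomial ring over \<open>'k\<close> in \<open>CARD('x)\<close> variables; a power
  product is represented by its exponent vector.
\<close>

type_synonym ('x, 'k) mpoly = "('x \<Rightarrow>\<^sub>0 nat) \<Rightarrow>\<^sub>0 'k"

definition mdeg :: "('x::finite \<Rightarrow>\<^sub>0 nat) \<Rightarrow> nat"
  where "mdeg t = (\<Sum>x\<in>UNIV. Poly_Mapping.lookup t x)"

definition hom_piece :: "nat \<Rightarrow> ('x::finite, 'k::field) mpoly set"
  where "hom_piece e = {p. \<forall>t\<in>Poly_Mapping.keys p. mdeg t = e}"

definition homogeneous_ideal :: "('x::finite, 'k::field) mpoly set \<Rightarrow> bool"
  where "homogeneous_ideal J \<longleftrightarrow> (\<exists>S. S \<subseteq> (\<Union>e. hom_piece e) \<and> J = ideal_gen S)"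

definition perfect_height_two :: "('x::finite, 'k::field) mpoly set \<Rightarrow> bool"
  where "perfect_height_two J \<longleftrightarrow> ideal_height J = 2 \<and> cohen_macaulay_quotient J"

definition k_scale :: "'k::field \<Rightarrow> ('x::finite, 'k) mpoly \<Rightarrow> ('x, 'k) mpoly"
  where "k_scale c p = Poly_Mapping.single 0 c * p"

lemma vector_space_k_scale: "vector_space (k_scale :: 'k::field \<Rightarrow> ('x::finite, 'k) mpoly \<Rightarrow> _)"
  by unfold_locales
    (simp_all add: k_scale_def algebra_simps Poly_Mapping.single_add Poly_Mapping.mult_single flip: mult.assoc)

text \<open>The Hilbert function and the Hilbert series of \<open>P/J\<close>, where \<open>(P/J)\<^sub>e = P\<^sub>e / (J \<inter> P\<^sub>e)\<close>.\<close>

definition hilbert_function :: "('x::finite, 'k::field) mpoly set \<Rightarrow> nat \<Rightarrow> nat"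
  where "hilbert_function J e =
    vector_space.dim k_scale (hom_piece e :: ('x, 'k) mpoly set)
      - vector_space.dim k_scale (J \<inter> hom_piece e)"

definition hilbert_series :: "('x::finite, 'k::field) mpoly set \<Rightarrow> rat fps"
  where "hilbert_series J = Abs_fps (\<lambda>e. of_nat (hilbert_function J e))"

text \<open>
  The natural number subtraction \<open>CARD('x) - 2\<close> is harmless: an ideal of height two exists only
  if there are at least two variables.
\<close>

definition has_h_vector :: "('x::finite, 'k::field) mpoly set \<Rightarrow> (int \<Rightarrow> int) \<Rightarrow> bool"
  where "has_h_vector J h \<longleftrightarrow>
    hilbert_series J = Abs_fps (\<lambda>j. of_int (h (int j))) / (1 - fps_X) ^ (CARD('x) - 2)"


section \<open>Graded Betti numbers\<close>

definition free_module :: "nat \<Rightarrow> (nat \<Rightarrow> 'a::zero) set"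
  where "free_module m = {v. \<forall>i\<ge>m. v i = 0}"

text \<open>
  A minimal graded free resolution
  \<open>0 \<rightarrow> \<Oplus>\<^sub>l P(-b\<^sub>l) \<rightarrow> \<Oplus>\<^sub>i P(-a\<^sub>i) \<rightarrow> J \<rightarrow> 0\<close>.
  The map onto \<open>J\<close> sends the \<open>i\<close>-th basis element to \<open>g i\<close>, and the other map sends the \<open>l\<close>-th
  basis element to \<open>(A l i)\<^sub>i\<close>. Both maps preserve degrees, and minimality says that the image of
  the latter map is contained in the irrelevant maximal ideal times the middle module.
\<close>

definition min_graded_resolution ::
  "('x::finite, 'k::field) mpoly set \<Rightarrow> nat list \<Rightarrow> nat list \<Rightarrow> (nat \<Rightarrow> ('x, 'k) mpoly)
     \<Rightarrow> (nat \<Rightarrow> nat \<Rightarrow> ('x, 'k) mpoly) \<Rightarrow> bool"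
  where "min_graded_resolution J a b g A \<longleftrightarrow>
    (\<forall>i<length a. g i \<in> hom_piece (a ! i)) \<and>
    (\<forall>l<length b. \<forall>i<length a. \<forall>t\<in>Poly_Mapping.keys (A l i). mdeg t + a ! i = b ! l) \<and>
    (\<lambda>v. \<Sum>i<length a. v i * g i) ` free_module (length a) = J \<and>
    {v \<in> free_module (length a). (\<Sum>i<length a. v i * g i) = 0} =
      (\<lambda>w i. if i < length a then \<Sum>l<length b. w l * A l i else 0) ` free_module (length b) \<and>
    inj_on (\<lambda>w i. if i < length a then \<Sum>l<length b. w l * A l i else 0)
      (free_module (length b)) \<and>
    (\<forall>l<length b. \<forall>i<length a. Poly_Mapping.lookup (A l i) 0 = 0)"

text \<open>
  The shifts of a minimal graded free resolution are unique up to order, so the descriptions below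
  are well defined whenever \<open>J\<close> has such a resolution of length one, in particular if \<open>J\<close> is
  perfect of height two.
\<close>

definition graded_betti0 :: "('x::finite, 'k::field) mpoly set \<Rightarrow> nat \<Rightarrow> nat"
  where "graded_betti0 J j =
    (THE m. \<exists>a b g A. min_graded_resolution J a b g A \<and> count_list a j = m)"

definition graded_betti1 :: "('x::finite, 'k::field) mpoly set \<Rightarrow> nat \<Rightarrow> nat"
  where "graded_betti1 J j =
    (THE m. \<exists>a b g A. min_graded_resolution J a b g A \<and> count_list b j = m)"


section \<open>O-sequences in codimension two\<close>

text \<open>
  The sequence \<open>(1, 2, \<dots>, d, h\<^sub>d, \<dots>, h\<^sub>s)\<close>. The case \<open>s = d - 1\<close>, in which there are no entries
  \<open>h\<^sub>d, \<dots>, h\<^sub>s\<close>, is included.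
\<close>

definition O_sequence :: "int \<Rightarrow> int \<Rightarrow> (int \<Rightarrow> int) \<Rightarrow> bool"
  where "O_sequence d s h \<longleftrightarrow> 1 \<le> d \<and> d \<le> s + 1 \<and>
    (\<forall>j. 0 \<le> j \<and> j \<le> d - 1 \<longrightarrow> h j = j + 1) \<and>
    (\<forall>j. d \<le> j \<and> j \<le> s \<longrightarrow> 1 \<le> h j \<and> h j \<le> d) \<and>
    (\<forall>j. d \<le> j \<and> j < s \<longrightarrow> h (j + 1) \<le> h j) \<and>
    (\<forall>j. j < 0 \<or> s < j \<longrightarrow> h j = 0)"

definition bdiff :: "(int \<Rightarrow> int) \<Rightarrow> int \<Rightarrow> int"
  where "bdiff h j = h j - h (j - 1)"

abbreviation bdiff2 :: "(int \<Rightarrow> int) \<Rightarrow> int \<Rightarrow> int"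
  where "bdiff2 h \<equiv> bdiff (bdiff h)"

end

theory Submission
  imports Defs "HOL-Library.Function_Algebras" "HOL-Library.Countable"
begin

text \<open>
  Let \<open>\<mm>\<close> be the irrelevant ideal and \<open>n\<close> the number of variables. Comparing Hilbert functions
  along \<open>0 \<rightarrow> P/(I : f) \<rightarrow> P/I \<rightarrow> P/(I, f) \<rightarrow> 0\<close> shows that a homogeneous ideal maximal among those of
  large growth is prime, and produces a chain of \<open>n - 1\<close> primes between \<open>J\<close> and \<open>\<mm>\<close>. By the
  Cohen-Macaulay property \<open>P/J\<close> therefore has depth at least \<open>n - 2\<close> at \<open>\<mm>\<close>. As elements of \<open>\<mm>\<close>
  act as zero on Koszul homology, going down a regular sequence gives \<open>H\<^sub>3(x; P/J) = 0\<close>, so the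
  syzygy module \<open>K\<close> of minimal generators of \<open>J\<close> has \<open>H\<^sub>1(x; K) = 0\<close>. The relation module \<open>L\<close> of
  minimal generators of \<open>K\<close> then satisfies \<open>L = \<mm>L\<close>, so \<open>K\<close> is free.

  The resulting minimal resolution has \<open>\<nu>(J)\<close> generators, and additivity of dimensions along it
  yields \<open>\<Delta>\<^sup>2h(j) = \<beta>\<^sub>1\<^sub>j - \<beta>\<^sub>0\<^sub>j\<close> for \<open>j \<ge> 1\<close>. Hence \<open>\<beta>\<^sub>0\<^sub>j \<ge> |\<Delta>\<^sup>2h(j)|\<close> on \<open>\<I>\<close>, with equality
  everywhere if the sums agree.
\<close>

subsection \<open>Linear algebra\<close>

text \<open>Depth n - 2 kills the Koszul homology of P/J above degree 2, hence the choice of degree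
  3. Since the Koszul complex of P is exact in positive degrees, the sequences 0 -> J -> P -> P/J ->
  0 and 0 -> K -> P^m -> J -> 0 shift degree 3 for P/J to degree 2 for J and to degree 1 for K. By
  minimality that last group is L / mL, so its vanishing is the freeness of K; this takes the place
  of the Auslander-Buchsbaum formula. The main obstacle is that the Cohen-Macaulay hypothesis is
  local while \<open>h\<close> is graded data. \<open>local_dim\<close> is a supremum over chains of
  primes, so one explicit chain bounds it from below, and growth of Hilbert functions supplies that
  chain. Returning from the local ring loses nothing: an element outside the irrelevant ideal is a
  nonzero constant plus an element that acts as zero on Koszul homology. Height two ensures n \<ge>
  2, so that \<open>CARD('x) - 2\<close> is a true difference. In the second claim the shifts are
  forced in every minimal resolution at once, which determines the values that the Betti numbers
  describe.\<close>

text \<open>Indexed families are used because distinct indices may carry equal vectors in the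
  applications. A repetition is itself a relation, which is the second case.\<close>

lemma (in vector_space) dependent_family:
  assumes "finite I" "finite B" "\<And>i. i \<in> I \<Longrightarrow> v i \<in> span B" "card B < card I"
  shows "\<exists>c. (\<exists>i\<in>I. c i \<noteq> 0) \<and> (\<Sum>i\<in>I. c i *s v i) = 0"
proof (cases "inj_on v I")
  case True
  have "dependent (v ` I)"
  proof (rule ccontr)
    assume "\<not> dependent (v ` I)"
    then have "card (v ` I) \<le> card B"
      using independent_span_bound[of B "v ` I"] assms by blast
    then show False
      using assms True by (simp add: card_image)
  qed
  then obtain u where u: "\<exists>x\<in>v ` I. u x \<noteq> 0" "(\<Sum>x\<in>v ` I. u x *s x) = 0"
    using dependent_finite[of "v ` I"] assms by auto
  show ?thesis
    by (rule exI[of _ "u \<circ> v"]) (use u True in \<open>auto simp: sum.reindex\<close>)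
next
  case False
  then obtain i j where ij: "i \<in> I" "j \<in> I" "i \<noteq> j" "v i = v j"
    by (auto simp: inj_on_def)
  define c where "c k = (if k = i then 1 else if k = j then -1 else 0 :: 'a)" for k
  have "(\<Sum>k\<in>I. c k *s v k) = (\<Sum>k\<in>{i, j}. c k *s v k)"
    by (rule sum.mono_neutral_right) (use assms ij in \<open>auto simp: c_def\<close>)
  also have "\<dots> = 0"
    using ij by (simp add: c_def)
  finally show ?thesis
    using ij by (intro exI[of _ c]) (auto simp: c_def)
qed

lemma (in vector_space) finite_basis_exists:
  assumes "subspace V" "V \<subseteq> span F" "finite F" "A \<subseteq> V" "independent A"
  obtains B where "A \<subseteq> B" "finite B" "independent B" "span B = V" "card B = dim V"
proof -
  obtain B where B: "A \<subseteq> B" "B \<subseteq> V" "independent B" "V \<subseteq> span B"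
    using maximal_independent_subset_extend[OF assms(4,5)] by blast
  have "finite B"
    using independent_span_bound[of F B] assms B by blast
  moreover have "span B = V"
    using B assms span_subspace by blast
  ultimately show ?thesis
    using that B by (metis basis_card_eq_dim)
qed

lemma (in vector_space) dim_mono_finite:
  assumes "subspace V" "V \<subseteq> W" "subspace W" "W \<subseteq> span F" "finite F"
  shows "dim V \<le> dim W"
proof -
  obtain B where "finite B" "independent B" "span B = V" "card B = dim V"
    using finite_basis_exists[of V F "{}"] assms by (metis empty_subsetI independent_empty subset_trans)
  moreover obtain C where "finite C" "independent C" "span C = W" "card C = dim W"
    using finite_basis_exists[of W F "{}"] assms by (metis empty_subsetI independent_empty)
  ultimately show ?thesis
    using assms(2) by (metis dim_le_card)
qed

text \<open>Rank-nullity for the composite of \<open>f\<close> with the projection modulo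
  \<open>W\<close>, phrased without quotient spaces.\<close>

lemma (in vector_space_pair) dim_add_image:
  assumes lin: "Vector_Spaces.linear s1 s2 f"
    and S: "vs1.subspace S" "S \<subseteq> vs1.span F" "finite F"
    and W: "vs2.subspace W" "W \<subseteq> vs2.span G" "finite G"
  shows "vs2.dim {w + f s |w s. w \<in> W \<and> s \<in> S} + vs1.dim {s \<in> S. f s \<in> W} = vs2.dim W + vs1.dim S"
proof -
  interpret f: Vector_Spaces.linear s1 s2 f by (fact lin)
  define S0 where "S0 = {s \<in> S. f s \<in> W}"
  have S0: "vs1.subspace S0"
    using vs1.subspace_inter[OF S(1) f.subspace_linear_preimage[OF W(1)]]
    by (simp add: S0_def Int_def)
  have S0S: "S0 \<subseteq> S"
    by (auto simp: S0_def)
  obtain B where B: "finite B" "vs1.independent B" "vs1.span B = S0" "card B = vs1.dim S0"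
    using vs1.finite_basis_exists[of S0 F "{}"] S S0 S0S
    by (metis empty_subsetI vs1.independent_empty subset_trans)
  obtain C where C: "B \<subseteq> C" "finite C" "vs1.independent C" "vs1.span C = S" "card C = vs1.dim S"
    using vs1.finite_basis_exists[OF S, of B] B S0S by (metis vs1.span_superset subset_trans)
  obtain D where D: "finite D" "vs2.independent D" "vs2.span D = W" "card D = vs2.dim W"
    using vs2.finite_basis_exists[OF W, of "{}"] by (metis empty_subsetI vs2.independent_empty)
  define E where "E = C - B"
  have E: "finite E" "card E + card B = card C"
    using C B card_mono[OF C(2,1)] by (auto simp: E_def card_Diff_subset)
  have zero: "c = 0" if cE: "c \<in> vs1.span E" and cW: "f c \<in> W" for c
  proof -
    have "c \<in> S"
      using cE C vs1.span_mono[of E C] by (auto simp: E_def)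
    then have "c \<in> vs1.span B"
      using cW B by (auto simp: S0_def)
    then obtain u where u: "c = (\<Sum>x\<in>B. s1 (u x) x)"
      using vs1.span_finite[OF B(1)] by auto
    obtain v where v: "c = (\<Sum>x\<in>E. s1 (v x) x)"
      using cE vs1.span_finite[OF E(1)] by auto
    define w where "w x = (if x \<in> B then u x else - v x)" for x
    have "(\<Sum>x\<in>C. s1 (w x) x) = (\<Sum>x\<in>B. s1 (w x) x) + (\<Sum>x\<in>E. s1 (w x) x)"
      unfolding E_def using sum.subset_diff[OF C(1,2)] by (metis add.commute)
    also have "(\<Sum>x\<in>B. s1 (w x) x) = c"
      by (simp add: u w_def)
    also have "(\<Sum>x\<in>E. s1 (w x) x) = (\<Sum>x\<in>E. - s1 (v x) x)"
      by (rule sum.cong) (auto simp: w_def E_def)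
    also have "\<dots> = - c"
      by (simp add: v sum_negf)
    finally have "(\<Sum>x\<in>C. s1 (w x) x) = 0" by simp
    then have "w x = 0" if "x \<in> C" for x
      using vs1.independentD[OF C(3) C(2), of w x] that by auto
    then have "u x = 0" if "x \<in> B" for x
      using that C(1) by (metis subsetD w_def)
    then show ?thesis
      by (simp add: u)
  qed
  have indE: "vs1.independent E"
    using C(3) vs1.independent_mono E_def by blast
  have inj: "inj_on f (vs1.span E)"
    using zero W(1) vs2.subspace_0 by (subst f.inj_on_iff_eq_0) auto
  have indfE: "vs2.independent (f ` E)"
    by (rule f.independent_injective_image[OF indE inj])
  have cardfE: "card (f ` E) = card E"
    using inj card_image inj_on_subset vs1.span_superset by metis
  have span_fE: "vs2.span (f ` E) \<inter> W = {0}"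
  proof (intro equalityI subsetI)
    fix y assume "y \<in> vs2.span (f ` E) \<inter> W"
    then obtain c where "y = f c" "c \<in> vs1.span E" "f c \<in> W"
      by (auto simp: f.span_image)
    then show "y \<in> {0}"
      using zero[of c] by simp
  qed (simp add: vs2.span_zero vs2.subspace_0 W(1))
  have disj: "D \<inter> f ` E = {}"
  proof -
    have "0 \<notin> D"
      using D(2) vs2.dependent_zero by blast
    moreover have "D \<inter> f ` E \<subseteq> vs2.span (f ` E) \<inter> W"
      using D(3) vs2.span_superset[of D] vs2.span_superset[of "f ` E"] by auto
    ultimately show ?thesis
      using span_fE by auto
  qed
  have "vs2.independent (D \<union> f ` E)"
  proof (rule vs2.independent_if_scalars_zero)
    show "finite (D \<union> f ` E)"
      using D E by simp
    fix u x assume z: "(\<Sum>x\<in>D \<union> f ` E. s2 (u x) x) = 0" and x: "x \<in> D \<union> f ` E"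
    define p q where "p = (\<Sum>x\<in>D. s2 (u x) x)" and "q = (\<Sum>x\<in>f ` E. s2 (u x) x)"
    have "p + q = 0"
      using z disj D E by (simp add: sum.union_disjoint p_def q_def)
    have "p \<in> W"
      unfolding D(3)[symmetric] p_def by (intro vs2.span_sum vs2.span_scale vs2.span_base)
    moreover have "q \<in> vs2.span (f ` E)"
      unfolding q_def by (intro vs2.span_sum vs2.span_scale vs2.span_base)
    moreover have "p = - q"
      using \<open>p + q = 0\<close> by (simp add: eq_neg_iff_add_eq_0)
    ultimately have "p \<in> vs2.span (f ` E) \<inter> W"
      using vs2.span_neg by blast
    then have "p = 0" "q = 0"
      using span_fE \<open>p = - q\<close> by auto
    then show "u x = 0"
      using x vs2.independentD[OF D(2) D(1), of u x] vs2.independentD[OF indfE, of "f ` E" u x] E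
      by (auto simp: p_def q_def)
  qed
  moreover have "vs2.span (D \<union> f ` E) = {w + f s |w s. w \<in> W \<and> s \<in> S}"
  proof -
    have "vs2.span (D \<union> f ` E) = {w + f s |w s. w \<in> W \<and> s \<in> vs1.span E}"
      by (auto simp: vs2.span_Un D(3) f.span_image)
    also have "\<dots> = {w + f s |w s. w \<in> W \<and> s \<in> S}"
    proof (intro equalityI subsetI)
      fix y assume "y \<in> {w + f s |w s. w \<in> W \<and> s \<in> S}"
      then obtain w s where y: "y = w + f s" "w \<in> W" "s \<in> S" by auto
      have "s \<in> vs1.span (B \<union> E)"
        using y C by (simp add: E_def Un_absorb1)
      then obtain b e where s: "s = b + e" "b \<in> vs1.span B" "e \<in> vs1.span E"
        by (auto simp: vs1.span_Un)
      then have "f b \<in> W"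
        using B(3) by (auto simp: S0_def)
      then have "w + f b \<in> W"
        using y W(1) vs2.subspace_add by blast
      moreover have "y = (w + f b) + f e"
        by (simp add: y s f.add)
      ultimately show "y \<in> {w + f s |w s. w \<in> W \<and> s \<in> vs1.span E}"
        using s by blast
    next
      fix y assume "y \<in> {w + f s |w s. w \<in> W \<and> s \<in> vs1.span E}"
      moreover have "vs1.span E \<subseteq> S"
        using C vs1.span_mono[of E C] by (auto simp: E_def)
      ultimately show "y \<in> {w + f s |w s. w \<in> W \<and> s \<in> S}"
        by blast
    qed
    finally show ?thesis .
  qed
  ultimately have "vs2.dim {w + f s |w s. w \<in> W \<and> s \<in> S} = card (D \<union> f ` E)"
    by (metis vs2.dim_span_eq_card_independent)
  also have "\<dots> = vs2.dim W + card E"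
    using disj D E cardfE by (simp add: card_Un_disjoint)
  finally show ?thesis
    using E(2) B(4) C(5) by (simp add: S0_def)
qed

abbreviation (input) "coef \<equiv> Poly_Mapping.lookup"
abbreviation (input) "keys \<equiv> Poly_Mapping.keys"
abbreviation (input) "single \<equiv> Poly_Mapping.single"

subsection \<open>Monomials and homogeneous components\<close>

lemma coef_single_mult_add:
  fixes p :: "('x \<Rightarrow>\<^sub>0 nat) \<Rightarrow>\<^sub>0 'k::comm_ring_1"
  shows "coef (single s c * p) (s + u) = c * coef p u"
proof -
  have "coef (single s c * p) (s + u) = (\<Sum>l. (c when s = l) * (\<Sum>q. coef p q when s + u = l + q))"
    by (simp add: lookup_mult lookup_single)
  also have "\<dots> = c * (\<Sum>q. coef p q when s + u = s + q)"
    by (simp add: when_mult)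
  also have "\<dots> = c * coef p u"
    by simp
  finally show ?thesis .
qed

lemma coef_single_mult_eq_0:
  fixes p :: "('x \<Rightarrow>\<^sub>0 nat) \<Rightarrow>\<^sub>0 'k::comm_ring_1"
  assumes "\<And>u. t \<noteq> s + u"
  shows "coef (single s c * p) t = 0"
proof -
  have "t \<notin> keys (single s c * p)"
    using keys_mult[of "single s c" p] assms by (auto split: if_splits)
  then show ?thesis
    by (simp add: in_keys_iff)
qed

lemma monomial_split:
  fixes t s :: "'x \<Rightarrow>\<^sub>0 nat"
  assumes "\<And>x. coef s x \<le> coef t x"
  shows "t = s + (t - s)"
  by (rule poly_mapping_eqI) (simp add: lookup_add lookup_minus assms)

definition pvar :: "'x \<Rightarrow> ('x \<Rightarrow>\<^sub>0 nat) \<Rightarrow>\<^sub>0 'k::comm_ring_1"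
  where "pvar v = single (single v 1) 1"

lemma coef_pvar_mult:
  "coef (pvar v * p) t = (if coef t v = 0 then 0 else coef p (t - single v 1))"
proof (cases "coef t v = 0")
  case True
  then have "t \<noteq> single v 1 + u" for u
    by (auto simp: lookup_add)
  then show ?thesis
    using True by (simp add: pvar_def coef_single_mult_eq_0)
next
  case False
  then have "t = single v 1 + (t - single v 1)"
    by (intro monomial_split) (auto simp: lookup_single when_def)
  then show ?thesis
    using False coef_single_mult_add[of "single v 1" 1 p "t - single v 1"] by (simp add: pvar_def)
qed

lemma mdeg_add: "mdeg (s + t) = mdeg s + mdeg t"
  by (simp add: mdeg_def lookup_add sum.distrib)

lemma mdeg_0 [simp]: "mdeg 0 = 0"
  by (simp add: mdeg_def)

lemma mdeg_single [simp]: "mdeg (single v e) = e"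
  by (simp add: mdeg_def lookup_single when_def)

lemma mdeg_eq_0_iff: "mdeg t = 0 \<longleftrightarrow> t = 0"
  by (auto simp: mdeg_def intro: poly_mapping_eqI)

lemma hom_piece_0 [simp]: "0 \<in> hom_piece e"
  by (simp add: hom_piece_def)

lemma hom_piece_add: "p \<in> hom_piece e \<Longrightarrow> q \<in> hom_piece e \<Longrightarrow> p + q \<in> hom_piece e"
  unfolding hom_piece_def using Poly_Mapping.keys_add[of p q] by auto

lemma hom_piece_mult: "p \<in> hom_piece d \<Longrightarrow> q \<in> hom_piece e \<Longrightarrow> p * q \<in> hom_piece (d + e)"
  unfolding hom_piece_def using Poly_Mapping.keys_mult[of p q] by (fastforce simp: mdeg_add)

lemma pvar_hom_piece: "pvar v \<in> hom_piece 1"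
  by (simp add: hom_piece_def pvar_def)

definition hcomp :: "nat \<Rightarrow> ('x::finite, 'k::field) mpoly \<Rightarrow> ('x, 'k) mpoly"
  where "hcomp e p = Poly_Mapping.mapp (\<lambda>t c. if mdeg t = e then c else 0) p"

lemma coef_hcomp: "coef (hcomp e p) t = (if mdeg t = e then coef p t else 0)"
  by (simp add: hcomp_def lookup_mapp in_keys_iff when_def)

lemma hcomp_hom_piece [simp]: "hcomp e p \<in> hom_piece e"
  by (auto simp: hom_piece_def in_keys_iff coef_hcomp split: if_splits)

lemma hcomp_add: "hcomp e (p + q) = hcomp e p + hcomp e q"
  by (rule poly_mapping_eqI) (simp add: coef_hcomp lookup_add)

lemma hcomp_0 [simp]: "hcomp e 0 = 0"
  by (rule poly_mapping_eqI) (simp add: coef_hcomp)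

lemma hcomp_sum: "hcomp e (sum f A) = (\<Sum>i\<in>A. hcomp e (f i))"
  by (induction A rule: infinite_finite_induct) (auto simp: hcomp_add)

lemma hcomp_of_hom_piece: "p \<in> hom_piece d \<Longrightarrow> hcomp e p = (if d = e then p else 0)"
  by (rule poly_mapping_eqI) (auto simp: coef_hcomp hom_piece_def in_keys_iff)

lemma sum_hcomp:
  assumes "\<And>t. t \<in> keys p \<Longrightarrow> mdeg t \<le> N"
  shows "(\<Sum>e\<le>N. hcomp e p) = p"
proof (rule poly_mapping_eqI)
  fix t
  have "(\<Sum>e\<le>N. coef (hcomp e p) t) = (if mdeg t \<le> N then coef p t else 0)"
    by (simp add: coef_hcomp)
  then show "coef (\<Sum>e\<le>N. hcomp e p) t = coef p t"
    using assms[of t] by (auto simp: lookup_sum in_keys_iff)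
qed

lemma degree_bound_exists: "\<exists>N0. \<forall>t\<in>keys p. mdeg t \<le> N0"
proof -
  have "\<forall>t\<in>keys p. mdeg t \<le> Max (mdeg ` keys p)"
    by simp
  then show ?thesis ..
qed

lemma hcomp_decomposition: obtains N0 where "\<And>N. N \<ge> N0 \<Longrightarrow> (\<Sum>e\<le>N. hcomp e p) = p"
  using degree_bound_exists[of p] sum_hcomp[of p] order_trans by metis

lemma hcomp_mult_hom:
  assumes "q \<in> hom_piece d"
  shows "hcomp e (p * q) = (if d \<le> e then hcomp (e - d) p * q else 0)"
proof -
  obtain N0 where N0: "\<And>N. N \<ge> N0 \<Longrightarrow> (\<Sum>e\<le>N. hcomp e p) = p"
    using hcomp_decomposition[of p] by blast
  define N where "N = max N0 e"
  have "hcomp e (p * q) = hcomp e (\<Sum>i\<le>N. hcomp i p * q)"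
    using N0[of N] by (simp add: N_def flip: sum_distrib_right)
  also have "\<dots> = (\<Sum>i\<le>N. if i + d = e then hcomp i p * q else 0)"
    by (simp add: hcomp_sum hcomp_of_hom_piece[OF hom_piece_mult[OF hcomp_hom_piece assms]])
  also have "\<dots> = (\<Sum>i\<le>N. if i = e - d then (if d \<le> e then hcomp i p * q else 0) else 0)"
    by (rule sum.cong) auto
  also have "\<dots> = (if d \<le> e then hcomp (e - d) p * q else 0)"
    by (auto simp: N_def)
  finally show ?thesis .
qed

lemma hcomp_mult: "hcomp e (p * q) = (\<Sum>i\<le>e. hcomp (e - i) p * hcomp i q)"
proof -
  obtain N0 where N0: "\<And>N. N \<ge> N0 \<Longrightarrow> (\<Sum>e\<le>N. hcomp e q) = q"
    using hcomp_decomposition[of q] by blast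
  define N where "N = max N0 e"
  have "hcomp e (p * q) = hcomp e (\<Sum>i\<le>N. p * hcomp i q)"
    using N0[of N] by (simp add: N_def flip: sum_distrib_left)
  also have "\<dots> = (\<Sum>i\<le>N. if i \<le> e then hcomp (e - i) p * hcomp i q else 0)"
    by (simp add: hcomp_sum hcomp_mult_hom[OF hcomp_hom_piece])
  also have "\<dots> = (\<Sum>i\<le>e. hcomp (e - i) p * hcomp i q)"
    by (rule sum.mono_neutral_cong_right) (auto simp: N_def)
  finally show ?thesis .
qed

lemma hcomp_0_left: "hcomp 0 p = single 0 (coef p 0)"
  by (rule poly_mapping_eqI) (auto simp: coef_hcomp mdeg_eq_0_iff lookup_single when_def)

lemma coef_0_mult:
  fixes p q :: "('x::finite, 'k::field) mpoly"
  shows "coef (p * q) 0 = coef p 0 * coef q 0"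
proof -
  have "coef (hcomp 0 (p * q)) 0 = coef (single 0 (coef p 0) * single 0 (coef q 0) :: ('x, 'k) mpoly) 0"
    by (simp add: hcomp_mult hcomp_0_left)
  then show ?thesis
    by (simp add: coef_hcomp mult_single)
qed

subsection \<open>Homogeneous ideals\<close>

interpretation idl: module "(*) :: 'a::comm_ring_1 \<Rightarrow> 'a \<Rightarrow> 'a"
  by (rule module_mult)

text \<open>As a simp rule this would reassociate all products to the left, against \<open>mult.assoc\<close>.\<close>

declare idl.scale_scale [simp del]

lemma is_ideal_ideal_gen: "is_ideal (ideal_gen S)"
  by (simp add: is_ideal_def ideal_gen_def)

text \<open>Later arguments use stability under homogeneous components; the definition speaks of
  homogeneous generators.\<close>

lemma homogeneous_ideal_iff:
  "homogeneous_ideal J \<longleftrightarrow> is_ideal J \<and> (\<forall>p\<in>J. \<forall>e. hcomp e p \<in> J)"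
proof
  assume "homogeneous_ideal J"
  then obtain S where S: "S \<subseteq> (\<Union>e. hom_piece e)" "J = idl.span S"
    by (auto simp: homogeneous_ideal_def ideal_gen_def)
  have "\<forall>e. hcomp e p \<in> idl.span S" if "p \<in> idl.span S" for p
    using that
  proof (induction rule: idl.span_induct_alt)
    case (step c x y)
    then obtain d where "x \<in> hom_piece d"
      using S by auto
    then show ?case
      using step by (auto simp: hcomp_add hcomp_mult_hom intro!: idl.span_add intro: idl.span_scale idl.span_base)
  qed (simp add: idl.span_zero)
  then show "is_ideal J \<and> (\<forall>p\<in>J. \<forall>e. hcomp e p \<in> J)"
    using S by (simp add: is_ideal_def)
next
  assume J: "is_ideal J \<and> (\<forall>p\<in>J. \<forall>e. hcomp e p \<in> J)"
  define S where "S = J \<inter> (\<Union>e. hom_piece e)"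
  have "p \<in> ideal_gen S" if "p \<in> J" for p
  proof -
    obtain N where "(\<Sum>e\<le>N. hcomp e p) = p"
      using hcomp_decomposition[of p] by blast
    moreover have "hcomp e p \<in> ideal_gen S" for e
      using J that hcomp_hom_piece[of e p] unfolding S_def ideal_gen_def by (intro idl.span_base) blast
    then have "(\<Sum>e\<le>N. hcomp e p) \<in> ideal_gen S"
      by (auto simp: ideal_gen_def intro!: idl.span_sum)
    ultimately show ?thesis by simp
  qed
  moreover have "ideal_gen S \<subseteq> J"
    using J idl.span_minimal[of S J] by (auto simp: S_def ideal_gen_def is_ideal_def)
  ultimately have "J = ideal_gen S" by blast
  then show "homogeneous_ideal J"
    by (auto simp: homogeneous_ideal_def S_def)
qed

subsection \<open>Finite generation\<close>

lemma nat_seq_incseq_subseq: "\<exists>r. strict_mono r \<and> incseq (\<lambda>n. g (r n))" for g :: "nat \<Rightarrow> nat"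
proof -
  obtain f where f: "strict_mono f" "monoseq (\<lambda>n. g (f n))"
    using seq_monosub[of g] by blast
  show ?thesis
  proof (cases "incseq (\<lambda>n. g (f n))")
    case True
    then show ?thesis using f by blast
  next
    case False
    then have dec: "decseq (\<lambda>n. g (f n))"
      using f(2) by (auto simp: monoseq_iff)
    \<comment> \<open>A decreasing sequence of natural numbers is constant once it has reached its
      minimum, and its tail is then increasing too.\<close>
    obtain N where N: "\<And>n. g (f N) \<le> g (f n)"
      using ex_has_least_nat[of "\<lambda>_. True" 0 "\<lambda>n. g (f n)"] by auto
    have "g (f (N + n)) = g (f N)" for n
      using N[of "N + n"] decseqD[OF dec, of N "N + n"] by simp
    moreover have "strict_mono (\<lambda>n. f (N + n))"
      using f(1) by (simp add: strict_mono_def)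
    ultimately show ?thesis
      by (intro exI[of _ "\<lambda>n. f (N + n)"]) (simp add: incseq_def)
  qed
qed

text \<open>Passing to a subsequence once for each variable makes all exponents increasing; any two
  of its terms then do.\<close>

lemma dickson:
  fixes f :: "nat \<Rightarrow> 'x::finite \<Rightarrow>\<^sub>0 nat"
  obtains i j where "i < j" "\<And>x. coef (f i) x \<le> coef (f j) x"
proof -
  have "\<exists>r. strict_mono r \<and> (\<forall>x\<in>V. incseq (\<lambda>n. coef (f (r n)) x))" if "finite V" for V
    using that
  proof (induction V)
    case empty
    then show ?case
      using strict_mono_id by auto
  next
    case (insert v V)
    then obtain r where r: "strict_mono r" "\<forall>x\<in>V. incseq (\<lambda>n. coef (f (r n)) x)"
      by blast
    obtain q where q: "strict_mono q" "incseq (\<lambda>n. coef (f (r (q n))) v)"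
      using nat_seq_incseq_subseq[of "\<lambda>n. coef (f (r n)) v"] by blast
    have "strict_mono (r \<circ> q)"
      using r(1) q(1) by (simp add: strict_mono_o)
    moreover have "incseq (\<lambda>n. coef (f ((r \<circ> q) n)) x)" if "x \<in> insert v V" for x
      using that r(2) q strict_mono_mono[OF q(1)] by (auto simp: incseq_def mono_def)
    ultimately show ?case by blast
  qed
  from this[of UNIV] obtain r where "strict_mono r" "\<forall>x. incseq (\<lambda>n. coef (f (r n)) x)"
    by auto
  then show ?thesis
    using that[of "r 0" "r 1"] by (auto simp: strict_mono_def incseq_def)
qed

text \<open>The lexicographic order. The type of variables carries no order of its own, so
  \<open>to_nat\<close> orders them.\<close>

definition lexless :: "('x::finite \<Rightarrow>\<^sub>0 nat) \<Rightarrow> ('x \<Rightarrow>\<^sub>0 nat) \<Rightarrow> bool"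
  where "lexless t u \<longleftrightarrow>
    (\<exists>x. coef t x < coef u x \<and> (\<forall>y. to_nat y < to_nat x \<longrightarrow> coef t y = coef u y))"

lemma lexless_trans: "lexless t u \<Longrightarrow> lexless u w \<Longrightarrow> lexless t w"
proof -
  assume "lexless t u" "lexless u w"
  then obtain x y where xy: "coef t x < coef u x" "\<forall>z. to_nat z < to_nat x \<longrightarrow> coef t z = coef u z"
    "coef u y < coef w y" "\<forall>z. to_nat z < to_nat y \<longrightarrow> coef u z = coef w z"
    by (auto simp: lexless_def)
  consider "to_nat x < to_nat y" | "to_nat y < to_nat x" | "x = y"
    using inj_to_nat by (metis injD linorder_neqE_nat)
  then show ?thesis
  proof cases
    case 1
    with xy show ?thesis
      unfolding lexless_def by (intro exI[of _ x]) auto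
  next
    case 2
    with xy show ?thesis
      unfolding lexless_def by (intro exI[of _ y]) auto
  next
    case 3
    with xy show ?thesis
      unfolding lexless_def by (intro exI[of _ x]) auto
  qed
qed

lemma lexless_total: "t \<noteq> u \<Longrightarrow> lexless t u \<or> lexless u t"
proof -
  assume "t \<noteq> u"
  then obtain x0 where "coef t x0 \<noteq> coef u x0"
    by (meson poly_mapping_eqI)
  then obtain x where x: "coef t x \<noteq> coef u x" "\<And>y. coef t y \<noteq> coef u y \<Longrightarrow> to_nat x \<le> to_nat y"
    using ex_has_least_nat[of "\<lambda>x. coef t x \<noteq> coef u x" x0 to_nat] by blast
  then have "\<forall>y. to_nat y < to_nat x \<longrightarrow> coef t y = coef u y"
    by (meson not_le)
  moreover have "coef t x < coef u x \<or> coef u x < coef t x"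
    using x(1) by linarith
  ultimately show ?thesis
    unfolding lexless_def by metis
qed

lemma lexless_add: "lexless t u \<Longrightarrow> lexless (s + t) (s + u)"
  by (auto simp: lexless_def lookup_add)

lemma not_lexless_if_le: "(\<And>x. coef t x \<le> coef u x) \<Longrightarrow> \<not> lexless u t"
  by (auto simp: lexless_def not_less)

text \<open>In an infinite descent, Dickson's lemma finds an earlier term that divides a later one,
  whereas a divisor is never lexicographically larger.\<close>

lemma wf_lexless: "wf {(t :: 'x::finite \<Rightarrow>\<^sub>0 nat, u). lexless t u}"
proof (rule ccontr)
  assume "\<not> ?thesis"
  then obtain f :: "nat \<Rightarrow> 'x \<Rightarrow>\<^sub>0 nat" where f: "\<forall>i. lexless (f (Suc i)) (f i)"
    unfolding wf_iff_no_infinite_down_chain by auto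
  have less: "lexless (f j) (f i)" if "i < j" for i j
    using that by (induction rule: less_Suc_induct) (auto intro: f[rule_format] lexless_trans)
  obtain i j where "i < j" "\<And>x. coef (f i) x \<le> coef (f j) x"
    using dickson[of f] by blast
  then show False
    using less not_lexless_if_le by blast
qed

lemma leading_monomial_exists:
  assumes "p \<noteq> 0"
  shows "\<exists>t\<in>keys p. \<forall>u\<in>keys p. u = t \<or> lexless u t"
proof -
  have "\<exists>t\<in>A. \<forall>u\<in>A. u = t \<or> lexless u t"
    if "finite A" "A \<noteq> {}" for A :: "('a::finite \<Rightarrow>\<^sub>0 nat) set"
    using that
  proof (induction A rule: finite_ne_induct)
    case (insert x A)
    then obtain t where t: "t \<in> A" "\<forall>u\<in>A. u = t \<or> lexless u t"
      by blast
    show ?case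
    proof (cases "lexless t x")
      case True
      then have "\<forall>u\<in>insert x A. u = x \<or> lexless u x"
        using t True by (auto intro: lexless_trans)
      then show ?thesis by blast
    next
      case False
      then have "\<forall>u\<in>insert x A. u = t \<or> lexless u t"
        using t False lexless_total[of t x] by auto
      then show ?thesis using t by blast
    qed
  qed auto
  then show ?thesis
    using assms by simp
qed

section \<open>Leading monomials and Hilbert's basis theorem\<close>

definition lmon :: "('x::finite, 'k::field) mpoly \<Rightarrow> ('x \<Rightarrow>\<^sub>0 nat)"
  where "lmon p = (SOME t. t \<in> keys p \<and> (\<forall>u\<in>keys p. u = t \<or> lexless u t))"

lemma lmon:
  assumes "p \<noteq> 0"
  shows "lmon p \<in> keys p" "\<And>u. u \<in> keys p \<Longrightarrow> u = lmon p \<or> lexless u (lmon p)"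
proof -
  have "lmon p \<in> keys p \<and> (\<forall>u\<in>keys p. u = lmon p \<or> lexless u (lmon p))"
    unfolding lmon_def by (rule someI_ex) (use leading_monomial_exists[OF assms] in blast)
  then show "lmon p \<in> keys p" "\<And>u. u \<in> keys p \<Longrightarrow> u = lmon p \<or> lexless u (lmon p)"
    by auto
qed

text \<open>If \<open>I\<close> were not finitely generated, one could go on choosing an element
  outside the ideal generated so far, each time with least leading monomial. By Dickson's lemma some
  leading monomial divides a later one; cancelling the later leading term leaves an element outside
  the same ideal with a smaller leading monomial.\<close>

theorem hilbert_basis:
  fixes I :: "('x::finite, 'k::field) mpoly set"
  assumes I: "is_ideal I"
  shows "\<exists>S. finite S \<and> S \<subseteq> I \<and> ideal_gen S = I"
proof (rule ccontr)
  assume nfg: "\<nexists>S. finite S \<and> S \<subseteq> I \<and> ideal_gen S = I"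
  have sub: "idl.subspace I"
    using I by (simp add: is_ideal_def)
  define good where "good S p \<longleftrightarrow> p \<in> I - ideal_gen S \<and> (\<forall>q\<in>I - ideal_gen S. \<not> lexless (lmon q) (lmon p))"
    for S p
  have ex: "\<exists>p. good S p" if S: "finite S" "S \<subseteq> I" for S
  proof -
    have "ideal_gen S \<subseteq> I"
      using that idl.span_minimal sub by (simp add: ideal_gen_def)
    then obtain p0 where "p0 \<in> I - ideal_gen S"
      using nfg S by blast
    then have "lmon p0 \<in> lmon ` (I - ideal_gen S)"
      by blast
    then obtain t where t: "t \<in> lmon ` (I - ideal_gen S)"
      "\<And>u. (u, t) \<in> {(t, u). lexless t u} \<Longrightarrow> u \<notin> lmon ` (I - ideal_gen S)"
      using wfE_min[OF wf_lexless] by metis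
    obtain p where p: "p \<in> I - ideal_gen S" "t = lmon p"
      using t(1) by blast
    have "\<not> lexless (lmon q) (lmon p)" if "q \<in> I - ideal_gen S" for q
      using t(2)[of "lmon q"] p(2) that by auto
    then show ?thesis
      using p(1) unfolding good_def by blast
  qed
  define pick where "pick S = (SOME p. good S p)" for S
  define L where "L n = ((\<lambda>S. insert (pick S) S) ^^ n) {}" for n
  have L: "finite (L n) \<and> L n \<subseteq> I" for n
  proof (induction n)
    case (Suc n)
    then have "good (L n) (pick (L n))"
      unfolding pick_def by (metis ex someI_ex)
    with Suc show ?case
      by (auto simp: L_def good_def)
  qed (simp add: L_def)
  have pick: "good (L n) (pick (L n))" for n
    unfolding pick_def by (metis ex L someI_ex)
  have in_L: "pick (L i) \<in> L j" if "i < j" for i j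
    using that by (induction j) (auto simp: L_def less_Suc_eq)
  obtain i j where ij: "i < j" "\<And>x. coef (lmon (pick (L i))) x \<le> coef (lmon (pick (L j))) x"
    using dickson[of "\<lambda>n. lmon (pick (L n))"] by blast
  define p r where "p = pick (L i)" and "r = pick (L j)"
  define u where "u = lmon r - lmon p"
  have lm: "lmon r = u + lmon p"
    using monomial_split[of "lmon p" "lmon r"] ij(2) by (simp add: u_def p_def r_def add.commute)
  have nz: "s \<noteq> 0" if "s \<in> I - ideal_gen T" for s T
    using that idl.span_zero[of T] by (auto simp: ideal_gen_def)
  have p: "p \<in> I" "p \<noteq> 0"
    using pick[of i] nz[of p "L i"] by (auto simp: good_def p_def)
  have r: "r \<in> I" "r \<noteq> 0" "r \<notin> ideal_gen (L j)"
    using pick[of j] nz[of r "L j"] by (auto simp: good_def r_def)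
  define c where "c = coef r (lmon r) / coef p (lmon p)"
  have cp: "coef p (lmon p) \<noteq> 0"
    using lmon(1)[OF p(2)] by (simp add: in_keys_iff)
  define q where "q = r - single u c * p"
  have "p \<in> L j"
    using in_L[OF ij(1)] by (simp add: p_def)
  then have up: "single u c * p \<in> ideal_gen (L j)"
    by (simp add: ideal_gen_def idl.span_scale idl.span_base)
  have qI: "q \<in> I"
    unfolding q_def using r(1) p(1) sub by (metis idl.subspace_diff idl.subspace_scale)
  have "q \<notin> ideal_gen (L j)"
  proof
    assume "q \<in> ideal_gen (L j)"
    then have "q + single u c * p \<in> ideal_gen (L j)"
      using up idl.span_add by (simp add: ideal_gen_def)
    then show False using r(3) by (simp add: q_def)
  qed
  with qI have q: "q \<in> I - ideal_gen (L j)" by simp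
  have qlm: "coef q (lmon r) = 0"
    using coef_single_mult_add[of u c p "lmon p"] cp by (simp add: q_def lookup_minus lm c_def)
  have "lexless w (lmon r)" if "w \<in> keys q" for w
  proof -
    have "w \<noteq> lmon r"
      using that qlm by (auto simp: in_keys_iff)
    have "w \<in> keys r \<or> w \<in> keys (single u c * p)"
      using that by (auto simp: q_def in_keys_iff lookup_minus)
    then show ?thesis
    proof
      assume "w \<in> keys r"
      then show ?thesis using lmon(2)[OF r(2)] \<open>w \<noteq> lmon r\<close> by blast
    next
      assume "w \<in> keys (single u c * p)"
      then obtain z where z: "z \<in> keys p" "w = u + z"
        using keys_mult[of "single u c" p] by (auto split: if_splits)
      then have "z \<noteq> lmon p"
        using \<open>w \<noteq> lmon r\<close> lm by auto
      then show ?thesis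
        using lmon(2)[OF p(2) z(1)] lexless_add lm z(2) by auto
    qed
  qed
  then have "lexless (lmon q) (lmon r)"
    using lmon(1) nz[OF q] by blast
  then show False
    using pick[of j] q by (auto simp: good_def r_def)
qed

subsection \<open>Graded submodules of free modules\<close>

definition vscale :: "'a::comm_ring_1 \<Rightarrow> (nat \<Rightarrow> 'a) \<Rightarrow> nat \<Rightarrow> 'a"
  where "vscale c v = (\<lambda>i. c * v i)"

text \<open>The simplifier also uses these rules without the argument and then unfolds \<open>0\<close> and \<open>+\<close> on functions.\<close>

declare plus_fun_apply [simp del] zero_fun_apply [simp del]

lemma vscale_apply: "vscale c v i = c * v i"
  by (simp add: vscale_def)

lemmas pointwise = plus_fun_apply zero_fun_apply vscale_apply

lemma sum_fun_apply: "(sum f A) x = (\<Sum>i\<in>A. f i x)"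
  by (induction A rule: infinite_finite_induct) (auto simp: pointwise)

lemma module_vscale: "module (vscale :: 'a::comm_ring_1 \<Rightarrow> _)"
proof
  fix a b :: 'a and x y :: "nat \<Rightarrow> 'a"
  show "vscale a (x + y) = vscale a x + vscale a y"
    by (simp add: vscale_def plus_fun_def distrib_left)
  show "vscale (a + b) x = vscale a x + vscale b x"
    by (simp add: vscale_def plus_fun_def distrib_right)
  show "vscale a (vscale b x) = vscale (a * b) x"
    by (rule ext) (simp only: vscale_apply mult.assoc)
  show "vscale 1 x = x"
    by (rule ext) (simp only: vscale_apply mult_1_left)
qed

interpretation vec: module "vscale :: 'a::comm_ring_1 \<Rightarrow> (nat \<Rightarrow> 'a) \<Rightarrow> (nat \<Rightarrow> 'a)"
  by (rule module_vscale)

lemma subspace_free_module: "vec.subspace (free_module r)"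
  unfolding vec.subspace_def free_module_def
  by (simp add: plus_fun_def zero_fun_def vscale_def)

text \<open>Induction on the rank: the last coordinates form an ideal, and the kernel of that
  coordinate lies in a free module of smaller rank.\<close>

lemma submodule_finitely_generated:
  fixes N :: "(nat \<Rightarrow> ('x::finite, 'k::field) mpoly) set"
  assumes "vec.subspace N" "N \<subseteq> free_module r"
  shows "\<exists>S. finite S \<and> S \<subseteq> N \<and> vec.span S = N"
  using assms
proof (induction r arbitrary: N)
  case 0
  then have "N = {0}"
    using vec.subspace_0[of N] by (auto simp: free_module_def zero_fun_def)
  then show ?case
    by (intro exI[of _ "{}"]) auto
next
  case (Suc r)
  define e where "e v = v r" for v :: "nat \<Rightarrow> ('x, 'k) mpoly"
  interpret e: module_hom "vscale :: ('x, 'k) mpoly \<Rightarrow> _" "(*)" e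
    by unfold_locales (auto simp: e_def pointwise algebra_simps)
  obtain S where S: "finite S" "S \<subseteq> e ` N" "ideal_gen S = e ` N"
    using hilbert_basis[of "e ` N"] e.subspace_image[OF Suc.prems(1)] by (auto simp: is_ideal_def)
  obtain T where T: "finite T" "T \<subseteq> N" "S = e ` T"
    using S(1,2) by (meson finite_subset_image)
  have T': "e ` vec.span T = e ` N"
    using S(3) by (simp add: T(3) ideal_gen_def e.span_image)
  define N' where "N' = N \<inter> {v. e v = 0}"
  have N': "vec.subspace N'"
    unfolding N'_def by (intro vec.subspace_inter Suc.prems e.subspace_kernel)
  have "v \<in> free_module r" if "v \<in> N'" for v
  proof -
    have "v i = 0" if "r \<le> i" for i
      using \<open>v \<in> N'\<close> Suc.prems(2) that
      by (cases "i = r") (auto simp: N'_def e_def free_module_def)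
    then show ?thesis by (simp add: free_module_def)
  qed
  then obtain S' where S': "finite S'" "S' \<subseteq> N'" "vec.span S' = N'"
    using Suc.IH[OF N'] by blast
  have "v \<in> vec.span (S' \<union> T)" if "v \<in> N" for v
  proof -
    have "e v \<in> e ` vec.span T"
      using that T' by blast
    then obtain w where w: "w \<in> vec.span T" "e v = e w"
      by blast
    have "w \<in> N"
      using w(1) vec.span_minimal[OF T(2) Suc.prems(1)] by blast
    then have "v - w \<in> N'"
      using that w(2) vec.subspace_diff[OF Suc.prems(1)] by (simp add: N'_def e.diff)
    then have "v - w \<in> vec.span (S' \<union> T)"
      using S'(3) vec.span_mono[of S' "S' \<union> T"] by auto
    moreover have "w \<in> vec.span (S' \<union> T)"
      using w(1) vec.span_mono[of T "S' \<union> T"] by auto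
    ultimately show ?thesis
      using vec.span_add by fastforce
  qed
  moreover have "S' \<union> T \<subseteq> N"
    using S'(2) T(2) by (auto simp: N'_def)
  moreover have "vec.span (S' \<union> T) \<subseteq> N"
    using \<open>S' \<union> T \<subseteq> N\<close> vec.span_minimal Suc.prems(1) by blast
  ultimately show ?case
    using S'(1) T(1) by (intro exI[of _ "S' \<union> T"]) blast
qed

text \<open>Homogeneity in the free module with shifts \<open>a\<close>. The additive form forces
  components with \<open>e < a i\<close> to vanish and avoids truncated subtraction.\<close>

definition vhom :: "(nat \<Rightarrow> nat) \<Rightarrow> nat \<Rightarrow> (nat \<Rightarrow> ('x::finite, 'k::field) mpoly) \<Rightarrow> bool"
  where "vhom a e v \<longleftrightarrow> (\<forall>i. \<forall>t\<in>keys (v i). mdeg t + a i = e)"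

definition vcomp ::
  "(nat \<Rightarrow> nat) \<Rightarrow> nat \<Rightarrow> (nat \<Rightarrow> ('x::finite, 'k::field) mpoly) \<Rightarrow> nat \<Rightarrow> ('x, 'k) mpoly"
  where "vcomp a e v = (\<lambda>i. if a i \<le> e then hcomp (e - a i) (v i) else 0)"

lemma coef_vcomp: "coef (vcomp a e v i) t = (if mdeg t + a i = e then coef (v i) t else 0)"
  by (auto simp: vcomp_def coef_hcomp)

lemma vhom_vcomp: "vhom a e (vcomp a e v)"
  by (auto simp: vhom_def in_keys_iff coef_vcomp split: if_splits)

lemma vcomp_add: "vcomp a e (v + w) = vcomp a e v + vcomp a e w"
  by (rule ext) (simp add: vcomp_def hcomp_add pointwise)

lemma vcomp_0 [simp]: "vcomp a e 0 = 0"
  by (rule ext) (simp add: vcomp_def pointwise)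

lemma vcomp_sum: "vcomp a e (sum f A) = (\<Sum>i\<in>A. vcomp a e (f i))"
  by (induction A rule: infinite_finite_induct) (simp_all add: vcomp_add)

lemma vcomp_vscale:
  assumes "vhom a d v"
  shows "vcomp a e (vscale c v) = (if d \<le> e then vscale (hcomp (e - d) c) v else 0)"
proof
  fix i
  show "vcomp a e (vscale c v) i = (if d \<le> e then vscale (hcomp (e - d) c) v else 0) i"
  proof (cases "v i = 0")
    case False
    then obtain t where "t \<in> keys (v i)"
      by (metis all_not_in_conv keys_eq_empty)
    \<comment> \<open>This makes the truncated difference of \<open>e - a i\<close> and
      \<open>d - a i\<close> equal to \<open>e - d\<close>. It is available only for a nonzero
      component; for a zero one both sides vanish.\<close>
    then have "a i \<le> d"
      using assms by (fastforce simp: vhom_def)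
    moreover have "v i \<in> hom_piece (d - a i)"
      using assms by (fastforce simp: vhom_def hom_piece_def)
    ultimately show ?thesis
      by (auto simp: vcomp_def hcomp_mult_hom pointwise intro!: arg_cong2[of _ _ _ _ hcomp])
  qed (simp add: vcomp_def pointwise)
qed

lemma sum_vcomp:
  assumes "v \<in> free_module r"
  shows "\<exists>N. (\<Sum>e\<le>N. vcomp a e v) = v"
proof -
  have "\<forall>i. \<exists>N0. \<forall>t\<in>keys (v i). mdeg t \<le> N0"
    using degree_bound_exists by blast
  then obtain D where D: "\<And>i t. t \<in> keys (v i) \<Longrightarrow> mdeg t \<le> D i"
    by metis
  define N where "N = Max (insert 0 ((\<lambda>i. D i + a i) ` {..<r}))"
  have "(\<Sum>e\<le>N. vcomp a e v) i = v i" for i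
  proof (rule poly_mapping_eqI)
    fix t
    have "coef ((\<Sum>e\<le>N. vcomp a e v) i) t = (if mdeg t + a i \<le> N then coef (v i) t else 0)"
      by (simp add: sum_fun_apply lookup_sum coef_vcomp)
    moreover have "mdeg t + a i \<le> N" if "coef (v i) t \<noteq> 0"
    proof -
      have "i < r"
        using that assms by (cases "i < r") (auto simp: free_module_def)
      then have "D i + a i \<le> N"
        by (simp add: N_def)
      then show ?thesis
        using D[of t i] that by (auto simp: in_keys_iff)
    qed
    ultimately show "coef ((\<Sum>e\<le>N. vcomp a e v) i) t = coef (v i) t"
      by auto
  qed
  then show ?thesis by blast
qed

text \<open>
  A homogeneous generating set of least cardinality is minimal in the sense of Nakayama: a unit
  coefficient in a relation would, after passing to one homogeneous component, express a generator
  by the others.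
\<close>

lemma minimal_homogeneous_generators:
  fixes N :: "(nat \<Rightarrow> ('x::finite, 'k::field) mpoly) set"
  assumes N: "vec.subspace N" "N \<subseteq> free_module m"
    and graded: "\<And>v e. v \<in> N \<Longrightarrow> vcomp a e v \<in> N"
  shows "\<exists>r b A. (\<forall>l<r. A l \<in> N \<and> vhom a (b l) (A l)) \<and>
    (\<forall>v\<in>N. \<exists>w\<in>free_module r. v = (\<Sum>l<r. vscale (w l) (A l))) \<and>
    (\<forall>w l. (\<Sum>l<r. vscale (w l) (A l)) = 0 \<longrightarrow> l < r \<longrightarrow> coef (w l) 0 = 0)"
proof -
  define gens where "gens S \<longleftrightarrow> finite S \<and> S \<subseteq> N \<and> vec.span S = N \<and> (\<forall>v\<in>S. \<exists>e. vhom a e v)" for S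
  have "\<exists>S. gens S"
  proof -
    obtain S where S: "finite S" "S \<subseteq> N" "vec.span S = N"
      using submodule_finitely_generated[OF N] by blast
    have "\<forall>v\<in>S. \<exists>M. (\<Sum>e\<le>M. vcomp a e v) = v"
      using S(2) N(2) sum_vcomp by blast
    then obtain M where M: "\<And>v. v \<in> S \<Longrightarrow> (\<Sum>e\<le>M v. vcomp a e v) = v"
      by metis
    define S' where "S' = (\<Union>v\<in>S. (\<lambda>e. vcomp a e v) ` {..M v})"
    have "S' \<subseteq> N"
      using S(2) graded by (auto simp: S'_def)
    have "S \<subseteq> vec.span S'"
    proof
      fix v assume "v \<in> S"
      then have "(\<Sum>e\<le>M v. vcomp a e v) \<in> vec.span S'"
        by (intro vec.span_sum vec.span_base) (auto simp: S'_def)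
      then show "v \<in> vec.span S'"
        using M[OF \<open>v \<in> S\<close>] by simp
    qed
    then have "vec.span S' = N"
      using S(3) \<open>S' \<subseteq> N\<close> N(1) vec.span_minimal vec.subspace_span by (metis subset_antisym)
    moreover have "\<forall>v\<in>S'. \<exists>e. vhom a e v"
      using vhom_vcomp by (auto simp: S'_def)
    moreover have "finite S'"
      using S(1) by (simp add: S'_def)
    ultimately show ?thesis
      using \<open>S' \<subseteq> N\<close> unfolding gens_def by blast
  qed
  then obtain S where S: "gens S" "\<And>T. gens T \<Longrightarrow> card S \<le> card T"
    using ex_has_least_nat[of gens _ card] by blast
  then have S': "finite S" "S \<subseteq> N" "vec.span S = N" "\<forall>v\<in>S. \<exists>e. vhom a e v"
    by (auto simp: gens_def)
  obtain B where B: "\<And>v. v \<in> S \<Longrightarrow> vhom a (B v) v"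
    using S'(4) by metis
  have min: "coef (w s) 0 = 0" if rel: "(\<Sum>v\<in>S. vscale (w v) v) = 0" and s: "s \<in> S" for w s
  proof (rule ccontr)
    assume nz: "coef (w s) 0 \<noteq> 0"
    define w' where "w' v = (if B v \<le> B s then hcomp (B s - B v) (w v) else 0)" for v
    define c where "c = coef (w s) 0"
    have w's: "w' s = single 0 c"
      by (rule poly_mapping_eqI)
        (auto simp: w'_def c_def coef_hcomp mdeg_eq_0_iff lookup_single when_def)
    have "vcomp a (B s) (\<Sum>v\<in>S. vscale (w v) v) = (\<Sum>v\<in>S. vscale (w' v) v)"
      by (simp add: vcomp_sum) (auto intro!: sum.cong simp: vcomp_vscale[OF B] w'_def zero_fun_def)
    then have "(\<Sum>v\<in>S. vscale (w' v) v) = 0"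
      using rel by simp
    then have rel': "vscale (single 0 c) s + (\<Sum>v\<in>S - {s}. vscale (w' v) v) = 0"
      using s S'(1) by (simp add: sum.remove[of S s] w's)
    have "s = vscale (single 0 (1 / c) * single 0 c) s"
      using nz by (simp add: mult_single c_def)
    also have "\<dots> = vscale (single 0 (1 / c)) (- (\<Sum>v\<in>S - {s}. vscale (w' v) v))"
      by (simp only: vec.scale_scale[symmetric] rel'[folded eq_neg_iff_add_eq_0])
    also have "\<dots> \<in> vec.span (S - {s})"
      by (intro vec.span_scale vec.span_neg vec.span_sum vec.span_base) auto
    finally have "s \<in> vec.span (S - {s})" .
    then have "S \<subseteq> vec.span (S - {s})"
      using vec.span_superset[of "S - {s}"] by auto
    then have "N \<subseteq> vec.span (S - {s})"
      using S'(3) vec.span_minimal vec.subspace_span by blast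
    moreover have "vec.span (S - {s}) \<subseteq> N"
      using S'(3) vec.span_mono by blast
    ultimately have "gens (S - {s})"
      using S' by (auto simp: gens_def)
    then show False
      using S(2)[of "S - {s}"] s S'(1) by (metis card_Diff1_less leD)
  qed
  obtain A where A: "bij_betw A {..<card S} S"
    using ex_bij_betw_nat_finite[OF S'(1)] by (auto simp: atLeast0LessThan)
  have AS: "A l \<in> S" if "l < card S" for l
    using A that by (auto simp: bij_betw_def)
  have reindex: "(\<Sum>v\<in>S. vscale (u v) v) = (\<Sum>l<card S. vscale (u (A l)) (A l))" for u
    using sum.reindex_bij_betw[OF A, of "\<lambda>v. vscale (u v) v"] by simp
  show ?thesis
  proof (intro exI[of _ "card S"] exI[of _ "B \<circ> A"] exI[of _ A] conjI allI impI ballI)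
    show "A l \<in> N" if "l < card S" for l
      using AS[OF that] S'(2) by blast
    show "vhom a ((B \<circ> A) l) (A l)" if "l < card S" for l
      using AS[OF that] B by simp
    show "\<exists>w\<in>free_module (card S). v = (\<Sum>l<card S. vscale (w l) (A l))" if "v \<in> N" for v
    proof -
      have "v \<in> range (\<lambda>u. \<Sum>x\<in>S. vscale (u x) x)"
        using that S'(3) vec.span_finite[OF S'(1)] by simp
      then obtain u where "v = (\<Sum>x\<in>S. vscale (u x) x)"
        by blast
      then have "v = (\<Sum>l<card S. vscale ((\<lambda>l. if l < card S then u (A l) else 0) l) (A l))"
        by (simp add: reindex)
      moreover have "(\<lambda>l. if l < card S then u (A l) else 0) \<in> free_module (card S)"
        by (simp add: free_module_def)
      ultimately show ?thesis by (intro bexI)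
    qed
    show "coef (w l) 0 = 0" if "(\<Sum>l<card S. vscale (w l) (A l)) = 0" "l < card S" for w l
    proof -
      define u where "u v = w (the_inv_into {..<card S} A v)" for v
      have u: "u (A l) = w l" if "l < card S" for l
        using A that by (simp add: u_def bij_betw_def the_inv_into_f_f)
      then have "(\<Sum>v\<in>S. vscale (u v) v) = 0"
        using that(1) by (simp add: reindex)
      then show ?thesis
        using min[OF _ AS[OF that(2)], of u] u[OF that(2)] by simp
    qed
  qed
qed

subsection \<open>The Koszul complex of the variables\<close>

text \<open>
  A Koszul chain assigns to a set of variables the coefficient of the corresponding wedge product.
  The differential \<open>kd\<close> contracts with the variables, and \<open>ks g\<close> is the exterior multiplication by
  \<open>\<Sum>\<^sub>i g\<^sub>i e\<^sub>i\<close>.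
\<close>

definition ksgn :: "'x::finite set \<Rightarrow> 'x \<Rightarrow> 'a::comm_ring_1"
  where "ksgn S i = (- 1) ^ card {j \<in> S. to_nat j < to_nat i}"

definition kd :: "('x::finite set \<Rightarrow> ('x, 'k::field) mpoly) \<Rightarrow> 'x set \<Rightarrow> ('x, 'k) mpoly"
  where "kd c S = (\<Sum>i\<in>- S. ksgn S i * pvar i * c (insert i S))"

definition ks :: "('x::finite \<Rightarrow> ('x, 'k::field) mpoly) \<Rightarrow> ('x set \<Rightarrow> ('x, 'k) mpoly) \<Rightarrow> 'x set \<Rightarrow> ('x, 'k) mpoly"
  where "ks g c S = (\<Sum>i\<in>S. ksgn S i * g i * c (S - {i}))"

definition kchain :: "nat \<Rightarrow> ('x::finite set \<Rightarrow> 'b::zero) \<Rightarrow> bool"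
  where "kchain q c \<longleftrightarrow> (\<forall>S. card S \<noteq> q \<longrightarrow> c S = 0)"

lemma ksgn_cases: "(ksgn S i :: 'a::comm_ring_1) = 1 \<or> ksgn S i = - (1 :: 'a)" for S :: "'x::finite set"
  by (cases "even (card {j \<in> S. to_nat j < to_nat i})") (simp_all add: ksgn_def)

lemma ksgn_square [simp]: "(ksgn S i :: 'a::comm_ring_1) * ksgn S i = 1" for S :: "'x::finite set"
  using ksgn_cases[of S i, where 'a = 'a] by auto

lemma ksgn_insert:
  fixes S :: "'x::finite set"
  assumes "j \<notin> S"
  shows "(ksgn (insert j S) i :: 'a::comm_ring_1) = (if to_nat j < to_nat i then - ksgn S i else ksgn S i)"
proof (cases "to_nat j < to_nat i")
  case True
  then have "{l \<in> insert j S. to_nat l < to_nat i} = insert j {l \<in> S. to_nat l < to_nat i}"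
    by auto
  then show ?thesis
    using True assms by (simp add: ksgn_def)
next
  case False
  then have "{l \<in> insert j S. to_nat l < to_nat i} = {l \<in> S. to_nat l < to_nat i}"
    by auto
  then show ?thesis
    using False by (simp add: ksgn_def)
qed

lemma ksgn_self [simp]: "ksgn (insert i S) i = ksgn S i" "ksgn (S - {i}) i = ksgn S i"
  by (auto simp: ksgn_def intro!: arg_cong[of _ _ "\<lambda>A. (- 1) ^ card A"])

lemma to_nat_neq: "i \<noteq> j \<Longrightarrow> to_nat i < to_nat j \<or> to_nat j < to_nat i"
  by (metis inj_to_nat injD linorder_neqE_nat)

text \<open>Exactly one of \<open>i\<close> and \<open>j\<close> precedes the other, so exactly one
  order of insertion picks up an extra sign. Hence \<open>kd\<close> squares to zero.\<close>

lemma ksgn_swap: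
  assumes "i \<noteq> j" "i \<notin> S" "j \<notin> S"
  shows "ksgn S i * ksgn (insert i S) j = - (ksgn S j * ksgn (insert j S) i)"
  using to_nat_neq[OF assms(1)] assms by (auto simp: ksgn_insert mult.commute)

text \<open>The analogue for inserting \<open>i\<close> and removing \<open>j\<close>; it cancels
  the mixed terms in \<open>koszul_homotopy\<close>.\<close>

lemma ksgn_swap':
  assumes "i \<notin> S" "j \<in> S"
  shows "ksgn S i * ksgn (insert i S) j = - (ksgn S j * ksgn (S - {j}) i)"
proof -
  define R where "R = S - {j}"
  have R: "S = insert j R" "j \<notin> R" "i \<notin> R" "i \<noteq> j"
    using assms by (auto simp: R_def)
  then have "insert i S = insert j (insert i R)"
    by auto
  then have "ksgn (insert i S) j = (ksgn (insert i R) j :: 'b)"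
    by simp
  then show ?thesis
    using R to_nat_neq[OF R(4)] by (auto simp: ksgn_insert mult.commute)
qed

text \<open>The diagonal is required to vanish separately because antisymmetry does not force this
  in characteristic two.\<close>

lemma sum_antisymmetric:
  fixes T :: "'a \<Rightarrow> 'a \<Rightarrow> 'b::ab_group_add"
  assumes "finite A" "\<And>i. T i i = 0" "\<And>i j. i \<in> A \<Longrightarrow> j \<in> A \<Longrightarrow> i \<noteq> j \<Longrightarrow> T i j = - T j i"
  shows "(\<Sum>i\<in>A. \<Sum>j\<in>A. T i j) = 0"
  using assms(1,3)
proof (induction A)
  case (insert x A)
  have "(\<Sum>j\<in>A. T x j) = (\<Sum>j\<in>A. - T j x)"
    by (rule sum.cong[OF refl], rule insert.prems) (use insert.hyps in auto)
  then have 1: "(\<Sum>j\<in>A. T x j) + (\<Sum>j\<in>A. T j x) = 0"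
    by (simp add: sum_negf)
  have 2: "(\<Sum>i\<in>A. \<Sum>j\<in>A. T i j) = 0"
    by (rule insert.IH, rule insert.prems) auto
  have "(\<Sum>i\<in>insert x A. \<Sum>j\<in>insert x A. T i j)
      = T x x + ((\<Sum>j\<in>A. T x j) + (\<Sum>j\<in>A. T j x)) + (\<Sum>i\<in>A. \<Sum>j\<in>A. T i j)"
    using insert.hyps by (simp add: sum.distrib add.assoc)
  then show ?case
    using 1 2 assms(2) by simp
qed simp

lemma kd_kd: "kd (kd c) S = 0"
proof -
  define T where "T i j = (if i = j then 0 else
    (ksgn S i * ksgn (insert i S) j) * (pvar i * pvar j * c (insert j (insert i S))))" for i j
  have "ksgn S i * pvar i * kd c (insert i S) = (\<Sum>j\<in>- S. T i j)" if "i \<in> - S" for i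
  proof -
    have "- S = insert i (- insert i S)" "i \<notin> - insert i S"
      using that by auto
    then have "(\<Sum>j\<in>- S. T i j) = (\<Sum>j\<in>insert i (- insert i S). T i j)"
      by simp
    also have "\<dots> = (\<Sum>j\<in>- insert i S. T i j)"
      by (simp add: T_def)
    also have "\<dots> = ksgn S i * pvar i * kd c (insert i S)"
      unfolding kd_def sum_distrib_left by (rule sum.cong) (auto simp: T_def ac_simps)
    finally show ?thesis by simp
  qed
  then have "kd (kd c) S = (\<Sum>i\<in>- S. \<Sum>j\<in>- S. T i j)"
    unfolding kd_def[of "kd c"] by simp
  also have "\<dots> = 0"
  proof (rule sum_antisymmetric)
    fix i j assume ij: "i \<in> - S" "j \<in> - S" "i \<noteq> j"
    then have "(ksgn S i * ksgn (insert i S) j :: ('a, 'b) mpoly) = - (ksgn S j * ksgn (insert j S) i)"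
      by (intro ksgn_swap) auto
    then show "T i j = - T j i"
      using ij by (simp add: T_def insert_commute mult.commute)
  qed (auto simp: T_def)
  finally show ?thesis .
qed

text \<open>Contraction and exterior multiplication anticommute up to the pairing of the two
  vectors: putting in and taking out the same index gives the right-hand side, and distinct indices
  cancel. By \<open>pvar_decomposition\<close> every element of the irrelevant ideal has the form of
  the factor on the right, so it acts as zero on Koszul homology.\<close>

lemma koszul_homotopy: "kd (ks g c) S + ks g (kd c) S = (\<Sum>i\<in>UNIV. g i * pvar i) * c S"
proof -
  define T where "T i j = pvar i * g j * c (insert i (S - {j}))" for i j
  have 1: "ksgn S i * pvar i * ks g c (insert i S)
      = g i * pvar i * c S + (\<Sum>j\<in>S. (ksgn S i * ksgn (insert i S) j) * T i j)" if "i \<in> - S" for i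
  proof -
    have "ks g c (insert i S) = ksgn S i * g i * c S
        + (\<Sum>j\<in>S. ksgn (insert i S) j * g j * c (insert i (S - {j})))"
      unfolding ks_def using that
      by (subst sum.insert) (auto intro!: sum.cong arg_cong2[of _ _ _ _ "(+)"] arg_cong2[of _ _ _ _ "(*)"]
          arg_cong[of _ _ c])
    moreover have "ksgn S i * pvar i * (ksgn S i * g i * c S) = (ksgn S i * ksgn S i) * (g i * pvar i * c S)"
      by (simp only: ac_simps)
    moreover have "ksgn S i * pvar i * (\<Sum>j\<in>S. ksgn (insert i S) j * g j * c (insert i (S - {j})))
        = (\<Sum>j\<in>S. (ksgn S i * ksgn (insert i S) j) * T i j)"
      unfolding sum_distrib_left by (rule sum.cong) (auto simp: T_def ac_simps)
    ultimately show ?thesis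
      by (simp add: distrib_left)
  qed
  have 2: "ksgn S j * g j * kd c (S - {j})
      = g j * pvar j * c S + (\<Sum>i\<in>- S. (ksgn S j * ksgn (S - {j}) i) * T i j)" if "j \<in> S" for j
  proof -
    have "- (S - {j}) = insert j (- S)" "insert j (S - {j}) = S"
      using that by auto
    then have "kd c (S - {j}) = ksgn S j * pvar j * c S
        + (\<Sum>i\<in>- S. ksgn (S - {j}) i * pvar i * c (insert i (S - {j})))"
      unfolding kd_def using that by simp
    moreover have "ksgn S j * g j * (ksgn S j * pvar j * c S) = (ksgn S j * ksgn S j) * (g j * pvar j * c S)"
      by (simp only: ac_simps)
    moreover have "ksgn S j * g j * (\<Sum>i\<in>- S. ksgn (S - {j}) i * pvar i * c (insert i (S - {j})))
        = (\<Sum>i\<in>- S. (ksgn S j * ksgn (S - {j}) i) * T i j)"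
      unfolding sum_distrib_left by (rule sum.cong) (auto simp: T_def ac_simps)
    ultimately show ?thesis
      by (simp add: distrib_left)
  qed
  have "kd (ks g c) S = (\<Sum>i\<in>- S. g i * pvar i * c S)
      + (\<Sum>i\<in>- S. \<Sum>j\<in>S. (ksgn S i * ksgn (insert i S) j) * T i j)"
    unfolding kd_def[of "ks g c"] using 1 by (simp add: sum.distrib)
  moreover have "ks g (kd c) S = (\<Sum>j\<in>S. g j * pvar j * c S)
      + (\<Sum>j\<in>S. \<Sum>i\<in>- S. (ksgn S j * ksgn (S - {j}) i) * T i j)"
    unfolding ks_def[of g "kd c"] using 2 by (simp add: sum.distrib)
  moreover have "(\<Sum>j\<in>S. \<Sum>i\<in>- S. (ksgn S j * ksgn (S - {j}) i) * T i j)
      = - (\<Sum>i\<in>- S. \<Sum>j\<in>S. (ksgn S i * ksgn (insert i S) j) * T i j)"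
    by (subst sum.swap) (auto simp: sum_negf[symmetric] ksgn_swap' intro!: sum.cong)
  moreover have "(\<Sum>i\<in>UNIV. g i * pvar i) * c S = (\<Sum>i\<in>- S. g i * pvar i * c S) + (\<Sum>i\<in>S. g i * pvar i * c S)"
  proof -
    have "(\<Sum>i\<in>UNIV. g i * pvar i) * c S = (\<Sum>i\<in>S \<union> - S. g i * pvar i * c S)"
      by (simp add: sum_distrib_right)
    then show ?thesis
      by (subst (asm) sum.union_disjoint) (auto simp: add.commute)
  qed
  ultimately show ?thesis
    by simp
qed

lemma kd_add: "kd (\<lambda>S. c S + e S) S = kd c S + kd e S"
  by (simp add: kd_def distrib_left sum.distrib)

lemma kd_minus: "kd (\<lambda>S. c S - e S) S = kd c S - kd e S"
  by (simp add: kd_def right_diff_distrib sum_subtractf)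

lemma kd_mult: "kd (\<lambda>S. c S * p) S = kd c S * p"
  by (simp add: kd_def sum_distrib_right mult.assoc)

lemma kd_mult_left: "kd (\<lambda>S. p * c S) S = p * kd c S"
  using kd_mult[of c p S] by (simp add: mult.commute)

lemma kd_0 [simp]: "kd (\<lambda>_. 0) S = 0"
  by (simp add: kd_def)

lemma kd_sum: "kd (\<lambda>S. \<Sum>l\<in>A. f l S) S = (\<Sum>l\<in>A. kd (f l) S)"
  by (induction A rule: infinite_finite_induct) (simp_all add: kd_add)

lemma kd_in_ideal: "is_ideal I \<Longrightarrow> (\<And>S. c S \<in> I) \<Longrightarrow> kd c S \<in> I"
  unfolding kd_def is_ideal_def by (intro idl.subspace_sum idl.subspace_scale)

lemma ks_in_ideal: "is_ideal I \<Longrightarrow> (\<And>S. c S \<in> I) \<Longrightarrow> ks g c S \<in> I"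
  unfolding ks_def is_ideal_def by (intro idl.subspace_sum idl.subspace_scale)

lemma kchain_kd: "kchain (Suc q) c \<Longrightarrow> kchain q (kd c)"
  unfolding kchain_def kd_def by (auto intro!: sum.neutral)

lemma kchain_ks:
  fixes c :: "'x::finite set \<Rightarrow> ('x, 'k::field) mpoly"
  shows "kchain q c \<Longrightarrow> kchain (Suc q) (ks g c)"
  unfolding kchain_def ks_def
proof (intro allI impI sum.neutral ballI)
  fix S :: "'x set" and x assume c: "\<forall>S. card S \<noteq> q \<longrightarrow> c S = 0" and S: "card S \<noteq> Suc q" "x \<in> S"
  have "Suc (card (S - {x})) = card S"
    by (rule card_Suc_Diff1) (use S in auto)
  then have "card (S - {x}) \<noteq> q"
    using S by auto
  then show "ksgn S x * g x * c (S - {x}) = 0"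
    using c by simp
qed

subsection \<open>Exactness of the Koszul complex of the polynomial ring\<close>

definition above :: "'x::finite \<Rightarrow> ('x \<Rightarrow>\<^sub>0 nat) \<Rightarrow> bool"
  where "above v t \<longleftrightarrow> (\<forall>u. coef t u \<noteq> 0 \<longrightarrow> to_nat v \<le> to_nat u)"

text \<open>Division by \<open>v\<close> of those terms whose least variable is \<open>v\<close>; all other terms are dropped.\<close>

lift_definition divmin :: "'x::finite \<Rightarrow> ('x, 'k::field) mpoly \<Rightarrow> ('x, 'k) mpoly"
  is "\<lambda>v p t. if above v t then p (t + single v 1) else 0"
proof -
  fix v :: 'x and p :: "('x \<Rightarrow>\<^sub>0 nat) \<Rightarrow> 'k"
  assume "finite {t. p t \<noteq> 0}"
  moreover have "inj (\<lambda>t. t + single v (1 :: nat))"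
    by (rule injI) simp
  ultimately have "finite ((\<lambda>t. t + single v 1) -` {t. p t \<noteq> 0})"
    by (rule finite_vimageI)
  then show "finite {t. (if above v t then p (t + single v 1) else 0) \<noteq> 0}"
    by (rule rev_finite_subset) auto
qed

lemma coef_divmin: "coef (divmin v p) t = (if above v t then coef p (t + single v 1) else 0)"
  by transfer simp

lemma divmin_add: "divmin v (p + q) = divmin v p + divmin v q"
  by (rule poly_mapping_eqI) (simp add: coef_divmin lookup_add)

lemma divmin_0 [simp]: "divmin v 0 = 0"
  by (rule poly_mapping_eqI) (simp add: coef_divmin)

lemma divmin_uminus: "divmin v (- p) = - divmin v p"
  by (rule poly_mapping_eqI) (simp add: coef_divmin)

lemma divmin_sum: "divmin v (sum f A) = (\<Sum>i\<in>A. divmin v (f i))"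
  by (induction A rule: infinite_finite_induct) (simp_all add: divmin_add)

lemma divmin_ksgn: "divmin v (ksgn S i * p) = ksgn S i * divmin v p"
  using ksgn_cases[of S i, where 'a = "('a, 'b) mpoly"] by (auto simp: divmin_uminus)

lemma coef_pvar_divmin:
  "coef (pvar i * divmin i p) t = (if coef t i \<noteq> 0 \<and> above i t then coef p t else 0)"
proof (cases "coef t i = 0")
  case False
  then have "t - single i 1 + single i 1 = t"
    by (intro poly_mapping_eqI) (auto simp: lookup_add lookup_minus lookup_single when_def)
  moreover have "above i (t - single i 1) \<longleftrightarrow> above i t"
    unfolding above_def by (auto simp: lookup_minus lookup_single when_def split: if_splits)
  ultimately show ?thesis
    using False by (simp add: coef_pvar_mult coef_divmin)
qed (simp add: coef_pvar_mult)

lemma divmin_pvar_self: "coef (divmin v (pvar v * p)) t = (if above v t then coef p t else 0)"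
  by (simp add: coef_divmin coef_pvar_mult lookup_add)

lemma divmin_pvar_less:
  assumes "to_nat i < to_nat v"
  shows "divmin v (pvar i * p) = 0"
proof (rule poly_mapping_eqI)
  fix t
  have "coef (t + single v 1) i = 0" if "above v t"
    using that assms by (auto simp: above_def lookup_add lookup_single when_def)
  then show "coef (divmin v (pvar i * p)) t = coef 0 t"
    by (simp add: coef_divmin coef_pvar_mult)
qed

lemma divmin_pvar_greater:
  assumes "to_nat v < to_nat i"
  shows "divmin v (pvar i * p) = pvar i * divmin v p"
proof (rule poly_mapping_eqI)
  fix t
  have vi: "v \<noteq> i" using assms by auto
  show "coef (divmin v (pvar i * p)) t = coef (pvar i * divmin v p) t"
  proof (cases "coef t i = 0")
    case False
    have "t + single v 1 - single i 1 = t - single i 1 + single v 1"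
      using False vi by (intro poly_mapping_eqI) (auto simp: lookup_add lookup_minus lookup_single when_def)
    moreover have "above v (t - single i 1) \<longleftrightarrow> above v t"
    proof -
      have c: "coef (t - single i 1) u = (if u = i then coef t u - 1 else coef t u)" for u
        by (simp add: lookup_minus lookup_single when_def)
      show ?thesis
      proof
        assume *: "above v (t - single i 1)"
        show "above v t"
          unfolding above_def
        proof (intro allI impI)
          fix u assume "coef t u \<noteq> 0"
          then show "to_nat v \<le> to_nat u"
            using * c[of u] assms by (cases "u = i") (auto simp: above_def)
        qed
      next
        assume *: "above v t"
        show "above v (t - single i 1)"
          unfolding above_def
        proof (intro allI impI)
          fix u assume "coef (t - single i 1) u \<noteq> 0"
          then have "coef t u \<noteq> 0"
            using c[of u] by (cases "u = i") auto
          then show "to_nat v \<le> to_nat u"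
            using * by (auto simp: above_def)
        qed
      qed
    qed
    ultimately show ?thesis
      using False vi by (simp add: coef_divmin coef_pvar_mult lookup_add)
  qed (use vi in \<open>simp add: coef_divmin coef_pvar_mult lookup_add lookup_single\<close>)
qed

text \<open>Only the least variable of \<open>t\<close> contributes, and it lies in \<open>V\<close>
  because \<open>V\<close> is closed downward. The lemma is used for all variables and for an
  initial segment.\<close>

lemma sum_coef_pvar_divmin:
  assumes "coef t u \<noteq> 0" "u \<in> V" "\<And>i j. i \<in> V \<Longrightarrow> to_nat j < to_nat i \<Longrightarrow> j \<in> V"
  shows "(\<Sum>i\<in>V. coef (pvar i * divmin i p) t) = coef p t"
proof -
  obtain m where m: "coef t m \<noteq> 0" "\<And>j. coef t j \<noteq> 0 \<Longrightarrow> to_nat m \<le> to_nat j"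
    using ex_has_least_nat[of "\<lambda>m. coef t m \<noteq> 0" u to_nat] assms(1) by blast
  have "m \<in> V"
    using assms m(2)[OF assms(1)] by (metis inj_to_nat injD nat_less_le)
  have "(coef t i \<noteq> 0 \<and> above i t) \<longleftrightarrow> i = m" for i
    unfolding above_def using m by (metis inj_to_nat injD antisym)
  then have "(\<Sum>i\<in>V. coef (pvar i * divmin i p) t) = (\<Sum>i\<in>V. if i = m then coef p t else 0)"
    by (simp add: coef_pvar_divmin)
  then show ?thesis
    using \<open>m \<in> V\<close> by simp
qed

lemma pvar_decomposition:
  assumes "coef p 0 = 0"
  shows "p = (\<Sum>i\<in>UNIV. divmin i p * pvar i)"
proof (rule poly_mapping_eqI)
  fix t
  show "coef p t = coef (\<Sum>i\<in>UNIV. divmin i p * pvar i) t"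
  proof (cases "t = 0")
    case True
    then show ?thesis
      using assms by (simp add: lookup_sum coef_pvar_mult mult.commute[of _ "pvar _"])
  next
    case False
    then obtain u where "coef t u \<noteq> 0"
      by (metis lookup_zero poly_mapping_eqI)
    then show ?thesis
      using sum_coef_pvar_divmin[of t u UNIV p] by (simp add: lookup_sum mult.commute[of _ "pvar _"])
  qed
qed

text \<open>Terms whose variables all come at or after \<open>v\<close> survive multiplication and
  then division by \<open>v\<close>; every other term is recovered from its least variable, which
  precedes \<open>v\<close>.\<close>

lemma divmin_decomposition:
  "divmin v (pvar v * p) + (\<Sum>i | to_nat i < to_nat v. pvar i * divmin i p) = p"
proof (rule poly_mapping_eqI)
  fix t
  show "coef (divmin v (pvar v * p) + (\<Sum>i | to_nat i < to_nat v. pvar i * divmin i p)) t = coef p t"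
  proof (cases "above v t")
    case True
    then have "coef t i = 0" if "to_nat i < to_nat v" for i
      using that by (auto simp: above_def)
    then have "(\<Sum>i | to_nat i < to_nat v. coef (pvar i * divmin i p) t) = 0"
      by (intro sum.neutral) (auto simp: coef_pvar_divmin)
    then show ?thesis
      using True by (simp add: lookup_add lookup_sum divmin_pvar_self)
  next
    case False
    then obtain u where "coef t u \<noteq> 0" "to_nat u < to_nat v"
      by (auto simp: above_def not_le)
    then show ?thesis
      using False sum_coef_pvar_divmin[of t u "{i. to_nat i < to_nat v}" p]
      by (simp add: lookup_add lookup_sum divmin_pvar_self)
  qed
qed

definition kmin :: "'x::finite set \<Rightarrow> 'x"
  where "kmin S = (SOME v. v \<in> S \<and> (\<forall>u\<in>S. to_nat v \<le> to_nat u))"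

lemma kmin:
  assumes "S \<noteq> {}"
  shows "kmin S \<in> S" "\<And>u. u \<in> S \<Longrightarrow> to_nat (kmin S) \<le> to_nat u"
proof -
  obtain s where "s \<in> S"
    using assms by blast
  then have "\<exists>v. v \<in> S \<and> (\<forall>u\<in>S. to_nat v \<le> to_nat u)"
    using ex_has_least_nat[of "\<lambda>v. v \<in> S" s to_nat] by blast
  then have "kmin S \<in> S \<and> (\<forall>u\<in>S. to_nat (kmin S) \<le> to_nat u)"
    unfolding kmin_def by (rule someI_ex)
  then show "kmin S \<in> S" "\<And>u. u \<in> S \<Longrightarrow> to_nat (kmin S) \<le> to_nat u"
    by auto
qed

lemma kmin_eqI: "v \<in> S \<Longrightarrow> (\<And>u. u \<in> S \<Longrightarrow> to_nat v \<le> to_nat u) \<Longrightarrow> kmin S = v"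
  using kmin[of S] by (metis antisym empty_iff inj_to_nat injD)

text \<open>A contracting homotopy. A monomial times the wedge over \<open>T\<close>, with
  \<open>v\<close> the least variable of the monomial, goes to the monomial divided by
  \<open>v\<close> times the wedge over \<open>insert v T\<close> if \<open>v\<close> precedes all
  of \<open>T\<close>, and to zero otherwise. There is no sign because \<open>v\<close> comes
  first.\<close>

definition kh :: "('x::finite set \<Rightarrow> ('x, 'k::field) mpoly) \<Rightarrow> 'x set \<Rightarrow> ('x, 'k) mpoly"
  where "kh c S = (if S = {} then 0 else divmin (kmin S) (c (S - {kmin S})))"

text \<open>The second summand is \<open>kh (kd c) S\<close>, so this is the homotopy identity. At
  the empty set it fails by the constant term, which represents the homology k in degree
  zero.\<close>

lemma kd_kh:
  assumes "S \<noteq> {}"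
  shows "kd (kh c) S + divmin (kmin S) (kd c (S - {kmin S})) = c S"
proof -
  define v where "v = kmin S"
  have v: "v \<in> S" "\<And>u. u \<in> S \<Longrightarrow> to_nat v \<le> to_nat u"
    using kmin[OF assms] by (auto simp: v_def)
  have lt: "to_nat v < to_nat i" if "i \<notin> S" "\<not> to_nat i < to_nat v" for i
    using that v(1) to_nat_neq[of i v] by auto
  \<comment> \<open>For \<open>i\<close> outside \<open>S\<close>, the least element of
    \<open>insert i S\<close> is \<open>i\<close> or \<open>v\<close>, giving a term
    \<open>Y i\<close> or \<open>X i\<close>. The \<open>X\<close> terms cancel against those of
    \<open>kd c (S - {v})\<close>; the \<open>Y\<close> terms complete the term of \<open>v\<close>
    to \<open>c S\<close> by \<open>divmin_decomposition\<close>.\<close>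
  define X where "X i = ksgn S i * pvar i * divmin v (c (insert i (S - {v})))" for i
  define Y where "Y i = pvar i * divmin i (c S)" for i
  have "ksgn S i * pvar i * kh c (insert i S) = (if to_nat i < to_nat v then Y i else X i)"
    if "i \<in> - S" for i
  proof (cases "to_nat i < to_nat v")
    case True
    have "kmin (insert i S) = i"
      using True v by (intro kmin_eqI) (auto intro: less_imp_le order.strict_trans2)
    moreover have "insert i S - {i} = S"
      using that by auto
    moreover have "{j \<in> S. to_nat j < to_nat i} = {}"
      using True v(2) by force
    then have "ksgn S i = (1 :: ('a, 'b) mpoly)"
      unfolding ksgn_def by (metis card.empty power_0)
    ultimately show ?thesis
      using True by (simp add: kh_def Y_def)
  next
    case False
    have "kmin (insert i S) = v"
      using False v by (intro kmin_eqI) auto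
    moreover have "insert i S - {v} = insert i (S - {v})"
      using that v(1) by auto
    ultimately show ?thesis
      using False by (simp add: kh_def X_def)
  qed
  then have 1: "kd (kh c) S = (\<Sum>i\<in>- S. if to_nat i < to_nat v then Y i else X i)"
    by (simp add: kd_def)
  have 2: "divmin v (ksgn (S - {v}) i * pvar i * c (insert i (S - {v})))
      = (if to_nat i < to_nat v then 0 else - X i)" if "i \<in> - S" for i
  proof (cases "to_nat i < to_nat v")
    case True
    then show ?thesis
      by (simp add: divmin_ksgn divmin_pvar_less mult.assoc)
  next
    case False
    then have "to_nat v < to_nat i"
      using lt that by simp
    moreover have "ksgn S i = (- ksgn (S - {v}) i :: ('a, 'b) mpoly)"
      using ksgn_insert[of v "S - {v}" i, where 'a = "('a, 'b) mpoly"] calculation v(1)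
      by (simp add: insert_absorb)
    ultimately show ?thesis
      by (simp add: divmin_ksgn divmin_pvar_greater mult.assoc X_def)
  qed
  have sgn1: "ksgn S v = (1 :: ('a, 'b) mpoly)"
  proof -
    have "{j \<in> S. to_nat j < to_nat v} = {}"
      using v(2) by force
    then show ?thesis
      unfolding ksgn_def by (metis card.empty power_0)
  qed
  have "- (S - {v}) = insert v (- S)" "insert v (S - {v}) = S"
    using v(1) by auto
  then have "kd c (S - {v}) = pvar v * c S + (\<Sum>i\<in>- S. ksgn (S - {v}) i * pvar i * c (insert i (S - {v})))"
    unfolding kd_def using v(1) sgn1 by simp
  then have 3: "divmin v (kd c (S - {v}))
      = divmin v (pvar v * c S) + (\<Sum>i\<in>- S. if to_nat i < to_nat v then 0 else - X i)"
    using 2 by (simp add: divmin_add divmin_sum)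
  have "(\<Sum>i\<in>- S. if to_nat i < to_nat v then Y i else X i)
      + (\<Sum>i\<in>- S. if to_nat i < to_nat v then 0 else - X i) = (\<Sum>i\<in>- S. if to_nat i < to_nat v then Y i else 0)"
    unfolding sum.distrib[symmetric] by (rule sum.cong) auto
  also have "\<dots> = (\<Sum>i | to_nat i < to_nat v. Y i)"
    using v(2) by (intro sum.mono_neutral_cong_right) (auto simp: not_less[symmetric])
  finally have "kd (kh c) S + divmin v (kd c (S - {v}))
      = divmin v (pvar v * c S) + (\<Sum>i | to_nat i < to_nat v. Y i)"
    using 1 3 by (simp add: ac_simps)
  then show ?thesis
    using divmin_decomposition[of v "c S"] by (simp add: Y_def v_def)
qed

lemma koszul_exact:
  assumes "kchain q c" "q \<ge> 1" "\<And>S. kd c S = 0"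
  shows "\<exists>e. kchain (Suc q) e \<and> (\<forall>S. kd e S = c S)"
proof (intro exI conjI allI)
  show "kchain (Suc q) (kh c)"
    unfolding kchain_def
  proof (intro allI impI)
    fix S :: "'a set" assume S: "card S \<noteq> Suc q"
    show "kh c S = 0"
    proof (cases "S = {}")
      case False
      have "Suc (card (S - {kmin S})) = card S"
        by (rule card_Suc_Diff1) (use kmin(1)[OF False] in auto)
      then have "card (S - {kmin S}) \<noteq> q"
        using S by auto
      then show ?thesis
        using assms(1) False by (simp add: kh_def kchain_def)
    qed (simp add: kh_def)
  qed
  show "kd (kh c) S = c S" for S
  proof (cases "S = {}")
    case True
    have "c {} = 0"
      using assms(1,2) by (simp add: kchain_def)
    moreover have "kh c {i} = divmin i (c {})" for i
      using kmin[of "{i}"] by (simp add: kh_def)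
    ultimately show ?thesis
      using True by (simp add: kd_def)
  next
    case False
    then show ?thesis
      using kd_kh[OF False, of c] assms(3) by simp
  qed
qed

subsection \<open>Depth and vanishing of Koszul homology\<close>

definition irrelevant :: "('x::finite, 'k::field) mpoly set"
  where "irrelevant = {p. coef p 0 = 0}"

lemma is_ideal_irrelevant: "is_ideal irrelevant"
  unfolding is_ideal_def idl.subspace_def irrelevant_def by (simp add: lookup_add coef_0_mult)

lemma irrelevant_mult_iff: "p * q \<in> irrelevant \<longleftrightarrow> p \<in> irrelevant \<or> q \<in> irrelevant"
  by (simp add: irrelevant_def coef_0_mult)

lemma single_0_inverse: "c \<noteq> 0 \<Longrightarrow> single 0 (1 / c) * single 0 c = (1 :: ('x::finite, 'k::field) mpoly)"
  by (simp add: mult_single)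

lemma ideal_with_constant:
  fixes I :: "('x::finite, 'k::field) mpoly set"
  assumes "is_ideal I" "c \<noteq> 0" "single 0 c \<in> I"
  shows "I = UNIV"
proof -
  have sub: "idl.subspace I"
    using assms(1) by (simp add: is_ideal_def)
  have "single 0 (1 / c) * single 0 c \<in> I"
    by (rule idl.subspace_scale[OF sub assms(3)])
  then have "1 \<in> I"
    by (simp only: single_0_inverse[OF assms(2)])
  then show ?thesis
    using idl.subspace_scale[OF sub, of 1] by auto
qed

lemma not_irrelevant_split:
  assumes "u \<notin> irrelevant"
  obtains c v where "c \<noteq> 0" "v \<in> irrelevant" "u = single 0 c + v"
proof (rule that[of "coef u 0" "u - single 0 (coef u 0)"])
  show "coef u 0 \<noteq> 0"
    using assms by (simp add: irrelevant_def)
  show "u - single 0 (coef u 0) \<in> irrelevant"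
    by (simp add: irrelevant_def lookup_minus)
qed simp

lemma maximal_ideal_irrelevant: "maximal_ideal (irrelevant :: ('x::finite, 'k::field) mpoly set)"
  unfolding maximal_ideal_def
proof (intro conjI allI impI)
  show "is_ideal (irrelevant :: ('x, 'k) mpoly set)"
    by (rule is_ideal_irrelevant)
  have "(1 :: ('x, 'k) mpoly) \<notin> irrelevant"
    by (simp add: irrelevant_def)
  then show "(irrelevant :: ('x, 'k) mpoly set) \<noteq> UNIV"
    by blast
  fix I :: "('x, 'k) mpoly set"
  assume I: "is_ideal I \<and> irrelevant \<subseteq> I \<and> I \<noteq> UNIV"
  have "p \<in> irrelevant" if "p \<in> I" for p
  proof (rule ccontr)
    assume "p \<notin> irrelevant"
    then obtain c v where cv: "c \<noteq> 0" "v \<in> irrelevant" "p = single 0 c + v"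
      by (rule not_irrelevant_split)
    have sub: "idl.subspace I"
      using I by (simp add: is_ideal_def)
    have "p - v \<in> I"
      using that cv(2) I idl.subspace_diff[OF sub] by blast
    then show False
      using I ideal_with_constant[of I c] cv(1,3) by simp
  qed
  then show "I = irrelevant"
    using I by blast
qed

text \<open>Vanishing of the degree \<open>q\<close> Koszul homology of P/I, expressed through lifts
  of chains to P.\<close>

definition koszul_vanishes :: "nat \<Rightarrow> ('x::finite, 'k::field) mpoly set \<Rightarrow> bool"
  where "koszul_vanishes q I \<longleftrightarrow> (\<forall>c. kchain q c \<and> (\<forall>S. kd c S \<in> I) \<longrightarrow>
    (\<exists>e. kchain (Suc q) e \<and> (\<forall>S. c S - kd e S \<in> I)))"

text \<open>Write \<open>u\<close> as a nonzero constant plus an element of the irrelevant ideal.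
  The latter acts as zero on homology, so if \<open>u\<close> times a cycle bounds, then so does the
  cycle. Thus elements that become units in the localisation already act invertibly on Koszul
  homology.\<close>

lemma koszul_unit:
  assumes I: "is_ideal I" and u: "u \<notin> irrelevant"
    and c: "kchain q c" "\<And>S. kd c S \<in> I"
    and w: "kchain (Suc q) w" "\<And>S. u * c S - kd w S \<in> I"
  shows "\<exists>e. kchain (Suc q) e \<and> (\<forall>S. c S - kd e S \<in> I)"
proof -
  have sub: "idl.subspace I"
    using I by (simp add: is_ideal_def)
  obtain a v where av: "a \<noteq> 0" "v \<in> irrelevant" "u = single 0 a + v"
    using not_irrelevant_split[OF u] by blast
  define g where "g i = divmin i v" for i
  have v: "v = (\<Sum>i\<in>UNIV. g i * pvar i)"
    unfolding g_def using av(2) by (intro pvar_decomposition) (simp add: irrelevant_def)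
  define b where "b = (single 0 (1 / a) :: ('a, 'b) mpoly)"
  define e where "e = (\<lambda>S. b * (w S - ks g c S))"
  have "kchain (Suc q) e"
    using w(1) kchain_ks[OF c(1), of g] by (simp add: kchain_def e_def)
  moreover have "c S - kd e S \<in> I" for S
  proof -
    have "v * c S = kd (ks g c) S + ks g (kd c) S"
      by (simp add: koszul_homotopy flip: v)
    then have "c S - kd e S = b * (u * c S - kd w S) - b * ks g (kd c) S
        + (c S - (b * single 0 a) * c S)"
      by (simp add: e_def kd_mult_left kd_minus av(3) algebra_simps)
    also have "(b * single 0 a) * c S = c S"
      by (simp add: b_def single_0_inverse[OF av(1)])
    finally have "c S - kd e S = b * (u * c S - kd w S) - b * ks g (kd c) S"
      by simp
    then show ?thesis
      using w(2) ks_in_ideal[OF I c(2)] sub by (simp add: idl.subspace_diff idl.subspace_scale)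
  qed
  ultimately show ?thesis by blast
qed

lemma subset_contracted: "I \<subseteq> contracted irrelevant I"
proof
  fix p assume "p \<in> I"
  moreover have "1 \<notin> irrelevant"
    by (simp add: irrelevant_def)
  ultimately show "p \<in> contracted irrelevant I"
    unfolding contracted_def by (metis (mono_tags, lifting) mem_Collect_eq mult_1)
qed

lemma contracted_mono: "I \<subseteq> I' \<Longrightarrow> contracted M I \<subseteq> contracted M I'"
  by (auto simp: contracted_def)

lemma is_ideal_contracted:
  assumes "is_ideal I"
  shows "is_ideal (contracted irrelevant I)"
proof -
  have sub: "idl.subspace I"
    using assms by (simp add: is_ideal_def)
  show ?thesis
    unfolding is_ideal_def
  proof (rule idl.subspaceI)
    show "0 \<in> contracted irrelevant I"
      using subset_contracted[of I] idl.subspace_0[OF sub] by blast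
    fix p q assume "p \<in> contracted irrelevant I" "q \<in> contracted irrelevant I"
    then obtain s t where st: "s \<notin> irrelevant" "t \<notin> irrelevant" "s * p \<in> I" "t * q \<in> I"
      by (auto simp: contracted_def)
    have "(s * t) * (p + q) = t * (s * p) + s * (t * q)"
      by (simp add: algebra_simps)
    also have "\<dots> \<in> I"
      using st sub idl.subspace_add idl.subspace_scale by blast
    finally show "p + q \<in> contracted irrelevant I"
      using st(1,2) irrelevant_mult_iff unfolding contracted_def by blast
  next
    fix a p assume "p \<in> contracted irrelevant I"
    then obtain s where s: "s \<notin> irrelevant" "s * p \<in> I"
      by (auto simp: contracted_def)
    then have "s * (a * p) \<in> I"
      using idl.subspace_scale[OF sub, of "s * p" a] by (simp add: ac_simps)
    then show "a * p \<in> contracted irrelevant I"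
      using s(1) unfolding contracted_def by blast
  qed
qed

lemma common_denominator:
  fixes I :: "('x::finite, 'k::field) mpoly set"
  assumes "is_ideal I" "finite A" "\<And>S. S \<in> A \<Longrightarrow> f S \<in> contracted irrelevant I"
  shows "\<exists>u. u \<notin> irrelevant \<and> (\<forall>S\<in>A. u * f S \<in> I)"
  using assms(2,3)
proof (induction A)
  case empty
  show ?case
    by (intro exI[of _ 1]) (simp add: irrelevant_def)
next
  case (insert S A)
  have sub: "idl.subspace I"
    using assms(1) by (simp add: is_ideal_def)
  obtain u where u: "u \<notin> irrelevant" "\<And>S. S \<in> A \<Longrightarrow> u * f S \<in> I"
    using insert by auto
  obtain s where s: "s \<notin> irrelevant" "s * f S \<in> I"
    using insert.prems[of S] by (auto simp: contracted_def)
  have "u * s * f T \<in> I" if "T \<in> insert S A" for T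
  proof (cases "T = S")
    case True
    then show ?thesis
      using idl.subspace_scale[OF sub s(2), of u] by (simp add: ac_simps)
  next
    case False
    then show ?thesis
      using that idl.subspace_scale[OF sub u(2)[of T], of s] by (simp add: ac_simps)
  qed
  then show ?case
    using u(1) s(1) irrelevant_mult_iff by blast
qed

text \<open>Passing to \<open>contracted irrelevant J\<close> amounts to localising P/J. A boundary
  found there leaves an error which one \<open>u\<close> outside the irrelevant ideal moves into
  \<open>J\<close>; \<open>koszul_unit\<close> then bounds that error.\<close>

lemma koszul_vanishes_uncontracted:
  fixes J :: "('x::finite, 'k::field) mpoly set"
  assumes J: "is_ideal J" and van: "koszul_vanishes q (contracted irrelevant J)"
  shows "koszul_vanishes q J"
  unfolding koszul_vanishes_def
proof (intro allI impI)
  fix c :: "'x set \<Rightarrow> ('x, 'k) mpoly"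
  assume c: "kchain q c \<and> (\<forall>S. kd c S \<in> J)"
  then obtain e where e: "kchain (Suc q) e" "\<And>S. c S - kd e S \<in> contracted irrelevant J"
    using van subset_contracted[of J] unfolding koszul_vanishes_def by blast
  obtain u where u: "u \<notin> irrelevant" "\<And>S. u * (c S - kd e S) \<in> J"
    using common_denominator[OF J finite[of UNIV], of "\<lambda>S. c S - kd e S"] e(2) by auto
  have "kchain q (\<lambda>S. c S - kd e S)"
    using c kchain_kd[OF e(1)] by (simp add: kchain_def)
  moreover have "kd (\<lambda>S. c S - kd e S) S \<in> J" for S
    using c by (simp add: kd_minus kd_kd)
  moreover have "kchain (Suc q) (\<lambda>_ :: 'x set. 0 :: ('x, 'k) mpoly)"
    by (simp add: kchain_def)
  ultimately obtain e' where e': "kchain (Suc q) e'" "\<And>S. c S - kd e S - kd e' S \<in> J"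
    using koszul_unit[OF J u(1), of q "\<lambda>S. c S - kd e S" "\<lambda>_. 0"] u(2) by auto
  have "kchain (Suc q) (\<lambda>S. e S + e' S)"
    using e(1) e'(1) by (simp add: kchain_def)
  moreover have "c S - kd (\<lambda>S. e S + e' S) S \<in> J" for S
    using e'(2)[of S] by (simp add: kd_add algebra_simps)
  ultimately show "\<exists>e. kchain (Suc q) e \<and> (\<forall>S. c S - kd e S \<in> J)"
    by blast
qed

text \<open>
  Since \<open>f\<close> lies in the irrelevant ideal, multiplication by \<open>f\<close> is null-homotopic on the Koszul
  complex. Hence the connecting map from degree \<open>q + 1\<close> homology modulo \<open>f\<close> is onto.
\<close>

lemma koszul_vanishes_step:
  fixes I :: "('x::finite, 'k::field) mpoly set"
  assumes I: "is_ideal I" and f: "f \<in> irrelevant"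
    and reg: "\<And>p. f * p \<in> contracted irrelevant I \<Longrightarrow> p \<in> contracted irrelevant I"
    and van: "koszul_vanishes (Suc q) (contracted irrelevant (ideal_gen (insert f I)))"
  shows "koszul_vanishes q (contracted irrelevant I)"
  unfolding koszul_vanishes_def
proof (intro allI impI)
  define C where "C = contracted irrelevant I"
  define I' where "I' = ideal_gen (insert f I)"
  have C: "is_ideal C" "idl.subspace C"
    using is_ideal_contracted[OF I] by (auto simp: C_def is_ideal_def)
  have sub: "idl.subspace I"
    using I by (simp add: is_ideal_def)
  have I': "is_ideal I'" "I \<subseteq> I'" "f \<in> I'"
    by (auto simp: I'_def is_ideal_def ideal_gen_def intro: idl.span_base)
  have C': "is_ideal (contracted irrelevant I')" "idl.subspace (contracted irrelevant I')"
    using is_ideal_contracted[OF I'(1)] by (auto simp: is_ideal_def)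
  have I'_split: "\<exists>a\<in>I. \<exists>b. p = a + f * b" if p: "p \<in> I'" for p
  proof -
    obtain k where "p - k * f \<in> idl.span I"
      using p idl.span_breakdown_eq[of p f I] by (auto simp: I'_def ideal_gen_def)
    moreover have "idl.span I = I"
      using sub by simp
    moreover have "p = (p - k * f) + f * k"
      by (simp add: mult.commute)
    ultimately show ?thesis by blast
  qed
  define g where "g i = divmin i f" for i
  have fg: "f = (\<Sum>i\<in>UNIV. g i * pvar i)"
    unfolding g_def using f by (intro pvar_decomposition) (simp add: irrelevant_def)
  fix c :: "'x set \<Rightarrow> ('x, 'k) mpoly"
  assume "kchain q c \<and> (\<forall>S. kd c S \<in> contracted irrelevant I)"
  then have c: "kchain q c" "\<And>S. kd c S \<in> C"
    by (auto simp: C_def)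
  define z where "z = ks g (kd c)"
  have z: "z S \<in> C" for S
    unfolding z_def by (rule ks_in_ideal[OF C(1) c(2)])
  \<comment> \<open>By the homotopy formula \<open>e1\<close> bounds \<open>f * c\<close> up to
    values in \<open>C\<close>, so it is a cycle of degree \<open>Suc q\<close> modulo
    \<open>f\<close>, a preimage of \<open>c\<close> under the connecting map.\<close>
  define e1 where "e1 = ks g c"
  have e1: "kd e1 S = f * c S - z S" for S
    unfolding e1_def z_def fg using koszul_homotopy[of g c S] by (simp add: algebra_simps)
  have e1_chain: "kchain (Suc q) e1"
    unfolding e1_def by (rule kchain_ks[OF c(1)])
  have "kd e1 S \<in> contracted irrelevant I'" for S
  proof -
    have "f * c S \<in> contracted irrelevant I'"
      using I'(1,3) subset_contracted[of I'] idl.subspace_scale[of I' f "c S"]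
      by (auto simp: is_ideal_def mult.commute)
    moreover have "z S \<in> contracted irrelevant I'"
      using z contracted_mono[OF I'(2)] by (auto simp: C_def)
    ultimately show ?thesis
      unfolding e1 using idl.subspace_diff[OF C'(2)] by blast
  qed
  then obtain e2 where e2: "kchain (Suc (Suc q)) e2" "\<And>S. e1 S - kd e2 S \<in> contracted irrelevant I'"
    using van e1_chain unfolding koszul_vanishes_def I'_def by blast
  obtain u where u: "u \<notin> irrelevant" "\<And>S. u * (e1 S - kd e2 S) \<in> I'"
    using common_denominator[OF I'(1) finite[of UNIV], of "\<lambda>S. e1 S - kd e2 S"] e2(2) by auto
  \<comment> \<open>The choice \<open>b = 0\<close> off sets of size \<open>Suc q\<close> makes the
    quotients by \<open>f\<close> a chain of that degree.\<close>
  have "\<exists>a b. a \<in> I \<and> u * (e1 S - kd e2 S) = a + f * b \<and> (card S \<noteq> Suc q \<longrightarrow> b = 0)" for S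
  proof (cases "card S = Suc q")
    case True
    then show ?thesis using I'_split[OF u(2)[of S]] by blast
  next
    case False
    then have "e1 S = 0" "kd e2 S = 0"
      using e1_chain kchain_kd[OF e2(1)] by (auto simp: kchain_def)
    then show ?thesis
      using idl.subspace_0[OF sub] by (intro exI[of _ 0]) simp
  qed
  then obtain a w where aw: "\<And>S. a S \<in> I" "\<And>S. u * (e1 S - kd e2 S) = a S + f * w S"
    "\<And>S. card S \<noteq> Suc q \<Longrightarrow> w S = 0"
    by metis
  have w_chain: "kchain (Suc q) w"
    using aw(3) by (simp add: kchain_def)
  \<comment> \<open>Applying \<open>kd\<close> to the decomposition shows that \<open>f\<close>
    times this element lies in \<open>C\<close>; regularity cancels \<open>f\<close>.\<close>
  have "u * c S - kd w S \<in> C" for S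
  proof -
    have "kd (\<lambda>S. u * (e1 S - kd e2 S)) S = kd (\<lambda>S. a S + f * w S) S"
      using aw(2) by simp
    then have "u * (f * c S - z S) = kd a S + f * kd w S"
      by (simp add: kd_mult_left kd_minus kd_add kd_kd e1)
    then have "f * (u * c S - kd w S) = kd a S + u * z S"
      by (simp add: algebra_simps)
    also have "\<dots> \<in> C"
      using kd_in_ideal[OF I aw(1)] subset_contracted[of I] z C(2)
      by (auto simp: C_def intro!: idl.subspace_add idl.subspace_scale)
    finally show ?thesis
      using reg by (simp add: C_def)
  qed
  then show "\<exists>e. kchain (Suc q) e \<and> (\<forall>S. c S - kd e S \<in> contracted irrelevant I)"
    using koszul_unit[OF C(1) u(1) c w_chain] by (simp add: C_def)
qed

lemma koszul_vanishes_large: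
  fixes I :: "('x::finite, 'k::field) mpoly set"
  assumes "is_ideal I" "CARD('x) < q"
  shows "koszul_vanishes q I"
  unfolding koszul_vanishes_def
proof (intro allI impI)
  fix c :: "'x set \<Rightarrow> ('x, 'k) mpoly" assume c: "kchain q c \<and> (\<forall>S. kd c S \<in> I)"
  have "card S \<noteq> q" for S :: "'x set"
    using card_mono[of UNIV S] assms(2) by simp
  then have "c S = 0" for S
    using c by (simp add: kchain_def)
  then show "\<exists>e. kchain (Suc q) e \<and> (\<forall>S. c S - kd e S \<in> I)"
    using assms(1) by (intro exI[of _ "\<lambda>_. 0"]) (simp add: kchain_def is_ideal_def idl.subspace_0)
qed

lemma ideal_gen_insert_ideal_gen: "ideal_gen (insert f (ideal_gen S)) = ideal_gen (insert f S)"
proof -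
  have "idl.span (insert f (idl.span S)) \<subseteq> idl.span (insert f S)"
    by (rule idl.span_minimal) (use idl.span_mono[of S "insert f S"] in \<open>auto intro: idl.span_base\<close>)
  moreover have "idl.span (insert f S) \<subseteq> idl.span (insert f (idl.span S))"
    by (rule idl.span_mono) (use idl.span_superset in blast)
  ultimately show ?thesis
    by (simp add: ideal_gen_def)
qed

lemma koszul_vanishes_of_regular_sequence:
  fixes J :: "('x::finite, 'k::field) mpoly set"
  assumes J: "is_ideal J" and fs: "regular_sequence_at J irrelevant fs"
    and q: "CARD('x) < q + length fs"
  shows "koszul_vanishes q J"
proof -
  define I where "I i = ideal_gen (J \<union> set (take i fs))" for i
  \<comment> \<open>\<open>k\<close> counts the elements removed from the end of the sequence. With
    none removed, chains above degree n are zero; each removal lowers the degree by one.\<close>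
  have "koszul_vanishes q' (contracted irrelevant (I (length fs - k)))"
    if "k \<le> length fs" "CARD('x) < q' + k" for k q'
    using that
  proof (induction k arbitrary: q')
    case 0
    then show ?case
      by (intro koszul_vanishes_large) (auto simp: I_def is_ideal_ideal_gen is_ideal_contracted)
  next
    case (Suc k)
    define i where "i = length fs - Suc k"
    have i: "i < length fs" "length fs - k = Suc i"
      using Suc.prems by (auto simp: i_def)
    have "koszul_vanishes (Suc q') (contracted irrelevant (I (Suc i)))"
      using Suc.IH[of "Suc q'"] Suc.prems i(2) by simp
    moreover have "I (Suc i) = ideal_gen (insert (fs ! i) (I i))"
      using i(1) by (simp add: I_def ideal_gen_insert_ideal_gen take_Suc_conv_app_nth)
    ultimately have "koszul_vanishes (Suc q') (contracted irrelevant (ideal_gen (insert (fs ! i) (I i))))"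
      by simp
    moreover have "is_ideal (I i)"
      by (simp add: I_def is_ideal_ideal_gen)
    moreover have "fs ! i \<in> irrelevant"
      using fs nth_mem[OF i(1)] by (auto simp: regular_sequence_at_def)
    moreover have "p \<in> contracted irrelevant (I i)" if "fs ! i * p \<in> contracted irrelevant (I i)" for p
      using fs i(1) that unfolding regular_sequence_at_def I_def by blast
    ultimately have "koszul_vanishes q' (contracted irrelevant (I i))"
      by (intro koszul_vanishes_step[of "I i" "fs ! i"])
    then show ?case
      by (simp add: i_def)
  qed
  from this[of "length fs" q] have "koszul_vanishes q (contracted irrelevant (I 0))"
    using q by simp
  moreover have "I 0 = J"
    using J by (simp add: I_def ideal_gen_def is_ideal_def)
  ultimately show ?thesis
    using koszul_vanishes_uncontracted[OF J] by simp
qed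

subsection \<open>Resolutions of length one\<close>

text \<open>The dimension shift from degree 3 of P/J to degree 1 of the syzygies. Lift the cycle
  \<open>c\<close> to a chain \<open>e\<close> of vectors and push it to the cycle \<open>p\<close>
  with values in \<open>J\<close>. In P, \<open>p\<close> bounds some \<open>y\<close>, which is a
  cycle modulo \<open>J\<close> in degree 3; so \<open>y\<close> can be changed by a boundary to
  \<open>w\<close> with values in \<open>J\<close>. Lifting \<open>w\<close> to vectors
  \<open>v\<close> and subtracting the boundary of \<open>v\<close> from \<open>e\<close> makes its
  values syzygies.\<close>

lemma koszul_syzygy_exact:
  fixes J :: "('x::finite, 'k::field) mpoly set" and c :: "'x set \<Rightarrow> nat \<Rightarrow> ('x, 'k) mpoly"
  assumes J: "is_ideal J" and van: "koszul_vanishes 3 J"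
    and gens: "(\<lambda>v. \<Sum>i<m. v i * g i) ` free_module m = J"
    and c: "kchain 1 c" "\<And>S. c S \<in> free_module m" "\<And>S. (\<Sum>i<m. c S i * g i) = 0"
      "\<And>S i. kd (\<lambda>S. c S i) S = 0"
  shows "\<exists>e. kchain 2 e \<and> (\<forall>S. e S \<in> free_module m \<and> (\<Sum>i<m. e S i * g i) = 0)
    \<and> (\<forall>S i. kd (\<lambda>S. e S i) S = c S i)"
proof -
  have "\<exists>e. kchain 2 e \<and> (\<forall>S. kd e S = c S i)" for i
    using koszul_exact[of 1 "\<lambda>S. c S i"] c(1,4) by (auto simp: kchain_def zero_fun_apply numeral_2_eq_2)
  then obtain e0 where e0: "\<And>i. kchain 2 (e0 i)" "\<And>i S. kd (e0 i) S = c S i"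
    by metis
  define e where "e S i = (if i < m then e0 i S else 0)" for S i
  have ei: "kd (\<lambda>S. e S i) S = c S i" for S i
    using c(2)[of S] e0(2)[of i S] by (cases "i < m") (auto simp: e_def free_module_def)
  have e_free: "e S \<in> free_module m" for S
    by (simp add: e_def free_module_def)
  have e_chain: "kchain 2 e"
    using e0(1) by (auto simp: kchain_def e_def zero_fun_def)
  define p where "p = (\<lambda>S. \<Sum>i<m. e S i * g i)"
  have pJ: "p S \<in> J" for S
    unfolding p_def gens[symmetric] using e_free by blast
  have p_chain: "kchain 2 p"
    using e_chain by (simp add: kchain_def p_def zero_fun_apply)
  have kdp: "kd p S = 0" for S
    using c(3)[of S] unfolding p_def by (simp add: kd_sum kd_mult ei)
  obtain y where y: "kchain 3 y" "\<And>S. kd y S = p S"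
    using koszul_exact[of 2 p] p_chain kdp by (auto simp: numeral_3_eq_3 numeral_2_eq_2)
  have "\<forall>S. kd y S \<in> J"
    using y(2) pJ by simp
  then obtain x where x: "kchain (Suc 3) x" "\<And>S. y S - kd x S \<in> J"
    using van y(1) unfolding koszul_vanishes_def by blast
  define w where "w = (\<lambda>S. y S - kd x S)"
  have w_chain: "kchain 3 w"
    using y(1) kchain_kd[OF x(1)] by (simp add: kchain_def w_def)
  have "\<exists>v. v \<in> free_module m \<and> w S = (\<Sum>i<m. v i * g i) \<and> (card S \<noteq> 3 \<longrightarrow> v = 0)" for S
  proof (cases "card S = 3")
    case True
    then show ?thesis
      using x(2)[of S] unfolding w_def gens[symmetric] by blast
  next
    case False
    then have "w S = 0"
      using w_chain by (simp add: kchain_def)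
    then show ?thesis
      by (intro exI[of _ 0]) (simp add: free_module_def zero_fun_apply)
  qed
  then obtain v where v: "\<And>S. v S \<in> free_module m" "\<And>S. w S = (\<Sum>i<m. v S i * g i)"
    "\<And>S. card S \<noteq> 3 \<Longrightarrow> v S = 0"
    by metis
  define e' where "e' S i = e S i - kd (\<lambda>S. v S i) S" for S i
  have "kchain 2 (kd (\<lambda>S. v S i))" for i
    using kchain_kd[of 2 "\<lambda>S. v S i"] v(3) by (simp add: kchain_def zero_fun_apply numeral_3_eq_3 numeral_2_eq_2)
  then have "kchain 2 e'"
    using e_chain by (auto simp: kchain_def e'_def zero_fun_def)
  moreover have "e' S \<in> free_module m" for S
    using e_free[of S] v(1) by (simp add: e'_def free_module_def kd_def)
  moreover have "(\<Sum>i<m. e' S i * g i) = 0" for S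
  proof -
    have "(\<Sum>i<m. e' S i * g i) = p S - kd (\<lambda>S. \<Sum>i<m. v S i * g i) S"
      by (simp add: e'_def p_def left_diff_distrib sum_subtractf kd_sum kd_mult)
    also have "(\<lambda>S. \<Sum>i<m. v S i * g i) = w"
      using v(2) by auto
    also have "kd w S = p S"
      unfolding w_def by (simp add: kd_minus kd_kd y(2))
    finally show ?thesis by simp
  qed
  moreover have "kd (\<lambda>S. e' S i) S = c S i" for S i
    unfolding e'_def by (simp add: kd_minus kd_kd ei)
  ultimately show ?thesis by blast
qed

text \<open>By minimality a relation \<open>w\<close> is a combination of the variables with
  coefficient vectors \<open>z i\<close>. These need not be relations, but the syzygies they define
  form a Koszul 1-cycle because \<open>w\<close> is a relation. Bounding this cycle within the
  syzygies corrects the \<open>z i\<close> to relations with the same combination. Iterating puts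
  \<open>w\<close> into every power of the irrelevant ideal.\<close>

lemma minimal_syzygies_free:
  fixes J :: "('x::finite, 'k::field) mpoly set"
  assumes J: "is_ideal J" and van: "koszul_vanishes 3 J"
    and gens: "(\<lambda>v. \<Sum>i<m. v i * g i) ` free_module m = J"
    and syz: "\<And>l. l < r \<Longrightarrow> A l \<in> free_module m \<and> (\<Sum>i<m. A l i * g i) = 0"
    and syz_gens: "\<And>v. v \<in> free_module m \<Longrightarrow> (\<Sum>i<m. v i * g i) = 0 \<Longrightarrow>
      \<exists>w\<in>free_module r. v = (\<Sum>l<r. vscale (w l) (A l))"
    and min: "\<And>w l. (\<Sum>l<r. vscale (w l) (A l)) = 0 \<Longrightarrow> l < r \<Longrightarrow> coef (w l) 0 = 0"
    and w: "w \<in> free_module r" "(\<Sum>l<r. vscale (w l) (A l)) = 0"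
  shows "w = 0"
proof -
  have step: "\<exists>z. (\<forall>i. z i \<in> free_module r \<and> (\<Sum>l<r. vscale (z i l) (A l)) = 0)
      \<and> (\<forall>l. w l = (\<Sum>i\<in>UNIV. pvar i * z i l))"
    if w: "w \<in> free_module r" "(\<Sum>l<r. vscale (w l) (A l)) = 0" for w
  proof -
    define z where "z i l = divmin i (w l)" for i l
    have wz: "w l = (\<Sum>i\<in>UNIV. pvar i * z i l)" for l
    proof -
      have "coef (w l) 0 = 0"
        using min[OF w(2), of l] w(1) by (cases "l < r") (auto simp: free_module_def)
      then show ?thesis
        using pvar_decomposition[of "w l"] by (simp add: z_def mult.commute)
    qed
    have z_free: "z i \<in> free_module r" for i
      using w(1) by (simp add: z_def free_module_def)
    define c where "c S = (if card S = 1 then \<Sum>l<r. vscale (z (the_elem S) l) (A l) else 0)" for S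
    have ci: "c {i} = (\<Sum>l<r. vscale (z i l) (A l))" for i
      by (simp add: c_def)
    have c1: "kchain 1 c"
      by (simp add: kchain_def c_def)
    have cf: "c S \<in> free_module m \<and> (\<Sum>j<m. c S j * g j) = 0" for S
    proof -
      define y where "y = z (the_elem S)"
      have "(\<Sum>l<r. vscale (y l) (A l)) \<in> free_module m"
        using syz by (intro vec.subspace_sum vec.subspace_scale subspace_free_module) auto
      moreover have "(\<Sum>j<m. (\<Sum>l<r. vscale (y l) (A l)) j * g j) = (\<Sum>j<m. \<Sum>l<r. y l * (A l j * g j))"
        by (simp add: sum_fun_apply vscale_apply sum_distrib_right mult.assoc)
      then have "(\<Sum>j<m. (\<Sum>l<r. vscale (y l) (A l)) j * g j) = 0"
        using syz by (subst (asm) sum.swap) (simp flip: sum_distrib_left)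
      ultimately show ?thesis
        by (auto simp: c_def y_def zero_fun_apply intro: vec.subspace_0 subspace_free_module)
    qed
    have "kd (\<lambda>S. c S j) S = 0" for S j
    proof (cases "S = {}")
      case True
      have "kd (\<lambda>S. c S j) {} = (\<Sum>i\<in>UNIV. pvar i * c {i} j)"
        by (simp add: kd_def ksgn_def)
      also have "\<dots> = (\<Sum>i\<in>UNIV. \<Sum>l<r. (pvar i * z i l) * A l j)"
        by (simp add: ci sum_fun_apply vscale_apply sum_distrib_left mult.assoc)
      also have "\<dots> = (\<Sum>l<r. w l * A l j)"
        by (subst sum.swap) (simp add: wz flip: sum_distrib_right)
      also have "\<dots> = (\<Sum>l<r. vscale (w l) (A l)) j"
        by (simp add: sum_fun_apply vscale_apply)
      finally show ?thesis
        using w(2) True by (simp add: zero_fun_apply)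
    next
      case False
      then have "card (insert i S) \<noteq> 1" if "i \<notin> S" for i
        using that by simp
      then show ?thesis
        unfolding kd_def by (intro sum.neutral) (auto simp: c_def zero_fun_apply)
    qed
    then obtain e where e: "kchain 2 e" "\<And>S. e S \<in> free_module m \<and> (\<Sum>i<m. e S i * g i) = 0"
      "\<And>S i. kd (\<lambda>S. e S i) S = c S i"
      using koszul_syzygy_exact[OF J van gens c1, of] cf by blast
    have "\<exists>y. y \<in> free_module r \<and> e S = (\<Sum>l<r. vscale (y l) (A l)) \<and> (card S \<noteq> 2 \<longrightarrow> y = 0)" for S
    proof (cases "card S = 2")
      case True
      then show ?thesis using syz_gens e(2) by blast
    next
      case False
      then have "e S = 0"
        using e(1) by (simp add: kchain_def)
      then show ?thesis
        using vec.subspace_0[OF subspace_free_module] by (intro exI[of _ 0]) (simp add: zero_fun_apply)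
    qed
    then obtain y where y: "\<And>S. y S \<in> free_module r" "\<And>S. e S = (\<Sum>l<r. vscale (y S l) (A l))"
      "\<And>S. card S \<noteq> 2 \<Longrightarrow> y S = 0"
      by metis
    \<comment> \<open>The subtracted term removes the value \<open>c {i}\<close> of the cycle, and
      its combination with the variables is \<open>kd\<close> applied twice, hence zero.\<close>
    define z' where "z' i l = z i l - kd (\<lambda>S. y S l) {i}" for i l
    have "z' i \<in> free_module r" for i
      using z_free[of i] y(1) by (simp add: z'_def free_module_def kd_def)
    moreover have "(\<Sum>l<r. vscale (z' i l) (A l)) = 0" for i
    proof
      fix j
      have "(\<Sum>l<r. vscale (z' i l) (A l)) j = c {i} j - kd (\<lambda>S. \<Sum>l<r. y S l * A l j) {i}"
        by (simp add: z'_def ci sum_fun_apply vscale_apply left_diff_distrib sum_subtractf kd_sum kd_mult)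
      also have "(\<lambda>S. \<Sum>l<r. y S l * A l j) = (\<lambda>S. e S j)"
        by (simp add: y(2) sum_fun_apply vscale_apply)
      finally show "(\<Sum>l<r. vscale (z' i l) (A l)) j = 0 j"
        using e(3)[of j "{i}"] by (simp add: zero_fun_apply)
    qed
    moreover have "w l = (\<Sum>i\<in>UNIV. pvar i * z' i l)" for l
    proof -
      have "(\<Sum>i\<in>UNIV. pvar i * kd (\<lambda>S. y S l) {i}) = kd (kd (\<lambda>S. y S l)) {}"
        by (simp add: kd_def[of "kd _"] ksgn_def)
      then show ?thesis
        by (simp add: z'_def right_diff_distrib sum_subtractf kd_kd flip: wz)
    qed
    ultimately show ?thesis by blast
  qed
  have deg: "k \<le> mdeg t"
    if "w \<in> free_module r" "(\<Sum>l<r. vscale (w l) (A l)) = 0" "t \<in> keys (w l)" for k w l t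
    using that
  proof (induction k arbitrary: w l t)
    case (Suc k)
    obtain z where z: "\<And>i. z i \<in> free_module r" "\<And>i. (\<Sum>l<r. vscale (z i l) (A l)) = 0"
      "w l = (\<Sum>i\<in>UNIV. pvar i * z i l)"
      using step[OF Suc.prems(1,2)] by blast
    have "coef (w l) t \<noteq> 0"
      using Suc.prems(3) by (simp add: in_keys_iff)
    then obtain i where "coef (pvar i * z i l) t \<noteq> 0"
      unfolding z(3) lookup_sum by (meson sum.not_neutral_contains_not_neutral)
    then have "coef t i \<noteq> 0" "coef (z i l) (t - single i 1) \<noteq> 0"
      by (auto simp: coef_pvar_mult split: if_splits)
    then have "k \<le> mdeg (t - single i 1)"
      using Suc.IH[OF z(1,2)] by (simp add: in_keys_iff)
    moreover have "t = single i 1 + (t - single i 1)"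
      using \<open>coef t i \<noteq> 0\<close> by (intro monomial_split) (auto simp: lookup_single when_def)
    then have "mdeg t = 1 + mdeg (t - single i 1)"
      by (metis mdeg_add mdeg_single)
    ultimately show ?case by simp
  qed simp
  show ?thesis
  proof
    fix l
    have "t \<notin> keys (w l)" for t
      using deg[OF w, of t l "Suc (mdeg t)"] by auto
    then have "keys (w l) = {}"
      by blast
    then show "w l = 0 l"
      by (simp add: zero_fun_apply)
  qed
qed

lemma resolution_exists:
  fixes J :: "('x::finite, 'k::field) mpoly set"
  assumes hom: "homogeneous_ideal J" and van: "koszul_vanishes 3 J"
  shows "\<exists>a b g A. min_graded_resolution J a b g A"
proof -
  have J: "is_ideal J" and comp: "\<And>p e. p \<in> J \<Longrightarrow> hcomp e p \<in> J"
    using hom by (auto simp: homogeneous_ideal_iff)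
  have sub: "idl.subspace J"
    using J by (simp add: is_ideal_def)
  \<comment> \<open>\<open>J\<close> is viewed as a submodule of a free module of rank one, so that
    one lemma yields minimal generators both of \<open>J\<close> and of its syzygies.\<close>
  define N where "N = {v :: nat \<Rightarrow> ('x, 'k) mpoly. v \<in> free_module 1 \<and> v 0 \<in> J}"
  have N: "vec.subspace N"
  proof (rule vec.subspaceI)
    show "0 \<in> N"
      using vec.subspace_0[OF subspace_free_module, of 1] idl.subspace_0[OF sub] by (simp add: N_def zero_fun_apply)
    show "v + w \<in> N" if "v \<in> N" "w \<in> N" for v w
      using that idl.subspace_add[OF sub, of "v 0" "w 0"] by (simp add: N_def free_module_def plus_fun_apply)
    show "vscale c v \<in> N" if "v \<in> N" for c v
      using that idl.subspace_scale[OF sub, of "v 0" c] by (simp add: N_def free_module_def vscale_apply)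
  qed
  have N_free: "N \<subseteq> free_module 1"
    by (auto simp: N_def)
  have N_comp: "vcomp (\<lambda>_. 0) e v \<in> N" if "v \<in> N" for v e
    using that comp by (auto simp: N_def vcomp_def free_module_def)
  obtain m a G where G: "\<And>l. l < m \<Longrightarrow> G l \<in> N" "\<And>l. l < m \<Longrightarrow> vhom (\<lambda>_. 0) (a l) (G l)"
    and G_gen: "\<And>v. v \<in> N \<Longrightarrow> \<exists>w\<in>free_module m. v = (\<Sum>l<m. vscale (w l) (G l))"
    and G_min: "\<And>w l. (\<Sum>l<m. vscale (w l) (G l)) = 0 \<Longrightarrow> l < m \<Longrightarrow> coef (w l) 0 = 0"
    using minimal_homogeneous_generators[OF N N_free, of "\<lambda>_. 0"] N_comp by blast
  define g where "g l = G l 0" for l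
  have g: "g l \<in> J" "g l \<in> hom_piece (a l)" if "l < m" for l
    using G[OF that] by (auto simp: N_def g_def vhom_def hom_piece_def)
  have G_eval: "(\<Sum>l<m. vscale (w l) (G l)) = (\<lambda>i. if i = 0 then \<Sum>l<m. w l * g l else 0)" for w
  proof
    fix i
    have "G l i = 0" if "l < m" "i \<noteq> 0" for l
      using G(1)[OF that(1)] that(2) by (simp add: N_def free_module_def)
    then show "(\<Sum>l<m. vscale (w l) (G l)) i = (if i = 0 then \<Sum>l<m. w l * g l else 0)"
      by (simp add: sum_fun_apply vscale_apply g_def)
  qed
  have gens: "(\<lambda>v. \<Sum>i<m. v i * g i) ` free_module m = J"
  proof (intro equalityI subsetI)
    fix p assume "p \<in> (\<lambda>v. \<Sum>i<m. v i * g i) ` free_module m"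
    then show "p \<in> J"
      using g(1) sub by (auto intro!: idl.subspace_sum idl.subspace_scale)
  next
    fix p assume "p \<in> J"
    then have "(\<lambda>i. if i = 0 then p else 0) \<in> N"
      by (simp add: N_def free_module_def)
    then obtain w where w: "w \<in> free_module m" "(\<lambda>i. if i = 0 then p else 0) = (\<Sum>l<m. vscale (w l) (G l))"
      using G_gen by blast
    then have "p = (\<Sum>l<m. w l * g l)"
      using fun_cong[OF w(2), of 0] by (simp add: G_eval)
    then show "p \<in> (\<lambda>v. \<Sum>i<m. v i * g i) ` free_module m"
      using w(1) by blast
  qed
  have g_min: "coef (w l) 0 = 0" if "(\<Sum>l<m. w l * g l) = 0" "l < m" for w l
    using that by (intro G_min[of w l]) (auto simp: G_eval zero_fun_def)
  define K where "K = {v. v \<in> free_module m \<and> (\<Sum>i<m. v i * g i) = 0}"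
  have K: "vec.subspace K"
  proof (rule vec.subspaceI)
    show "0 \<in> K"
      using vec.subspace_0[OF subspace_free_module, of m] by (simp add: K_def zero_fun_apply)
    show "v + w \<in> K" if "v \<in> K" "w \<in> K" for v w
      using that by (simp add: K_def free_module_def plus_fun_apply distrib_right sum.distrib)
    show "vscale c v \<in> K" if "v \<in> K" for c v
      using that by (simp add: K_def free_module_def vscale_apply mult.assoc flip: sum_distrib_left)
  qed
  have K_free: "K \<subseteq> free_module m"
    by (auto simp: K_def)
  have K_comp: "vcomp a e v \<in> K" if "v \<in> K" for v e
  proof -
    have "(\<Sum>i<m. vcomp a e v i * g i) = hcomp e (\<Sum>i<m. v i * g i)"
      unfolding hcomp_sum by (rule sum.cong) (auto simp: vcomp_def hcomp_mult_hom[OF g(2)])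
    then show ?thesis
      using that by (auto simp: K_def vcomp_def free_module_def)
  qed
  obtain r b A where A: "\<And>l. l < r \<Longrightarrow> A l \<in> K" "\<And>l. l < r \<Longrightarrow> vhom a (b l) (A l)"
    and A_gen: "\<And>v. v \<in> K \<Longrightarrow> \<exists>w\<in>free_module r. v = (\<Sum>l<r. vscale (w l) (A l))"
    and A_min: "\<And>w l. (\<Sum>l<r. vscale (w l) (A l)) = 0 \<Longrightarrow> l < r \<Longrightarrow> coef (w l) 0 = 0"
    using minimal_homogeneous_generators[OF K K_free, of a] K_comp by blast
  have A_eval: "(\<lambda>i. if i < m then \<Sum>l<r. w l * A l i else 0) = (\<Sum>l<r. vscale (w l) (A l))" for w
  proof
    fix i
    have "A l i = 0" if "l < r" "\<not> i < m" for l
      using A(1)[OF that(1)] that(2) by (simp add: K_def free_module_def)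
    then show "(if i < m then \<Sum>l<r. w l * A l i else 0) = (\<Sum>l<r. vscale (w l) (A l)) i"
      by (simp add: sum_fun_apply vscale_apply)
  qed
  have free: "w = 0" if "w \<in> free_module r" "(\<Sum>l<r. vscale (w l) (A l)) = 0" for w
  proof (rule minimal_syzygies_free[OF J van gens, of r A w])
    show "A l \<in> free_module m \<and> (\<Sum>i<m. A l i * g i) = 0" if "l < r" for l
      using A(1)[OF that] by (simp add: K_def)
    show "\<exists>w\<in>free_module r. v = (\<Sum>l<r. vscale (w l) (A l))"
      if "v \<in> free_module m" "(\<Sum>i<m. v i * g i) = 0" for v
      using that by (intro A_gen) (simp add: K_def)
  qed (use A_min that in auto)
  have inj: "inj_on (\<lambda>w. \<Sum>l<r. vscale (w l) (A l)) (free_module r)"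
  proof (rule inj_onI)
    fix w w' :: "nat \<Rightarrow> ('x, 'k) mpoly"
    assume w: "w \<in> free_module r" "w' \<in> free_module r"
      "(\<Sum>l<r. vscale (w l) (A l)) = (\<Sum>l<r. vscale (w' l) (A l))"
    have "(\<Sum>l<r. vscale ((w - w') l) (A l)) = 0"
      using w(3) by (simp add: vec.scale_left_diff_distrib sum_subtractf)
    moreover have "w - w' \<in> free_module r"
      using w(1,2) by (simp add: free_module_def)
    ultimately show "w = w'"
      using free[of "w - w'"] by simp
  qed
  have "min_graded_resolution J (map a [0..<m]) (map b [0..<r]) g A"
    unfolding min_graded_resolution_def length_map length_upt diff_zero A_eval
  proof (intro conjI allI impI ballI)
    show "g i \<in> hom_piece (map a [0..<m] ! i)" if "i < m" for i
      using g(2)[OF that] that by simp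
    show "mdeg t + map a [0..<m] ! i = map b [0..<r] ! l"
      if "l < r" "i < m" "t \<in> keys (A l i)" for l i t
      using A(2)[OF that(1)] that by (simp add: vhom_def)
    show "(\<lambda>v. \<Sum>i<m. v i * g i) ` free_module m = J"
      by (rule gens)
    show "{v \<in> free_module m. (\<Sum>i<m. v i * g i) = 0} = (\<lambda>w. \<Sum>l<r. vscale (w l) (A l)) ` free_module r"
    proof -
      have "(\<Sum>l<r. vscale (w l) (A l)) \<in> K" for w
        using A(1) K by (intro vec.subspace_sum vec.subspace_scale) auto
      then show ?thesis
        using A_gen by (auto simp: K_def)
    qed
    show "inj_on (\<lambda>w. \<Sum>l<r. vscale (w l) (A l)) (free_module r)"
      by (rule inj)
    \<comment> \<open>Each \<open>A l\<close> is a relation among minimal generators, so its entries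
      have no constant term.\<close>
    show "coef (A l i) 0 = 0" if "l < r" "i < m" for l i
      using A(1)[OF that(1)] that(2) by (intro g_min[of "A l"]) (simp_all add: K_def)
  qed
  then show ?thesis by blast
qed

subsection \<open>Hilbert functions of homogeneous ideals\<close>

interpretation kv: vector_space "k_scale :: 'k::field \<Rightarrow> ('x::finite, 'k) mpoly \<Rightarrow> ('x, 'k) mpoly"
  by (rule vector_space_k_scale)

lemma coef_k_scale: "coef (k_scale c p) t = c * coef p t"
  using coef_single_mult_add[of 0 c p t] by (simp add: k_scale_def)

lemma k_scale_mult: "k_scale c (p * q) = k_scale c p * q" "k_scale c (p * q) = p * k_scale c q"
  by (simp_all add: k_scale_def ac_simps)

lemma hom_piece_subspace: "kv.subspace (hom_piece e)"
proof (rule kv.subspaceI)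
  show "k_scale c p \<in> hom_piece e" if "p \<in> hom_piece e" for c p
    using that by (auto simp: hom_piece_def in_keys_iff coef_k_scale)
qed (simp_all add: hom_piece_add)

lemma ideal_k_subspace: "is_ideal I \<Longrightarrow> kv.subspace I"
  unfolding is_ideal_def idl.subspace_def kv.subspace_def by (simp add: k_scale_def)

lemma finite_monomials: "finite {t :: 'x::finite \<Rightarrow>\<^sub>0 nat. mdeg t = e}"
proof -
  have "finite (PiE UNIV (\<lambda>_ :: 'x. {..e}))"
    by (intro finite_PiE) auto
  moreover have "inj (Poly_Mapping.lookup :: ('x \<Rightarrow>\<^sub>0 nat) \<Rightarrow> 'x \<Rightarrow> nat)"
    by (rule injI) (simp add: lookup_inject)
  ultimately have "finite (Poly_Mapping.lookup -` PiE UNIV (\<lambda>_ :: 'x. {..e}))"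
    by (rule finite_vimageI)
  moreover have "coef t x \<le> mdeg t" for t and x :: 'x
    unfolding mdeg_def by (rule member_le_sum) auto
  then have "{t :: 'x \<Rightarrow>\<^sub>0 nat. mdeg t = e} \<subseteq> Poly_Mapping.lookup -` PiE UNIV (\<lambda>_. {..e})"
    by auto
  ultimately show ?thesis
    by (rule rev_finite_subset)
qed

definition mons :: "nat \<Rightarrow> ('x::finite, 'k::field) mpoly set"
  where "mons e = (\<lambda>t. single t 1) ` {t. mdeg t = e}"

lemma inj_single_1: "inj (\<lambda>t. single t (1 :: 'k::zero_neq_one))"
  by (rule injI) (metis lookup_single_eq lookup_single_not_eq zero_neq_one)

lemma finite_mons: "finite (mons e)"
  by (simp add: mons_def finite_monomials)

lemma mpoly_sum_monomials: "p = (\<Sum>t\<in>keys p. k_scale (coef p t) (single t 1))"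
proof (rule poly_mapping_eqI)
  fix u
  show "coef p u = coef (\<Sum>t\<in>keys p. k_scale (coef p t) (single t 1)) u"
    by (simp add: lookup_sum coef_k_scale lookup_single when_def in_keys_iff if_distrib cong: if_cong)
qed

lemma hom_piece_span: "hom_piece e = kv.span (mons e :: ('x::finite, 'k::field) mpoly set)"
proof
  show "hom_piece e \<subseteq> kv.span (mons e :: ('x, 'k) mpoly set)"
  proof
    fix p :: "('x, 'k) mpoly" assume p: "p \<in> hom_piece e"
    have "(\<Sum>t\<in>keys p. k_scale (coef p t) (single t 1)) \<in> kv.span (mons e)"
      using p by (intro kv.span_sum kv.span_scale kv.span_base) (auto simp: mons_def hom_piece_def)
    then show "p \<in> kv.span (mons e)"
      using mpoly_sum_monomials[of p] by simp
  qed
  show "kv.span (mons e :: ('x, 'k) mpoly set) \<subseteq> hom_piece e"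
    by (rule kv.span_minimal[OF _ hom_piece_subspace]) (auto simp: mons_def hom_piece_def)
qed

lemma independent_mons: "kv.independent (mons e :: ('x::finite, 'k::field) mpoly set)"
proof (rule kv.independent_if_scalars_zero[OF finite_mons])
  fix f and p :: "('x, 'k) mpoly"
  assume z: "(\<Sum>x\<in>(mons e :: ('x, 'k) mpoly set). k_scale (f x) x) = 0" and p: "p \<in> mons e"
  obtain t where t: "p = single t 1" "mdeg t = e"
    using p by (auto simp: mons_def)
  have "coef (\<Sum>x\<in>(mons e :: ('x, 'k) mpoly set). k_scale (f x) x) t = (\<Sum>u | mdeg u = e. f (single u 1) * (1 when u = t))"
    unfolding mons_def
    by (subst sum.reindex) (auto intro: inj_on_subset[OF inj_single_1] simp: lookup_sum coef_k_scale lookup_single)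
  also have "\<dots> = (\<Sum>u | mdeg u = e. if u = t then f (single u 1) else 0)"
    by (rule sum.cong) (auto simp: when_def)
  also have "\<dots> = f p"
    using t by (simp add: finite_monomials)
  finally show "f p = 0"
    using z by simp
qed

lemma dim_hom_piece: "kv.dim (hom_piece e :: ('x::finite, 'k::field) mpoly set) = card {t :: 'x \<Rightarrow>\<^sub>0 nat. mdeg t = e}"
proof -
  have "kv.dim (hom_piece e :: ('x, 'k) mpoly set) = card (mons e :: ('x, 'k) mpoly set)"
    unfolding hom_piece_span by (rule kv.dim_span_eq_card_independent[OF independent_mons])
  also have "\<dots> = card {t :: 'x \<Rightarrow>\<^sub>0 nat. mdeg t = e}"
    unfolding mons_def by (rule card_image) (rule inj_on_subset[OF inj_single_1], simp)
  finally show ?thesis .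
qed

text \<open>Finite dimension makes the truncated subtraction in \<open>hilbert_function\<close>
  exact.\<close>

lemma hilbert_function_add:
  fixes I :: "('x::finite, 'k::field) mpoly set"
  assumes "is_ideal I"
  shows "hilbert_function I e + kv.dim (I \<inter> hom_piece e) = kv.dim (hom_piece e :: ('x, 'k) mpoly set)"
proof -
  have "kv.dim (I \<inter> hom_piece e) \<le> kv.dim (hom_piece e :: ('x, 'k) mpoly set)"
    by (rule kv.dim_mono_finite[OF _ _ hom_piece_subspace _ finite_mons[of e]])
      (simp_all add: hom_piece_span[symmetric] kv.subspace_inter ideal_k_subspace hom_piece_subspace assms)
  then show ?thesis
    by (simp add: hilbert_function_def)
qed

definition colon :: "'a::comm_ring_1 set \<Rightarrow> 'a \<Rightarrow> 'a set"
  where "colon I a = {p. a * p \<in> I}"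

lemma is_ideal_colon: "is_ideal I \<Longrightarrow> is_ideal (colon I a)"
  unfolding is_ideal_def colon_def idl.subspace_def
  by (auto simp: distrib_left mult.left_commute)

lemma homogeneous_colon:
  assumes "homogeneous_ideal I" "a \<in> hom_piece d"
  shows "homogeneous_ideal (colon I a)"
proof -
  have "a * hcomp e p = hcomp (e + d) (a * p)" for e p
    using hcomp_mult_hom[OF assms(2), of "e + d" p] by (simp add: mult.commute)
  then show ?thesis
    using assms(1) is_ideal_colon unfolding homogeneous_ideal_iff by (auto simp: colon_def)
qed

lemma homogeneous_insert:
  assumes "homogeneous_ideal I" "a \<in> hom_piece d"
  shows "homogeneous_ideal (ideal_gen (insert a I))"
proof -
  obtain S where "S \<subseteq> (\<Union>e. hom_piece e)" "I = ideal_gen S"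
    using assms(1) by (auto simp: homogeneous_ideal_def)
  then have "insert a S \<subseteq> (\<Union>e. hom_piece e)" "ideal_gen (insert a I) = ideal_gen (insert a S)"
    using assms(2) by (auto simp: ideal_gen_insert_ideal_gen)
  then show ?thesis
    unfolding homogeneous_ideal_def by blast
qed

lemma mem_ideal_gen_insert:
  assumes "is_ideal I"
  shows "p \<in> ideal_gen (insert a I) \<longleftrightarrow> (\<exists>k. p - k * a \<in> I)"
proof -
  have "idl.span I = I"
    using assms by (simp add: is_ideal_def)
  then show ?thesis
    using idl.span_breakdown_eq[of p a I] by (simp only: ideal_gen_def)
qed

text \<open>Multiplication by \<open>a\<close> from degree \<open>j\<close> to degree
  \<open>j + d\<close>, taken modulo \<open>I\<close>: its image together with \<open>I\<close> is
  the degree piece of (I, a), and the preimage of \<open>I\<close> is that of I : a. Below degree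
  \<open>d\<close> adjoining \<open>a\<close> changes nothing.\<close>

lemma hilbert_function_colon:
  fixes I :: "('x::finite, 'k::field) mpoly set"
  assumes hom: "homogeneous_ideal I" and a: "a \<in> hom_piece d"
  shows "hilbert_function I (j + d) = hilbert_function (colon I a) j + hilbert_function (ideal_gen (insert a I)) (j + d)"
    and "e < d \<Longrightarrow> hilbert_function I e = hilbert_function (ideal_gen (insert a I)) e"
proof -
  have I: "is_ideal I" and comp: "\<And>p e. p \<in> I \<Longrightarrow> hcomp e p \<in> I"
    using hom by (auto simp: homogeneous_ideal_iff)
  have sub: "idl.subspace I"
    using I by (simp add: is_ideal_def)
  define W where "W = I \<inter> hom_piece (j + d)"
  interpret vp: vector_space_pair k_scale k_scale
    by unfold_locales
  have lin: "Vector_Spaces.linear k_scale k_scale (\<lambda>p. a * p)"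
    by unfold_locales (simp_all add: distrib_left k_scale_mult(2))
  have 1: "{w + a * s |w s. w \<in> W \<and> s \<in> hom_piece j} = ideal_gen (insert a I) \<inter> hom_piece (j + d)"
  proof (intro equalityI subsetI)
    fix p assume "p \<in> {w + a * s |w s. w \<in> W \<and> s \<in> hom_piece j}"
    then obtain w s where ws: "p = w + a * s" "w \<in> W" "s \<in> hom_piece j"
      by blast
    then have "p - s * a \<in> I"
      by (simp add: W_def mult.commute)
    moreover have "p \<in> hom_piece (j + d)"
      using ws hom_piece_mult[OF ws(3) a] by (auto simp: W_def mult.commute intro: hom_piece_add)
    ultimately show "p \<in> ideal_gen (insert a I) \<inter> hom_piece (j + d)"
      using mem_ideal_gen_insert[OF I] by blast
  next
    fix p assume p: "p \<in> ideal_gen (insert a I) \<inter> hom_piece (j + d)"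
    then obtain k where k: "p - k * a \<in> I"
      using mem_ideal_gen_insert[OF I] by blast
    have "p = hcomp (j + d) ((p - k * a) + k * a)"
      using p hcomp_of_hom_piece[of p "j + d"] by simp
    also have "\<dots> = hcomp (j + d) (p - k * a) + a * hcomp j k"
      unfolding hcomp_add hcomp_mult_hom[OF a] by (simp add: mult.commute)
    finally have "p = hcomp (j + d) (p - k * a) + a * hcomp j k" .
    moreover have "hcomp (j + d) (p - k * a) \<in> W"
      using comp[OF k] by (simp add: W_def)
    moreover have "hcomp j k \<in> hom_piece j"
      by simp
    ultimately show "p \<in> {w + a * s |w s. w \<in> W \<and> s \<in> hom_piece j}"
      by blast
  qed
  have 2: "{s \<in> hom_piece j. a * s \<in> W} = colon I a \<inter> hom_piece j"
    using hom_piece_mult[OF _ a, of _ j] by (auto simp: W_def colon_def mult.commute[of a])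
  have W: "kv.subspace W" "W \<subseteq> kv.span (mons (j + d))"
    by (simp_all add: W_def hom_piece_span[symmetric] kv.subspace_inter ideal_k_subspace hom_piece_subspace I)
  have "kv.dim (ideal_gen (insert a I) \<inter> hom_piece (j + d)) + kv.dim (colon I a \<inter> hom_piece j)
      = kv.dim (I \<inter> hom_piece (j + d)) + kv.dim (hom_piece j :: ('x, 'k) mpoly set)"
    using vp.dim_add_image[OF lin hom_piece_subspace[of j] _ finite_mons[of j] W finite_mons]
    unfolding 1 2 by (simp add: hom_piece_span[symmetric] W_def)
  then show "hilbert_function I (j + d) = hilbert_function (colon I a) j + hilbert_function (ideal_gen (insert a I)) (j + d)"
    using hilbert_function_add[OF I, of "j + d"] hilbert_function_add[OF is_ideal_colon[OF I], of a j]
      hilbert_function_add[OF is_ideal_ideal_gen, of "insert a I" "j + d"] by linarith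
  show "hilbert_function I e = hilbert_function (ideal_gen (insert a I)) e" if "e < d"
  proof -
    have "ideal_gen (insert a I) \<inter> hom_piece e = I \<inter> hom_piece e"
    proof (intro equalityI subsetI)
      fix p assume p: "p \<in> ideal_gen (insert a I) \<inter> hom_piece e"
      then obtain k where k: "p - k * a \<in> I"
        using mem_ideal_gen_insert[OF I] by blast
      have "p = hcomp e ((p - k * a) + k * a)"
        using p hcomp_of_hom_piece[of p e] by simp
      also have "\<dots> = hcomp e (p - k * a)"
        unfolding hcomp_add hcomp_mult_hom[OF a] using that by simp
      finally show "p \<in> I \<inter> hom_piece e"
        using comp[OF k, of e] p by auto
    qed (auto simp: ideal_gen_def intro: idl.span_base)
    then show ?thesis
      by (simp add: hilbert_function_def)
  qed
qed

subsection \<open>Growth of Hilbert functions and chains of primes\<close>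

text \<open>Partial sums are monotone, so the degree shift in the colon formula is harmless for
  upper bounds. The bound in \<open>slow\<close> has a factor \<open>e + 1\<close> on the left in
  place of the exponent r - 1, so it makes sense for r = 0 as well.\<close>

definition hilbert_sum :: "('x::finite, 'k::field) mpoly set \<Rightarrow> nat \<Rightarrow> nat"
  where "hilbert_sum I e = (\<Sum>j\<le>e. hilbert_function I j)"

text \<open>\<open>slow r I\<close> says that \<open>P/I\<close> has dimension less than \<open>r\<close>, measured by its Hilbert function.\<close>

definition slow :: "nat \<Rightarrow> ('x::finite, 'k::field) mpoly set \<Rightarrow> bool"
  where "slow r I \<longleftrightarrow> (\<exists>C. \<forall>e. hilbert_sum I e * (e + 1) \<le> C * (e + 1) ^ r)"

lemma hilbert_sum_mono: "e \<le> e' \<Longrightarrow> hilbert_sum I e \<le> hilbert_sum I e'"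
  unfolding hilbert_sum_def by (rule sum_mono2) auto

lemma hilbert_sum_colon:
  assumes "homogeneous_ideal I" "a \<in> hom_piece d"
  shows "hilbert_sum I e = hilbert_sum (ideal_gen (insert a I)) e
    + (if d \<le> e then hilbert_sum (colon I a) (e - d) else 0)"
proof (induction e)
  case 0
  show ?case
    using hilbert_function_colon(1)[OF assms, of 0] hilbert_function_colon(2)[OF assms, of 0]
    by (cases "d = 0") (auto simp: hilbert_sum_def)
next
  case (Suc e)
  consider "Suc e < d" | "Suc e = d" | "d \<le> e"
    by linarith
  then show ?case
  proof cases
    case 1
    then show ?thesis
      using Suc hilbert_function_colon(2)[OF assms, of "Suc e"] by (simp add: hilbert_sum_def)
  next
    case 2
    then show ?thesis
      using Suc hilbert_function_colon(1)[OF assms, of 0] by (simp add: hilbert_sum_def flip: 2)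
  next
    case 3
    then show ?thesis
      using Suc hilbert_function_colon(1)[OF assms, of "Suc e - d"] by (simp add: hilbert_sum_def Suc_diff_le)
  qed
qed

lemma slow_colon:
  assumes "homogeneous_ideal I" "a \<in> hom_piece d"
    and "slow r (colon I a)" "slow r (ideal_gen (insert a I))"
  shows "slow r I"
proof -
  obtain C C' where C: "\<And>e. hilbert_sum (colon I a) e * (e + 1) \<le> C * (e + 1) ^ r"
    and C': "\<And>e. hilbert_sum (ideal_gen (insert a I)) e * (e + 1) \<le> C' * (e + 1) ^ r"
    using assms(3,4) by (auto simp: slow_def)
  have "hilbert_sum I e * (e + 1) \<le> (C' + C) * (e + 1) ^ r" for e
  proof -
    have "hilbert_sum I e \<le> hilbert_sum (ideal_gen (insert a I)) e + hilbert_sum (colon I a) e"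
      using hilbert_sum_mono[of "e - d" e "colon I a"] hilbert_sum_colon[OF assms(1,2), of e] by simp
    then have "hilbert_sum I e * (e + 1)
        \<le> hilbert_sum (ideal_gen (insert a I)) e * (e + 1) + hilbert_sum (colon I a) e * (e + 1)"
      by (metis add_mult_distrib mult_le_mono1)
    also have "\<dots> \<le> C' * (e + 1) ^ r + C * (e + 1) ^ r"
      using C C' by (intro add_mono)
    finally show ?thesis
      by (simp add: add_mult_distrib)
  qed
  then show ?thesis
    unfolding slow_def by blast
qed

lemma slow_UNIV: "slow r (UNIV :: ('x::finite, 'k::field) mpoly set)"
  unfolding slow_def by (intro exI[of _ 0]) (simp add: hilbert_sum_def hilbert_function_def)

text \<open>If neither factor lies in \<open>p\<close>, take the lowest components of both that lie
  outside. In the component of the product in the sum of their degrees every other term lies in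
  \<open>p\<close>, hence so does the product of these two.\<close>

lemma homogeneous_prime_idealI:
  assumes hom: "homogeneous_ideal p" and "p \<noteq> UNIV"
    and prime: "\<And>a b d e. a \<in> hom_piece d \<Longrightarrow> b \<in> hom_piece e \<Longrightarrow> a * b \<in> p \<Longrightarrow> a \<in> p \<or> b \<in> p"
  shows "prime_ideal p"
proof -
  have I: "is_ideal p" and comp: "\<And>q e. q \<in> p \<Longrightarrow> hcomp e q \<in> p"
    using hom by (auto simp: homogeneous_ideal_iff)
  have sub: "idl.subspace p"
    using I by (simp add: is_ideal_def)
  have least: "\<exists>i. hcomp i a \<notin> p \<and> (\<forall>j<i. hcomp j a \<in> p)" if a: "a \<notin> p" for a
  proof -
    obtain N where "(\<Sum>e\<le>N. hcomp e a) = a"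
      using hcomp_decomposition[of a] by blast
    then have "\<exists>i. hcomp i a \<notin> p"
      using a idl.subspace_sum[OF sub, of "{..N}" "\<lambda>e. hcomp e a"] by auto
    then show ?thesis
      using exists_least_iff[of "\<lambda>i. hcomp i a \<notin> p"] by auto
  qed
  have "a \<in> p \<or> b \<in> p" if ab: "a * b \<in> p" for a b
  proof (rule ccontr)
    assume "\<not> (a \<in> p \<or> b \<in> p)"
    then obtain i j where i: "hcomp i a \<notin> p" "\<And>k. k < i \<Longrightarrow> hcomp k a \<in> p"
      and j: "hcomp j b \<notin> p" "\<And>k. k < j \<Longrightarrow> hcomp k b \<in> p"
      using least by metis
    define f where "f k = hcomp (i + j - k) a * hcomp k b" for k
    have f: "f k \<in> p" if "k \<in> {..i + j} - {j}" for k
    proof (cases "k < j")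
      case True
      then show ?thesis
        using j(2) idl.subspace_scale[OF sub] by (simp add: f_def)
    next
      case False
      then have "i + j - k < i"
        using that by auto
      then show ?thesis
        using i(2) idl.subspace_scale[OF sub, of "hcomp (i + j - k) a" "hcomp k b"]
        by (simp add: f_def mult.commute)
    qed
    have "hcomp (i + j) (a * b) = f j + (\<Sum>k\<in>{..i + j} - {j}. f k)"
      unfolding hcomp_mult f_def by (subst sum.remove[of _ j]) auto
    moreover have "(\<Sum>k\<in>{..i + j} - {j}. f k) \<in> p"
      by (rule idl.subspace_sum[OF sub f])
    ultimately have "f j \<in> p"
      using comp[OF ab, of "i + j"] idl.subspace_diff[OF sub] by (metis add_diff_cancel_right')
    then have "hcomp i a * hcomp j b \<in> p"
      by (simp add: f_def)
    then show False
      using prime[OF hcomp_hom_piece hcomp_hom_piece] i(1) j(1) by blast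
  qed
  then show ?thesis
    using I assms(2) unfolding prime_ideal_def by blast
qed

lemma exists_homogeneous_prime:
  fixes I :: "('x::finite, 'k::field) mpoly set"
  assumes hom: "homogeneous_ideal I" and ns: "\<not> slow r I"
  shows "\<exists>p. homogeneous_ideal p \<and> prime_ideal p \<and> I \<subseteq> p \<and> \<not> slow r p"
proof -
  define F where "F = {K. homogeneous_ideal K \<and> I \<subseteq> K \<and> \<not> slow r K}"
  have "I \<in> F"
    using assms by (simp add: F_def)
  then have "F \<noteq> {}"
    by blast
  have "\<exists>M\<in>F. \<forall>X\<in>F. M \<subseteq> X \<longrightarrow> X = M"
  proof (rule subset_Zorn_nonempty[OF \<open>F \<noteq> {}\<close>])
    fix \<C> assume \<C>: "\<C> \<noteq> {}" "subset.chain F \<C>"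
    have CF: "\<C> \<subseteq> F" and total: "\<And>X Y. X \<in> \<C> \<Longrightarrow> Y \<in> \<C> \<Longrightarrow> X \<subseteq> Y \<or> Y \<subseteq> X"
      using \<C>(2) by (auto simp: subset_chain_def)
    have ideal: "idl.subspace X" if "X \<in> \<C>" for X
      using CF that by (auto simp: F_def homogeneous_ideal_iff is_ideal_def)
    have "is_ideal (\<Union>\<C>)"
      unfolding is_ideal_def
    proof (rule idl.subspaceI)
      show "0 \<in> \<Union>\<C>"
        using \<C>(1) ideal idl.subspace_0 by blast
      fix x y assume "x \<in> \<Union>\<C>" "y \<in> \<Union>\<C>"
      then obtain X Y where XY: "X \<in> \<C>" "Y \<in> \<C>" "x \<in> X" "y \<in> Y"
        by blast
      then obtain Z where "Z \<in> \<C>" "x \<in> Z" "y \<in> Z"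
        using total[OF XY(1,2)] by blast
      then show "x + y \<in> \<Union>\<C>"
        using ideal idl.subspace_add by blast
    next
      fix c x assume "x \<in> \<Union>\<C>"
      then show "c * x \<in> \<Union>\<C>"
        using ideal idl.subspace_scale by blast
    qed
    \<comment> \<open>Finitely many generators of the union already lie in one member, so the chain
      has a largest element and the growth condition passes to the union.\<close>
    from hilbert_basis[OF this] obtain S where S: "finite S" "S \<subseteq> \<Union>\<C>" "ideal_gen S = \<Union>\<C>"
      by (elim exE conjE)
    obtain B where B: "B \<in> \<C>" "S \<subseteq> B"
      using finite_subset_Union_chain[OF S(1,2) \<C>] by blast
    have "\<Union>\<C> \<subseteq> B"
      using S(3) idl.span_minimal[OF B(2) ideal[OF B(1)]] by (simp add: ideal_gen_def)
    then have "\<Union>\<C> = B"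
      using B(1) by blast
    then show "\<Union>\<C> \<in> F"
      using B(1) CF by blast
  qed
  then obtain p where p: "p \<in> F" "\<And>X. X \<in> F \<Longrightarrow> p \<subseteq> X \<Longrightarrow> X = p"
    by blast
  have hp: "homogeneous_ideal p" "I \<subseteq> p" "\<not> slow r p"
    using p(1) by (auto simp: F_def)
  have max: "slow r X" if "homogeneous_ideal X" "p \<subseteq> X" "X \<noteq> p" for X
    using p(2)[of X] that hp(2) by (auto simp: F_def)
  have ideal: "idl.subspace p"
    using hp(1) by (simp add: homogeneous_ideal_iff is_ideal_def)
  have "prime_ideal p"
  proof (rule homogeneous_prime_idealI[OF hp(1)])
    show "p \<noteq> UNIV"
      using hp(3) slow_UNIV by blast
    fix a b :: "('x, 'k) mpoly" and d e
    assume ab: "a \<in> hom_piece d" "b \<in> hom_piece e" "a * b \<in> p"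
    show "a \<in> p \<or> b \<in> p"
    proof (rule ccontr)
      assume *: "\<not> (a \<in> p \<or> b \<in> p)"
      \<comment> \<open>Both p : a and (p, a) are strictly larger than \<open>p\<close>, the former
        through \<open>b\<close> and the latter through \<open>a\<close>. Both are slow by
        maximality, and so \<open>p\<close> would be.\<close>
      have "b \<in> colon p a"
        using ab(3) by (simp add: colon_def)
      moreover have "p \<subseteq> colon p a"
        using idl.subspace_scale[OF ideal] by (auto simp: colon_def)
      ultimately have 1: "slow r (colon p a)"
        using * by (intro max homogeneous_colon[OF hp(1) ab(1)]) auto
      have "a \<in> ideal_gen (insert a p)" "p \<subseteq> ideal_gen (insert a p)"
        by (auto simp: ideal_gen_def intro: idl.span_base)
      then have "slow r (ideal_gen (insert a p))"
        using * by (intro max homogeneous_insert[OF hp(1) ab(1)]) auto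
      then show False
        using slow_colon[OF hp(1) ab(1) 1] hp(3) by blast
    qed
  qed
  then show ?thesis
    using hp by blast
qed

lemma homogeneous_subset_irrelevant:
  assumes hom: "homogeneous_ideal I" and "I \<noteq> UNIV"
  shows "I \<subseteq> irrelevant"
proof
  fix p assume p: "p \<in> I"
  have I: "is_ideal I" and comp: "hcomp 0 p \<in> I"
    using hom p by (auto simp: homogeneous_ideal_iff)
  show "p \<in> irrelevant"
  proof (rule ccontr)
    assume "p \<notin> irrelevant"
    then have nz: "coef p 0 \<noteq> 0"
      by (simp add: irrelevant_def)
    show False
      using ideal_with_constant[OF I nz] comp assms(2) by (simp add: hcomp_0_left)
  qed
qed

lemma slow_if_irrelevant_subset:
  fixes p :: "('x::finite, 'k::field) mpoly set"
  assumes "irrelevant \<subseteq> p"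
  shows "slow (Suc r) p"
proof -
  have "hilbert_function p j = 0" if "j \<noteq> 0" for j
  proof -
    have "hom_piece j \<subseteq> (irrelevant :: ('x, 'k) mpoly set)"
      using that by (force simp: hom_piece_def irrelevant_def in_keys_iff)
    then have "p \<inter> hom_piece j = hom_piece j"
      using assms by blast
    then show ?thesis
      by (simp add: hilbert_function_def)
  qed
  then have "hilbert_sum p e = hilbert_function p 0" for e
    unfolding hilbert_sum_def by (subst sum.remove[of _ 0]) auto
  moreover have "e + 1 \<le> (e + 1) ^ Suc r" for e :: nat
    by (rule self_le_power) simp_all
  ultimately show ?thesis
    unfolding slow_def by (metis mult_le_mono2)
qed

text \<open>A prime of positive dimension omits some variable. Modulo the prime this variable is a
  nonzerodivisor, so the partial sums after adjoining it are the first differences of the old ones;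
  summing them back costs at most a factor \<open>e + 1\<close>. The dimension therefore drops by at
  most one, and the induction continues above the prime.\<close>

lemma prime_chain_exists:
  fixes I :: "('x::finite, 'k::field) mpoly set"
  assumes "homogeneous_ideal I" "\<not> slow r I"
  shows "\<exists>c. prime_chain r c \<and> I \<subseteq> c 0 \<and> c r \<subseteq> irrelevant"
  using assms
proof (induction r arbitrary: I)
  case 0
  then obtain p where p: "homogeneous_ideal p" "prime_ideal p" "I \<subseteq> p"
    using exists_homogeneous_prime by blast
  then have "p \<subseteq> irrelevant"
    by (intro homogeneous_subset_irrelevant) (auto simp: prime_ideal_def)
  then show ?case
    using p by (intro exI[of _ "\<lambda>_. p"]) (simp add: prime_chain_def)
next
  case (Suc r)
  then obtain p where p: "homogeneous_ideal p" "prime_ideal p" "I \<subseteq> p" "\<not> slow (Suc r) p"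
    using exists_homogeneous_prime by blast
  have sub: "idl.subspace p"
    using p(1) by (simp add: homogeneous_ideal_iff is_ideal_def)
  have "\<exists>v. pvar v \<notin> p"
  proof (rule ccontr)
    assume "\<nexists>v. pvar v \<notin> p"
    then have all: "pvar v \<in> p" for v
      by blast
    have "irrelevant \<subseteq> p"
    proof
      fix q :: "('x, 'k) mpoly" assume "q \<in> irrelevant"
      then have "q = (\<Sum>i\<in>UNIV. divmin i q * pvar i)"
        by (intro pvar_decomposition) (simp add: irrelevant_def)
      also have "\<dots> \<in> p"
        using all by (intro idl.subspace_sum[OF sub] idl.subspace_scale[OF sub])
      finally show "q \<in> p" .
    qed
    then show False
      using slow_if_irrelevant_subset p(4) by blast
  qed
  then obtain v where v: "pvar v \<notin> p"
    by blast
  define f where "f = (pvar v :: ('x, 'k) mpoly)"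
  define I' where "I' = ideal_gen (insert f p)"
  have f: "f \<in> hom_piece 1"
    by (simp add: f_def pvar_hom_piece[unfolded One_nat_def])
  have "colon p f = p"
    using p(2) v idl.subspace_scale[OF sub] unfolding prime_ideal_def colon_def f_def by blast
  then have rec: "hilbert_sum p e = hilbert_sum I' e + (if 1 \<le> e then hilbert_sum p (e - 1) else 0)" for e
    using hilbert_sum_colon[OF p(1) f, of e] by (simp add: I'_def)
  have le: "hilbert_sum p e \<le> (e + 1) * hilbert_sum I' e" for e
  proof (induction e)
    case 0
    then show ?case using rec[of 0] by simp
  next
    case (Suc e)
    have "hilbert_sum p (Suc e) = hilbert_sum I' (Suc e) + hilbert_sum p e"
      using rec[of "Suc e"] by simp
    also have "\<dots> \<le> hilbert_sum I' (Suc e) + (e + 1) * hilbert_sum I' (Suc e)"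
      using Suc hilbert_sum_mono[of e "Suc e" I'] by (intro add_left_mono order_trans[OF Suc] mult_le_mono2) simp
    finally show ?case by simp
  qed
  have "\<not> slow r I'"
  proof
    assume "slow r I'"
    then obtain C where C: "\<And>e. hilbert_sum I' e * (e + 1) \<le> C * (e + 1) ^ r"
      by (auto simp: slow_def)
    have "hilbert_sum p e * (e + 1) \<le> C * (e + 1) ^ Suc r" for e
    proof -
      have "hilbert_sum p e \<le> C * (e + 1) ^ r"
        using le[of e] C[of e] by (simp add: mult.commute)
      then have "hilbert_sum p e * (e + 1) \<le> C * (e + 1) ^ r * (e + 1)"
        by (rule mult_le_mono1)
      then show ?thesis by (simp add: ac_simps)
    qed
    then show False
      using p(4) unfolding slow_def by blast
  qed
  moreover have "homogeneous_ideal I'"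
    unfolding I'_def by (rule homogeneous_insert[OF p(1) f])
  ultimately obtain c where c: "prime_chain r c" "I' \<subseteq> c 0" "c r \<subseteq> irrelevant"
    using Suc.IH by blast
  define c' where "c' i = (case i of 0 \<Rightarrow> p | Suc j \<Rightarrow> c j)" for i
  have "f \<in> I'" "p \<subseteq> I'"
    by (auto simp: I'_def ideal_gen_def intro: idl.span_base)
  then have "p \<subset> c 0"
    using c(2) v by (auto simp: f_def)
  then have "prime_chain (Suc r) c'"
    using c(1) p(2) by (auto simp: prime_chain_def c'_def split: nat.splits)
  moreover have "I \<subseteq> c' 0" "c' (Suc r) \<subseteq> irrelevant"
    using p(3) c(3) by (simp_all add: c'_def)
  ultimately show ?case
    by blast
qed

section \<open>Growth forced by the h-vector\<close>

lemma fact_mult_power_le: "fact e * (e + 1) ^ q \<le> (fact (e + q) :: nat)"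
proof (induction q)
  case (Suc q)
  have "fact e * (e + 1) ^ Suc q = (e + 1) * (fact e * (e + 1) ^ q)"
    by (simp only: power_Suc ac_simps)
  also have "\<dots> \<le> (e + q + 1) * fact (e + q)"
    by (rule mult_le_mono) (use Suc in auto)
  also have "\<dots> = fact (e + Suc q)"
    by simp
  finally show ?case .
qed simp

lemma binomial_growth: "(e + 1) ^ q \<le> fact q * ((e + q) choose e)"
proof -
  have "fact e * (e + 1) ^ q \<le> fact e * (fact q * ((e + q) choose e))"
    using fact_mult_power_le[of e q] binomial_fact_lemma[of e "e + q"] by (simp add: mult.assoc)
  then show ?thesis
    by simp
qed

lemma hilbert_series_times_power:
  fixes J :: "('x::finite, 'k::field) mpoly set"
  assumes "has_h_vector J h"
  shows "hilbert_series J * (1 - fps_X) ^ (CARD('x) - 2) = Abs_fps (\<lambda>j. of_int (h (int j)))"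
proof -
  have unit: "fps_nth ((1 - fps_X :: rat fps) ^ (CARD('x) - 2)) 0 \<noteq> 0"
    by (simp add: fps_power_zeroth)
  show ?thesis
    using assms inverse_mult_eq_1[OF unit] unfolding has_h_vector_def fps_divide_unit[OF unit]
    by (simp add: mult.assoc)
qed

text \<open>Put q = n - 2. The partial sums have the generating series of \<open>h\<close> divided
  by (1 - t)^(q + 1). As \<open>h\<close> is nonnegative with \<open>h 0 = 1\<close>, they dominate
  the binomial coefficients from 1/(1 - t)^(q + 1), which grow like the q-th power of the
  degree.\<close>

lemma not_slow_h_vector:
  fixes J :: "('x::finite, 'k::field) mpoly set"
  assumes h: "has_h_vector J h" "h 0 = 1" "\<And>j. h j \<ge> 0"
  shows "\<not> slow (CARD('x) - 2) J"
proof
  define q where "q = CARD('x) - 2"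
  assume "slow (CARD('x) - 2) J"
  then obtain C where C: "\<And>e. hilbert_sum J e * (e + 1) \<le> C * (e + 1) ^ q"
    by (auto simp: slow_def q_def)
  define H where "H = Abs_fps (\<lambda>j. rat_of_int (h (int j)))"
  define B where "B = Abs_fps (\<lambda>k. rat_of_nat ((q + k) choose k))"
  have unit: "fps_nth ((1 - fps_X :: rat fps) ^ k) 0 \<noteq> 0" for k
    by (simp add: fps_power_zeroth)
  have B: "B * (1 - fps_X) ^ Suc q = 1"
  proof -
    have "inverse ((1 - fps_const 1 * fps_X :: rat fps) ^ Suc q) = B"
      using one_minus_const_fps_X_neg_power'[of "Suc q" "1 :: rat"] by (simp add: B_def)
    then show ?thesis
      using inverse_mult_eq_1[OF unit[of "Suc q"]] by simp
  qed
  have "hilbert_series J * (1 - fps_X) ^ q = H"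
    using hilbert_series_times_power[OF h(1)] by (simp add: H_def q_def)
  then have "(hilbert_series J * (1 - fps_X) ^ q) * B = H * B"
    by simp
  then have "hilbert_series J * (B * (1 - fps_X) ^ Suc q) = H * B * (1 - fps_X)"
    by (simp add: ac_simps)
  then have "hilbert_series J = (H * B) * (1 - fps_X)"
    unfolding B by simp
  then have "hilbert_series J * inverse (1 - fps_X) = H * B * ((1 - fps_X) * inverse (1 - fps_X))"
    by (simp add: ac_simps)
  then have S: "hilbert_series J * inverse (1 - fps_X) = H * B"
    using inverse_mult_eq_1'[OF unit[of 1]] by simp
  have "rat_of_nat (hilbert_sum J e) = fps_nth (H * B) e" for e
    unfolding S[symmetric] hilbert_sum_def hilbert_series_def
    by (simp add: fps_mult_nth fps_inverse_one_minus_fps_X atLeast0AtMost)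
  moreover have "fps_nth (H * B) e \<ge> rat_of_nat ((q + e) choose e)" for e
  proof -
    have "fps_nth (H * B) e = (\<Sum>i=0..e. fps_nth H i * fps_nth B (e - i))"
      by (rule fps_mult_nth)
    also have "\<dots> \<ge> fps_nth H 0 * fps_nth B (e - 0)"
      by (rule member_le_sum) (auto simp: H_def B_def h(3))
    finally show ?thesis
      by (simp add: H_def B_def h(2))
  qed
  ultimately have S_ge: "hilbert_sum J e \<ge> (q + e) choose e" for e
    by (metis of_nat_le_iff)
  have "e + 1 \<le> fact q * C" for e
  proof -
    have "(e + 1) ^ q * (e + 1) \<le> fact q * ((q + e) choose e) * (e + 1)"
      using binomial_growth[of e q] by (intro mult_le_mono1) (simp add: add.commute)
    also have "\<dots> \<le> fact q * (hilbert_sum J e * (e + 1))"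
      using S_ge[of e] by (simp only: mult.assoc) (intro mult_le_mono2 mult_le_mono1)
    also have "\<dots> \<le> fact q * (C * (e + 1) ^ q)"
      using C by (rule mult_le_mono2)
    finally have "(e + 1) ^ q * (e + 1) \<le> (e + 1) ^ q * (fact q * C)"
      by (simp only: ac_simps)
    then show ?thesis
      by (subst (asm) mult_le_cancel1) simp
  qed
  from this[of "fact q * C"] show False
    by simp
qed

lemma koszul_vanishes_cohen_macaulay:
  fixes J :: "('x::finite, 'k::field) mpoly set"
  assumes hom: "homogeneous_ideal J" and cm: "cohen_macaulay_quotient J" and ns: "\<not> slow (CARD('x) - 2) J"
  shows "koszul_vanishes 3 J"
proof -
  define N where "N = CARD('x) - 2"
  obtain c where c: "prime_chain N c" "J \<subseteq> c 0" "c N \<subseteq> irrelevant"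
    using prime_chain_exists[OF hom ns] by (auto simp: N_def)
  have "J \<noteq> UNIV"
    using ns slow_UNIV by blast
  then have "J \<subseteq> irrelevant"
    by (rule homogeneous_subset_irrelevant[OF hom])
  then have "local_depth J irrelevant = local_dim J irrelevant"
    using cm maximal_ideal_irrelevant by (auto simp: cohen_macaulay_quotient_def)
  moreover have "enat N \<le> local_dim J irrelevant"
    unfolding local_dim_def using c by (intro SUP_upper) blast
  ultimately have depth: "enat N \<le> local_depth J irrelevant"
    by simp
  have "\<exists>fs. regular_sequence_at J irrelevant fs \<and> N \<le> length fs"
  proof (rule ccontr)
    assume "\<not> ?thesis"
    then have less: "length fs < N" if "regular_sequence_at J irrelevant fs" for fs
      using that not_le by blast
    \<comment> \<open>The empty sequence excludes N = 0, so \<open>N - 1\<close> is a true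
      predecessor. Otherwise all lengths, and hence their supremum, would be at most N - 1.\<close>
    have "regular_sequence_at J irrelevant []"
      by (simp add: regular_sequence_at_def)
    then have "0 < N"
      using less[of "[]"] by simp
    have "local_depth J irrelevant \<le> enat (N - 1)"
      unfolding local_depth_def using less by (intro SUP_least) fastforce
    then have "enat N \<le> enat (N - 1)"
      using depth by (rule order_trans[rotated])
    then show False
      using \<open>0 < N\<close> by simp
  qed
  then obtain fs where "regular_sequence_at J irrelevant fs" "N \<le> length fs"
    by blast
  then show ?thesis
    using hom by (intro koszul_vanishes_of_regular_sequence) (auto simp: homogeneous_ideal_iff N_def)
qed

subsection \<open>Height two requires two variables\<close>

text \<open>Here the leading coefficient is the one of lowest order. Factor out
  \<open>p ^ k\<close>, which can be cancelled modulo the prime \<open>c\<close>; what remains is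
  \<open>a k\<close> plus a multiple of \<open>p\<close>, and \<open>p\<close> lies in the larger
  ideal.\<close>

lemma leading_coefficient_in_larger_prime:
  assumes c: "prime_ideal c" "p \<notin> c" and c': "is_ideal c'" "c \<subseteq> c'" "p \<in> c'"
    and rel: "(\<Sum>i\<le>N. a i * p ^ i) \<in> c" and k: "k \<le> N" "\<And>i. i < k \<Longrightarrow> a i = 0"
  shows "a k \<in> c'"
proof -
  have sub: "idl.subspace c'"
    using c'(1) by (simp add: is_ideal_def)
  define R where "R = (\<Sum>i\<in>{Suc k..N}. a i * p ^ (i - Suc k))"
  have "(\<Sum>i\<le>N. a i * p ^ i) = (\<Sum>i\<in>{k..N}. a i * p ^ i)"
    using k(2) by (intro sum.mono_neutral_right) auto
  also have "{k..N} = insert k {Suc k..N}"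
    using k(1) by auto
  also have "(\<Sum>i\<in>insert k {Suc k..N}. a i * p ^ i) = a k * p ^ k + (\<Sum>i\<in>{Suc k..N}. a i * p ^ i)"
    by simp
  also have "(\<Sum>i\<in>{Suc k..N}. a i * p ^ i) = p ^ k * (R * p)"
    unfolding R_def sum_distrib_left sum_distrib_right
  proof (rule sum.cong[OF refl])
    fix i assume "i \<in> {Suc k..N}"
    then have "i = k + Suc (i - Suc k)"
      by simp
    then have "p ^ i = p ^ k * (p ^ (i - Suc k) * p)"
      by (metis power_add power_Suc2)
    then show "a i * p ^ i = p ^ k * (a i * p ^ (i - Suc k) * p)"
      by (simp add: ac_simps)
  qed
  finally have "p ^ k * (a k + R * p) \<in> c"
    using rel by (simp add: algebra_simps)
  moreover have "q \<in> c" if "p ^ j * q \<in> c" for j q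
    using that c by (induction j) (auto simp: prime_ideal_def mult.assoc)
  ultimately have "a k + R * p \<in> c'"
    using c'(2) by blast
  moreover have "R * p \<in> c'"
    using c'(3) idl.subspace_scale[OF sub] by blast
  ultimately show ?thesis
    using idl.subspace_diff[OF sub] by fastforce
qed

lemma keys_mult_degree:
  assumes "\<And>t. t \<in> keys p \<Longrightarrow> mdeg t \<le> d" "\<And>t. t \<in> keys q \<Longrightarrow> mdeg t \<le> e" "t \<in> keys (p * q)"
  shows "mdeg t \<le> d + e"
  using assms keys_mult[of p q] by (fastforce simp: mdeg_add intro: add_mono)

lemma keys_power_degree:
  fixes p :: "('x::finite, 'k::field) mpoly"
  assumes "\<And>t. t \<in> keys p \<Longrightarrow> mdeg t \<le> d" "t \<in> keys (p ^ i)"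
  shows "mdeg t \<le> i * d"
  using assms(2)
proof (induction i arbitrary: t)
  case (Suc i)
  then show ?case
    using keys_mult_degree[of p d "p ^ i" "i * d" t] assms(1) by simp
qed (simp split: if_splits)

text \<open>Take \<open>p\<close> and \<open>q\<close> from the two steps of the chain. A dimension
  count gives an algebraic relation between them. Its lowest coefficient in powers of
  \<open>p\<close> is a polynomial in \<open>q\<close> lying in \<open>c1\<close>, whose lowest
  coefficient in turn is a nonzero constant lying in \<open>c2\<close>.\<close>

lemma no_prime_chain_one_variable:
  fixes c0 c1 c2 :: "('x::finite, 'k::field) mpoly set"
  assumes "CARD('x) = 1" "prime_ideal c0" "prime_ideal c1" "prime_ideal c2" "c0 \<subset> c1" "c1 \<subset> c2"
  shows False
proof -
  obtain x :: 'x where x: "UNIV = {x}"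
    using assms(1) by (auto simp: card_1_singleton_iff)
  obtain p q where pq: "p \<in> c1" "p \<notin> c0" "q \<in> c2" "q \<notin> c1"
    using assms(5,6) by blast
  obtain dp dq where dp: "\<And>t. t \<in> keys p \<Longrightarrow> mdeg t \<le> dp" and dq: "\<And>t. t \<in> keys q \<Longrightarrow> mdeg t \<le> dq"
    using degree_bound_exists[of p] degree_bound_exists[of q] by blast
  define d where "d = Suc (max dp dq)"
  have d: "mdeg t \<le> d" if "t \<in> keys p \<or> t \<in> keys q" for t
    using that dp[of t] dq[of t] by (auto simp: d_def)
  \<comment> \<open>There are (N + 1)^2 products of powers, in a space of dimension at most 2Nd + 1.
    With N = 2d the comparison is 4d^2 + 1 < (2d + 1)^2, strict because d is a successor.\<close>
  define N where "N = 2 * d"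
  define E where "E = N * d + N * d"
  define B where "B = (\<lambda>i. single (single x i) 1 :: ('x, 'k) mpoly) ` {..E}"
  define v where "v ij = p ^ fst ij * q ^ snd ij" for ij :: "nat \<times> nat"
  have mon: "t = single x (mdeg t)" for t :: "'x \<Rightarrow>\<^sub>0 nat"
  proof (rule poly_mapping_eqI)
    fix y
    have "y = x"
      using x by blast
    then show "coef t y = coef (single x (mdeg t)) y"
      by (simp add: mdeg_def x)
  qed
  have "v ij \<in> kv.span B" if ij: "ij \<in> {..N} \<times> {..N}" for ij
  proof -
    have "mdeg t \<le> E" if t: "t \<in> keys (v ij)" for t
    proof -
      have "mdeg t \<le> fst ij * d + snd ij * d"
        using keys_mult_degree[OF keys_power_degree[of p d] keys_power_degree[of q d]] d t
        unfolding v_def by blast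
      also have "\<dots> \<le> E"
        using ij unfolding E_def by (intro add_mono mult_le_mono1) auto
      finally show ?thesis .
    qed
    then have "single t 1 \<in> B" if "t \<in> keys (v ij)" for t
      using that mon[of t] unfolding B_def by (metis atMost_iff imageI)
    then have "(\<Sum>t\<in>keys (v ij). k_scale (coef (v ij) t) (single t 1)) \<in> kv.span B"
      by (intro kv.span_sum kv.span_scale kv.span_base)
    then show ?thesis
      using mpoly_sum_monomials[of "v ij"] by simp
  qed
  moreover have "card B < card ({..N} \<times> {..N})"
  proof -
    have "card B \<le> E + 1"
      unfolding B_def using card_image_le[of "{..E}"] by simp
    also have "\<dots> < (N + 1) * (N + 1)"
      by (simp add: E_def N_def d_def algebra_simps)
    finally show ?thesis
      by (simp add: card_cartesian_product)
  qed
  ultimately obtain \<mu> where l: "\<exists>ij\<in>{..N} \<times> {..N}. \<mu> ij \<noteq> 0"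
    "(\<Sum>ij\<in>{..N} \<times> {..N}. k_scale (\<mu> ij) (v ij)) = 0"
    using kv.dependent_family[of "{..N} \<times> {..N}" B v] by (auto simp: B_def)
  define a where "a i = (\<Sum>j\<le>N. single 0 (\<mu> (i, j)) * q ^ j)" for i
  have "(\<Sum>i\<le>N. a i * p ^ i) = (\<Sum>ij\<in>{..N} \<times> {..N}. k_scale (\<mu> ij) (v ij))"
    unfolding a_def sum_distrib_right sum.cartesian_product
    by (rule sum.cong) (auto simp: v_def k_scale_def ac_simps)
  then have rel: "(\<Sum>i\<le>N. a i * p ^ i) \<in> c0"
    using l(2) assms(2) by (simp add: prime_ideal_def is_ideal_def idl.subspace_0)
  obtain k where k: "k \<le> N" "\<exists>j\<le>N. \<mu> (k, j) \<noteq> 0" "\<And>i. i < k \<Longrightarrow> \<not> (\<exists>j\<le>N. \<mu> (i, j) \<noteq> 0)"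
  proof -
    define Q where "Q i \<longleftrightarrow> i \<le> N \<and> (\<exists>j\<le>N. \<mu> (i, j) \<noteq> 0)" for i
    have "\<exists>i. Q i"
      using l(1) by (auto simp: Q_def)
    then obtain k where "Q k" "\<And>i. i < k \<Longrightarrow> \<not> Q i"
      using exists_least_iff[of Q] by blast
    then show thesis
      using that[of k] by (simp add: Q_def)
  qed
  have "a k \<in> c1"
  proof (rule leading_coefficient_in_larger_prime[OF assms(2) pq(2) _ _ pq(1) rel k(1)])
    show "a i = 0" if "i < k" for i
      using k(3)[OF that] by (simp add: a_def)
  qed (use assms in \<open>auto simp: prime_ideal_def\<close>)
  then have rel': "(\<Sum>j\<le>N. single 0 (\<mu> (k, j)) * q ^ j) \<in> c1"
    by (simp add: a_def)
  obtain j where j: "j \<le> N" "\<mu> (k, j) \<noteq> 0" "\<And>i. i < j \<Longrightarrow> \<mu> (k, i) = 0"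
  proof -
    obtain j0 where "j0 \<le> N" "\<mu> (k, j0) \<noteq> 0"
      using k(2) by blast
    moreover obtain j where "\<mu> (k, j) \<noteq> 0" "\<And>i. i < j \<Longrightarrow> \<mu> (k, i) = 0"
      using exists_least_iff[of "\<lambda>j. \<mu> (k, j) \<noteq> 0"] calculation by blast
    ultimately show thesis
      using that[of j] by (metis le_trans linorder_le_less_linear less_imp_le)
  qed
  have "single 0 (\<mu> (k, j)) \<in> c2"
  proof (rule leading_coefficient_in_larger_prime[OF assms(3) pq(4) _ _ pq(3) rel' j(1)])
    show "(single 0 (\<mu> (k, i)) :: ('x, 'k) mpoly) = 0" if "i < j" for i
      using j(3)[OF that] by simp
  qed (use assms in \<open>auto simp: prime_ideal_def\<close>)
  moreover have "is_ideal c2" "c2 \<noteq> UNIV"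
    using assms(4) by (auto simp: prime_ideal_def)
  ultimately show False
    using ideal_with_constant[OF _ j(2)] by blast
qed

lemma card_vars_ge_2:
  fixes J :: "('x::finite, 'k::field) mpoly set"
  assumes "ideal_height J = 2"
  shows "CARD('x) \<ge> 2"
proof (rule ccontr)
  assume "\<not> CARD('x) \<ge> 2"
  moreover have "CARD('x) > 0"
    by simp
  ultimately have card1: "CARD('x) = 1"
    by linarith
  \<comment> \<open>Otherwise the height would be an infimum over the empty set, hence
    infinite.\<close>
  have "\<exists>p. prime_ideal p \<and> J \<subseteq> p"
  proof (rule ccontr)
    assume "\<nexists>p. prime_ideal p \<and> J \<subseteq> p"
    then have "{p. prime_ideal p \<and> J \<subseteq> p} = {}"
      by blast
    then have "ideal_height J = top"
      by (simp only: ideal_height_def image_empty Inf_empty)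
    then show False
      using assms by (simp add: top_enat_def)
  qed
  then obtain p where p: "prime_ideal p" "J \<subseteq> p"
    by blast
  have "ideal_height J \<le> prime_height p"
    unfolding ideal_height_def using p by (intro INF_lower) blast
  then have ht: "2 \<le> prime_height p"
    using assms by simp
  have "\<exists>l c. prime_chain l c \<and> c l = p \<and> 2 \<le> l"
  proof (rule ccontr)
    assume "\<not> ?thesis"
    then have "prime_height p \<le> enat 1"
      unfolding prime_height_def by (intro SUP_least) (fastforce simp: not_le)
    with ht have "(2 :: enat) \<le> enat 1"
      by (rule order_trans)
    then show False
      by (simp add: numeral_eq_enat)
  qed
  then obtain l and c :: "nat \<Rightarrow> ('x, 'k) mpoly set" where c: "prime_chain l c" "2 \<le> l"
    by blast
  then obtain k where k: "l = Suc (Suc k)"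
    by (metis Suc_le_D numeral_2_eq_2 Suc_le_mono)
  show False
    by (rule no_prime_chain_one_variable[OF card1, of "c k" "c (Suc k)" "c (Suc (Suc k))"])
      (use c(1) in \<open>auto simp: prime_chain_def k\<close>)
qed

subsection \<open>The number of generators\<close>

lemma vector_space_fun: "vector_space (\<lambda>(c :: 'k::field) f. (\<lambda>x. c * f x))"
  by unfold_locales (auto simp: fun_eq_iff plus_fun_apply algebra_simps)

lemma resolution_generator_mem:
  assumes "min_graded_resolution J a b g A" "i < length a"
  shows "g i \<in> J"
proof -
  have J: "(\<lambda>v. \<Sum>i<length a. v i * g i) ` free_module (length a) = J"
    using assms(1) by (simp add: min_graded_resolution_def)
  have "g i = (\<Sum>j<length a. (if j = i then 1 else 0) * g j)"
    using assms(2) by (simp add: if_distrib[of "\<lambda>x. x * _"] cong: if_cong)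
  moreover have "(\<lambda>j. if j = i then 1 else 0) \<in> free_module (length a)"
    using assms(2) by (simp add: free_module_def)
  ultimately show ?thesis
    unfolding J[symmetric] by (intro image_eqI)
qed

text \<open>Since \<open>S\<close> may be inhomogeneous, the argument uses constant terms in place
  of degrees. If \<open>S\<close> were too small, the constant terms of the \<open>g i\<close>
  expressed through \<open>S\<close> would be linearly dependent over k. The same combination of the
  \<open>g i\<close> then has coefficients over \<open>S\<close> without constant terms; expressing
  \<open>S\<close> back through \<open>g\<close> gives a syzygy with some nonzero constant term,
  against minimality.\<close>

lemma generators_card_ge:
  fixes J :: "('x::finite, 'k::field) mpoly set"
  assumes res: "min_graded_resolution J a b g A" and S: "finite S" "ideal_gen S = J"
  shows "length a \<le> card S"
proof (rule ccontr)
  assume "\<not> length a \<le> card S"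
  define m where "m = length a"
  have card: "card S < card {..<m}"
    using \<open>\<not> length a \<le> card S\<close> by (simp add: m_def)
  have J: "(\<lambda>v. \<Sum>i<m. v i * g i) ` free_module m = J"
    using res by (simp add: min_graded_resolution_def m_def)
  have syz: "coef (v i) 0 = 0" if "v \<in> free_module m" "(\<Sum>i<m. v i * g i) = 0" "i < m" for v i
  proof -
    have "v \<in> (\<lambda>w i. if i < m then \<Sum>l<length b. w l * A l i else 0) ` free_module (length b)"
      using res that(1,2) unfolding min_graded_resolution_def m_def by blast
    then obtain w where "v = (\<lambda>i. if i < m then \<Sum>l<length b. w l * A l i else 0)"
      by blast
    moreover have "coef (A l i) 0 = 0" if "l < length b" for l
      using res that \<open>i < m\<close> by (simp add: min_graded_resolution_def m_def)
    ultimately show ?thesis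
      using that(3) by (simp add: lookup_sum coef_0_mult)
  qed
  have "g i \<in> J" if "i < m" for i
    using resolution_generator_mem[OF res] that by (simp add: m_def)
  then have "\<exists>u. g i = (\<Sum>s\<in>S. u s * s)" if "i < m" for i
    using that idl.span_finite[OF S(1)] S(2) by (auto simp: ideal_gen_def)
  then obtain q where q: "\<And>i. i < m \<Longrightarrow> g i = (\<Sum>s\<in>S. q i s * s)"
    by metis
  have "\<exists>v\<in>free_module m. s = (\<Sum>i<m. v i * g i)" if "s \<in> S" for s
  proof -
    have "s \<in> J"
      using that S(2) idl.span_base by (auto simp: ideal_gen_def)
    then show ?thesis
      using J by blast
  qed
  then obtain p where p: "\<And>s. s \<in> S \<Longrightarrow> p s \<in> free_module m" "\<And>s. s \<in> S \<Longrightarrow> s = (\<Sum>i<m. p s i * g i)"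
    by metis
  interpret fv: vector_space "\<lambda>(c :: 'k) f. (\<lambda>s :: ('x, 'k) mpoly. c * f s)"
    by (rule vector_space_fun)
  define u where "u i s = (if s \<in> S then coef (q i s) 0 else 0)" for i s
  define \<delta> where "\<delta> s = (\<lambda>s'. if s' = s then 1 else 0 :: 'k)" for s :: "('x, 'k) mpoly"
  have "u i = (\<Sum>s\<in>S. (\<lambda>s'. u i s * \<delta> s s'))" for i
    by (rule ext) (auto simp: sum_fun_apply \<delta>_def u_def S(1) if_distrib cong: if_cong)
  moreover have "(\<Sum>s\<in>S. (\<lambda>s'. u i s * \<delta> s s')) \<in> fv.span (\<delta> ` S)" for i
    by (intro fv.span_sum fv.span_scale fv.span_base) auto
  ultimately have "u i \<in> fv.span (\<delta> ` S)" for i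
    by simp
  moreover have "card (\<delta> ` S) < card {..<m}"
    using card card_image_le[OF S(1), of \<delta>] by linarith
  ultimately obtain \<mu> where l: "\<exists>i\<in>{..<m}. \<mu> i \<noteq> 0" "(\<Sum>i<m. (\<lambda>s. \<mu> i * u i s)) = 0"
    using fv.dependent_family[of "{..<m}" "\<delta> ` S" u] S(1) by auto
  define r where "r s = (\<Sum>i<m. single 0 (\<mu> i) * q i s)" for s
  have r0: "coef (r s) 0 = 0" if "s \<in> S" for s
    using fun_cong[OF l(2), of s] that by (simp add: r_def lookup_sum coef_0_mult sum_fun_apply u_def zero_fun_apply)
  define w where "w i = (if i < m then single 0 (\<mu> i) - (\<Sum>s\<in>S. r s * p s i) else 0)" for i
  have "(\<Sum>i<m. single 0 (\<mu> i) * g i) = (\<Sum>i<m. \<Sum>s\<in>S. (single 0 (\<mu> i) * q i s) * s)"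
    using q by (intro sum.cong) (simp_all add: sum_distrib_left mult.assoc)
  also have "\<dots> = (\<Sum>s\<in>S. r s * s)"
    by (subst sum.swap) (simp add: r_def sum_distrib_right)
  also have "\<dots> = (\<Sum>s\<in>S. \<Sum>i<m. (r s * p s i) * g i)"
  proof (rule sum.cong[OF refl])
    fix s assume "s \<in> S"
    then show "r s * s = (\<Sum>i<m. (r s * p s i) * g i)"
      using p(2)[of s] by (metis (no_types, lifting) mult.assoc sum.cong sum_distrib_left)
  qed
  also have "\<dots> = (\<Sum>i<m. (\<Sum>s\<in>S. r s * p s i) * g i)"
    by (subst sum.swap) (simp add: sum_distrib_right)
  finally have "(\<Sum>i<m. w i * g i) = 0"
    by (simp add: w_def left_diff_distrib sum_subtractf)
  moreover have "w \<in> free_module m"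
    by (simp add: w_def free_module_def)
  ultimately have "coef (w i) 0 = 0" if "i < m" for i
    using syz that by blast
  moreover have "coef (w i) 0 = \<mu> i" if "i < m" for i
    using that r0 by (simp add: w_def lookup_minus lookup_sum coef_0_mult)
  ultimately show False
    using l(1) by auto
qed

lemma min_num_gens_eq_length:
  fixes J :: "('x::finite, 'k::field) mpoly set"
  assumes res: "min_graded_resolution J a b g A"
  shows "min_num_gens J = length a"
proof -
  define m where "m = length a"
  have J: "(\<lambda>v. \<Sum>i<m. v i * g i) ` free_module m = J"
    using res by (simp add: min_graded_resolution_def m_def)
  define S where "S = g ` {..<m}"
  have "ideal_gen S = J"
  proof (intro equalityI subsetI)
    fix p assume "p \<in> J"
    then obtain v where "p = (\<Sum>i<m. v i * g i)"
      using J by blast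
    also have "\<dots> \<in> ideal_gen S"
      unfolding ideal_gen_def by (intro idl.span_sum idl.span_scale idl.span_base) (auto simp: S_def)
    finally show "p \<in> ideal_gen S" .
  next
    have "S \<subseteq> J"
      using resolution_generator_mem[OF res] by (auto simp: S_def m_def)
    moreover have "idl.subspace J"
    proof (rule idl.subspaceI)
      have "(0 :: nat \<Rightarrow> ('x, 'k) mpoly) \<in> free_module m"
        by (simp add: free_module_def zero_fun_apply)
      then show "0 \<in> J"
        unfolding J[symmetric] by (intro image_eqI[of _ _ 0]) (simp_all add: zero_fun_apply)
    next
      fix x y assume "x \<in> J" "y \<in> J"
      then obtain v w where vw: "v \<in> free_module m" "w \<in> free_module m"
        "x = (\<Sum>i<m. v i * g i)" "y = (\<Sum>i<m. w i * g i)"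
        unfolding J[symmetric] by blast
      have "x + y = (\<Sum>i<m. (v + w) i * g i)"
        by (simp add: vw plus_fun_apply distrib_right sum.distrib)
      moreover have "v + w \<in> free_module m"
        using vw by (simp add: free_module_def plus_fun_apply)
      ultimately show "x + y \<in> J"
        unfolding J[symmetric] by blast
    next
      fix c x assume "x \<in> J"
      then obtain v where v: "v \<in> free_module m" "x = (\<Sum>i<m. v i * g i)"
        unfolding J[symmetric] by blast
      have "c * x = (\<Sum>i<m. vscale c v i * g i)"
        by (simp add: v vscale_apply sum_distrib_left mult.assoc)
      moreover have "vscale c v \<in> free_module m"
        using v by (simp add: free_module_def vscale_apply)
      ultimately show "c * x \<in> J"
        unfolding J[symmetric] by blast
    qed
    ultimately show "p \<in> J" if "p \<in> ideal_gen S" for p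
      using that idl.span_minimal[of S J] by (auto simp: ideal_gen_def)
  qed
  define Q where "Q k \<longleftrightarrow> (\<exists>S. finite S \<and> card S = k \<and> ideal_gen S = J)" for k
  have "Q (card S)"
    using \<open>ideal_gen S = J\<close> by (auto simp: Q_def S_def)
  then have "(LEAST k. Q k) \<le> card S" "Q (LEAST k. Q k)"
    by (rule Least_le, rule LeastI)
  moreover have "card S \<le> m"
    unfolding S_def using card_image_le[of "{..<m}" g] by simp
  moreover have "m \<le> k" if "Q k" for k
    using that generators_card_ge[OF res] by (auto simp: Q_def m_def)
  ultimately have "(LEAST k. Q k) = m"
    by (meson le_antisym le_trans)
  then show ?thesis
    by (simp add: min_num_gens_def Q_def m_def)
qed

subsection \<open>The Hilbert series of a resolved ideal\<close>

text \<open>The Hilbert series of the polynomial ring in the variables \<open>V\<close>, kept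
  general so that variables can be added one at a time.\<close>

definition mon_series :: "'x::finite set \<Rightarrow> rat fps"
  where "mon_series V = Abs_fps (\<lambda>e. of_nat (card {t :: 'x \<Rightarrow>\<^sub>0 nat. keys t \<subseteq> V \<and> mdeg t = e}))"

text \<open>A monomial either avoids \<open>v\<close> or is \<open>v\<close> times a monomial of
  degree one less.\<close>

lemma mon_series_insert:
  fixes v :: "'x::finite"
  assumes "v \<notin> V"
  shows "mon_series (insert v V) * (1 - fps_X) = mon_series V"
proof (rule fps_ext)
  fix e
  define M where "M U e = {t :: 'x \<Rightarrow>\<^sub>0 nat. keys t \<subseteq> U \<and> mdeg t = e}" for U e
  have fin: "finite (M U e)" for U e
    by (rule finite_subset[OF _ finite_monomials[of e]]) (auto simp: M_def)
  have split: "M (insert v V) e = M V e \<union> {t \<in> M (insert v V) e. coef t v \<noteq> 0}"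
    using in_keys_iff by (fastforce simp: M_def)
  have "M V e \<inter> {t \<in> M (insert v V) e. coef t v \<noteq> 0} = {}"
    using assms in_keys_iff[of v] by (auto simp: M_def)
  then have card: "card (M (insert v V) e) = card (M V e) + card {t \<in> M (insert v V) e. coef t v \<noteq> 0}"
    using fin by (subst split, subst card_Un_disjoint) auto
  have shift: "card {t \<in> M (insert v V) e. coef t v \<noteq> 0} = (if e = 0 then 0 else card (M (insert v V) (e - 1)))"
  proof (cases "e = 0")
    case True
    then have "{t \<in> M (insert v V) e. coef t v \<noteq> 0} = {}"
      by (auto simp: M_def mdeg_eq_0_iff)
    then show ?thesis
      using True by (metis card.empty)
  next
    case False
    have "bij_betw (\<lambda>t. t + single v 1) (M (insert v V) (e - 1)) {t \<in> M (insert v V) e. coef t v \<noteq> 0}"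
    proof (rule bij_betw_byWitness[of _ "\<lambda>t. t - single v 1"])
      have restore: "t - single v 1 + single v 1 = t" if "coef t v \<noteq> 0" for t :: "'x \<Rightarrow>\<^sub>0 nat"
        using that by (intro poly_mapping_eqI) (auto simp: lookup_add lookup_minus lookup_single when_def)
      then show "\<forall>t\<in>{t \<in> M (insert v V) e. coef t v \<noteq> 0}. t - single v 1 + single v 1 = t"
        by auto
      show "(\<lambda>t. t + single v 1) ` M (insert v V) (e - 1) \<subseteq> {t \<in> M (insert v V) e. coef t v \<noteq> 0}"
        using False Poly_Mapping.keys_add[of _ "single v (1 :: nat)"]
        by (fastforce simp: M_def mdeg_add lookup_add)
      show "(\<lambda>t. t - single v 1) ` {t \<in> M (insert v V) e. coef t v \<noteq> 0} \<subseteq> M (insert v V) (e - 1)"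
      proof
        fix u assume "u \<in> (\<lambda>t. t - single v 1) ` {t \<in> M (insert v V) e. coef t v \<noteq> 0}"
        then obtain t where t: "u = t - single v 1" "t \<in> M (insert v V) e" "coef t v \<noteq> 0"
          by blast
        have "keys u \<subseteq> keys t"
          unfolding t(1) by (auto simp: in_keys_iff lookup_minus)
        moreover have "mdeg t = mdeg u + 1"
          using restore[OF t(3)] t(1) by (metis mdeg_add mdeg_single)
        ultimately show "u \<in> M (insert v V) (e - 1)"
          using t(2) by (auto simp: M_def)
      qed
    qed auto
    then show ?thesis
      using False bij_betw_same_card by fastforce
  qed
  have nth: "fps_nth (f * (1 - fps_X)) e = fps_nth f e - (if e = 0 then 0 else fps_nth f (e - 1))" for f :: "rat fps"
    by (simp add: right_diff_distrib)
  show "fps_nth (mon_series (insert v V) * (1 - fps_X)) e = fps_nth (mon_series V) e"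
    unfolding nth using card shift by (simp add: mon_series_def M_def)
qed

lemma mon_series_power: "mon_series V * (1 - fps_X) ^ card V = 1" if "finite V" for V :: "'x::finite set"
  using that
proof (induction V)
  case empty
  have "{t :: 'x \<Rightarrow>\<^sub>0 nat. keys t \<subseteq> {} \<and> mdeg t = e} = (if e = 0 then {0} else {})" for e
    by (auto simp: mdeg_eq_0_iff)
  then show ?case
    by (intro fps_ext) (simp add: mon_series_def)
next
  case (insert v V)
  then show ?case
    using mon_series_insert[OF insert.hyps(2)] by (simp add: mult.assoc[symmetric])
qed

section \<open>Dimensions of the graded pieces of a resolution\<close>

lemma kv_dim_0: "kv.dim {0 :: ('x::finite, 'k::field) mpoly} = 0"
  by (metis card.empty kv.dim_span_eq_card_independent kv.independent_empty kv.span_empty)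

definition kvscale :: "'k::field \<Rightarrow> (nat \<Rightarrow> ('x::finite, 'k) mpoly) \<Rightarrow> nat \<Rightarrow> ('x, 'k) mpoly"
  where "kvscale c v = (\<lambda>i. k_scale c (v i))"

interpretation kw: vector_space "kvscale :: 'k::field \<Rightarrow> (nat \<Rightarrow> ('x::finite, 'k) mpoly) \<Rightarrow> _"
proof
  fix a b :: 'k and x y :: "nat \<Rightarrow> ('x, 'k) mpoly"
  show "kvscale a (x + y) = kvscale a x + kvscale a y"
    by (rule ext) (simp add: kvscale_def plus_fun_apply kv.scale_right_distrib)
  show "kvscale (a + b) x = kvscale a x + kvscale b x"
    by (rule ext) (simp add: kvscale_def plus_fun_apply kv.scale_left_distrib)
  show "kvscale a (kvscale b x) = kvscale (a * b) x"
    by (rule ext) (simp add: kvscale_def)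
  show "kvscale 1 x = x"
    by (rule ext) (simp add: kvscale_def)
qed

lemma kw_dim_0: "kw.dim {0 :: nat \<Rightarrow> ('x::finite, 'k::field) mpoly} = 0"
  by (metis card.empty kw.dim_span_eq_card_independent kw.independent_empty kw.span_empty)

definition free_piece :: "(nat \<Rightarrow> nat) \<Rightarrow> nat \<Rightarrow> nat \<Rightarrow> (nat \<Rightarrow> ('x::finite, 'k::field) mpoly) set"
  where "free_piece a m e = {v \<in> free_module m. vhom a e v}"

lemma vhom_iff: "vhom a e v \<longleftrightarrow> (\<forall>i. v i \<in> (if a i \<le> e then hom_piece (e - a i) else {0}))"
proof -
  have "(\<forall>t\<in>keys p. mdeg t + d = e) \<longleftrightarrow> p \<in> (if d \<le> e then hom_piece (e - d) else {0})"
    for p :: "('a, 'b) mpoly" and d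
  proof (cases "d \<le> e")
    case False
    then show ?thesis
      by (auto simp flip: keys_eq_empty)
  qed (auto simp: hom_piece_def)
  then show ?thesis
    unfolding vhom_def by blast
qed

lemma free_piece_subspace: "kw.subspace (free_piece a m e)"
proof (rule kw.subspaceI)
  show "0 \<in> free_piece a m e"
    by (simp add: free_piece_def free_module_def vhom_def zero_fun_apply)
  show "v + w \<in> free_piece a m e" if "v \<in> free_piece a m e" "w \<in> free_piece a m e" for v w
  proof -
    have "v i + w i \<in> (if a i \<le> e then hom_piece (e - a i) else {0})" for i
      using that hom_piece_add[of "v i" "e - a i" "w i"]
      unfolding free_piece_def vhom_iff mem_Collect_eq by (metis add.right_neutral singletonD singletonI)
    then show ?thesis
      using that by (simp add: free_piece_def free_module_def vhom_iff plus_fun_apply)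
  qed
  show "kvscale c v \<in> free_piece a m e" if "v \<in> free_piece a m e" for c v
  proof -
    have "k_scale c (v i) \<in> (if a i \<le> e then hom_piece (e - a i) else {0})" for i
      using that kv.subspace_scale[OF hom_piece_subspace, of "v i" "e - a i" c]
      unfolding free_piece_def vhom_iff mem_Collect_eq by (metis kv.scale_zero_right singletonD singletonI)
    then show ?thesis
      using that by (simp add: free_piece_def free_module_def vhom_iff kvscale_def)
  qed
qed

definition mon_count :: "'x::finite itself \<Rightarrow> nat \<Rightarrow> nat \<Rightarrow> nat"
  where "mon_count _ d e = (if d \<le> e then card {t :: 'x \<Rightarrow>\<^sub>0 nat. mdeg t = e - d} else 0)"

text \<open>Finite spanning is carried along in the induction because \<open>dim_add_image\<close>
  asks for it when the next coordinate is added.\<close>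

lemma dim_free_piece:
  "(\<exists>G. finite G \<and> (free_piece a m e :: (nat \<Rightarrow> ('x::finite, 'k::field) mpoly) set) \<subseteq> kw.span G) \<and>
    kw.dim (free_piece a m e :: (nat \<Rightarrow> ('x, 'k) mpoly) set) = (\<Sum>i<m. mon_count TYPE('x) (a i) e)"
proof (induction m)
  case 0
  have "free_piece a 0 e = {0 :: nat \<Rightarrow> ('x, 'k) mpoly}"
    by (auto simp: free_piece_def free_module_def vhom_def zero_fun_def)
  then show ?case
    by (auto intro!: exI[of _ "{}"] simp: kw_dim_0)
next
  case (Suc m)
  then obtain G where G: "finite G" "(free_piece a m e :: (nat \<Rightarrow> ('x, 'k) mpoly) set) \<subseteq> kw.span G"
    by blast
  define S where "S = (if a m \<le> e then hom_piece (e - a m) else {0} :: ('x, 'k) mpoly set)"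
  define F where "F = (if a m \<le> e then mons (e - a m) else {} :: ('x, 'k) mpoly set)"
  define \<iota> where "\<iota> p = (\<lambda>i. if i = m then p else 0)" for p :: "('x, 'k) mpoly"
  have S: "kv.subspace S" "S \<subseteq> kv.span F" "finite F" "S = kv.span F"
    by (auto simp: S_def F_def hom_piece_span[symmetric] hom_piece_subspace finite_mons)
  have dimS: "kv.dim S = mon_count TYPE('x) (a m) e"
    by (simp add: S_def mon_count_def dim_hom_piece kv_dim_0)
  interpret vp: vector_space_pair k_scale kvscale
    by unfold_locales
  have lin: "Vector_Spaces.linear k_scale kvscale \<iota>"
    by unfold_locales (auto simp: \<iota>_def kvscale_def plus_fun_apply fun_eq_iff)
  have 1: "{w + \<iota> s |w s. w \<in> free_piece a m e \<and> s \<in> S} = free_piece a (Suc m) e"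
  proof (intro equalityI subsetI)
    fix v assume "v \<in> {w + \<iota> s |w s. w \<in> free_piece a m e \<and> s \<in> S}"
    then obtain w s where v: "v = w + \<iota> s" "w \<in> free_piece a m e" "s \<in> S"
      by blast
    have "w i = 0" if "m \<le> i" for i
      using v(2) that by (simp add: free_piece_def free_module_def)
    then have vi: "v i = (if i = m then s else w i)" for i
      by (simp add: v(1) \<iota>_def plus_fun_apply)
    have w: "w i \<in> (if a i \<le> e then hom_piece (e - a i) else {0})" for i
      using v(2) unfolding free_piece_def vhom_iff by blast
    have "v i \<in> (if a i \<le> e then hom_piece (e - a i) else {0})" for i
      using v(3) w[of i] unfolding S_def vi by (auto split: if_splits)
    moreover have "v \<in> free_module (Suc m)"
      using v(2) by (simp add: free_piece_def free_module_def vi)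
    ultimately show "v \<in> free_piece a (Suc m) e"
      unfolding free_piece_def vhom_iff by blast
  next
    fix v :: "nat \<Rightarrow> ('x, 'k) mpoly" assume v: "v \<in> free_piece a (Suc m) e"
    define w where "w i = (if i = m then 0 else v i)" for i
    have "v = w + \<iota> (v m)"
      by (rule ext) (simp add: w_def \<iota>_def plus_fun_apply)
    moreover have "w \<in> free_piece a m e"
      using v by (auto simp: free_piece_def free_module_def vhom_def w_def)
    moreover have "v m \<in> S"
      using v by (auto simp: free_piece_def vhom_iff S_def)
    ultimately show "v \<in> {w + \<iota> s |w s. w \<in> free_piece a m e \<and> s \<in> S}"
      by blast
  qed
  have 2: "{s \<in> S. \<iota> s \<in> free_piece a m e} = {0}"
  proof -
    have "\<iota> s m = s" for s
      by (simp add: \<iota>_def)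
    then have "s = 0" if "\<iota> s \<in> free_piece a m e" for s
      using that by (metis (mono_tags, lifting) free_module_def free_piece_def mem_Collect_eq order_refl)
    moreover have "\<iota> 0 = 0"
      by (simp add: \<iota>_def zero_fun_def)
    ultimately show ?thesis
      using kv.subspace_0[OF S(1)] kw.subspace_0[OF free_piece_subspace[of a m e]] by auto
  qed
  have "kw.dim (free_piece a (Suc m) e :: (nat \<Rightarrow> ('x, 'k) mpoly) set)
      = kw.dim (free_piece a m e :: (nat \<Rightarrow> ('x, 'k) mpoly) set) + mon_count TYPE('x) (a m) e"
    using vp.dim_add_image[OF lin S(1-3) free_piece_subspace[of a m e] G(2,1)] unfolding 1 2 dimS by (simp add: kv_dim_0)
  moreover have "(free_piece a (Suc m) e :: (nat \<Rightarrow> ('x, 'k) mpoly) set) \<subseteq> kw.span (G \<union> \<iota> ` F)"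
  proof -
    interpret \<iota>: Vector_Spaces.linear k_scale kvscale \<iota>
      by (rule lin)
    show ?thesis
      unfolding 1[symmetric] kw.span_Un \<iota>.span_image using G(2) S(2) by blast
  qed
  ultimately show ?case
    using Suc G(1) S(3) by (auto intro!: exI[of _ "G \<union> \<iota> ` F"])
qed

lemma vcomp_of_vhom: "vhom a e v \<Longrightarrow> vcomp a e v = v"
  by (rule ext, rule poly_mapping_eqI) (metis coef_vcomp in_keys_iff vhom_def)

lemma vcomp_free_piece: "v \<in> free_module m \<Longrightarrow> vcomp a e v \<in> free_piece a m e"
  using vhom_vcomp by (auto simp: free_piece_def free_module_def vcomp_def)

text \<open>Both maps commute with taking degree \<open>e\<close> components, so exactness restricts
  to degree \<open>e\<close>. Rank-nullity for each map then eliminates the dimension of the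
  syzygies.\<close>

lemma resolution_dim:
  fixes J :: "('x::finite, 'k::field) mpoly set"
  assumes res: "min_graded_resolution J a b g A"
  shows "kv.dim (J \<inter> hom_piece e) + (\<Sum>l<length b. mon_count TYPE('x) (b ! l) e)
    = (\<Sum>i<length a. mon_count TYPE('x) (a ! i) e)"
proof -
  define m r where "m = length a" and "r = length b"
  \<comment> \<open>The definition of a resolution leaves the entries of \<open>A\<close> beyond the
    length of \<open>a\<close> unconstrained.\<close>
  define A' where "A' l i = (if i < m then A l i else 0)" for l i
  define \<psi> where "\<psi> w = (\<Sum>l<r. vscale (w l) (A' l))" for w
  define \<phi> where "\<phi> v = (\<Sum>i<m. v i * g i)" for v
  have \<psi>_eq: "(\<lambda>w i. if i < m then \<Sum>l<r. w l * A l i else 0) = \<psi>"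
    by (intro ext) (simp add: \<psi>_def A'_def sum_fun_apply vscale_apply)
  have g: "g i \<in> hom_piece (a ! i)" if "i < m" for i
    using res that by (simp add: min_graded_resolution_def m_def)
  have A: "vhom ((!) a) (b ! l) (A' l)" if "l < r" for l
    using res that by (auto simp: min_graded_resolution_def m_def r_def vhom_def A'_def)
  have J: "\<phi> ` free_module m = J"
    using res unfolding \<phi>_def[abs_def] m_def by (simp add: min_graded_resolution_def)
  have ker: "{v \<in> free_module m. \<phi> v = 0} = \<psi> ` free_module r"
    using res unfolding \<phi>_def \<psi>_eq[symmetric] m_def r_def by (simp add: min_graded_resolution_def)
  have inj: "inj_on \<psi> (free_module r)"
    using res unfolding \<psi>_eq[symmetric] m_def r_def by (simp add: min_graded_resolution_def)
  have \<phi>_comp: "\<phi> (vcomp ((!) a) e v) = hcomp e (\<phi> v)" for v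
    unfolding \<phi>_def hcomp_sum by (rule sum.cong) (auto simp: vcomp_def hcomp_mult_hom[OF g])
  have \<psi>_comp: "\<psi> (vcomp ((!) b) e w) = vcomp ((!) a) e (\<psi> w)" for w
    unfolding \<psi>_def vcomp_sum
    by (rule sum.cong) (auto simp: vcomp_vscale[OF A] vcomp_def[of "(!) b"])
  obtain G where G: "finite G" "(free_piece ((!) a) m e :: (nat \<Rightarrow> ('x, 'k) mpoly) set) \<subseteq> kw.span G"
    using dim_free_piece[of "(!) a" m e] by blast
  obtain G' where G': "finite G'" "(free_piece ((!) b) r e :: (nat \<Rightarrow> ('x, 'k) mpoly) set) \<subseteq> kw.span G'"
    using dim_free_piece[of "(!) b" r e] by blast
  define K where "K = {v \<in> free_piece ((!) a) m e. \<phi> v = 0}"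
  interpret vp: vector_space_pair kvscale k_scale
    by unfold_locales
  interpret vq: vector_space_pair kvscale kvscale
    by unfold_locales
  have lin\<phi>: "Vector_Spaces.linear kvscale k_scale \<phi>"
    by unfold_locales
      (simp_all add: \<phi>_def kvscale_def plus_fun_apply distrib_right sum.distrib kv.scale_sum_right k_scale_mult(1))
  have lin\<psi>: "Vector_Spaces.linear kvscale kvscale \<psi>"
  proof unfold_locales
    show "\<psi> (v + w) = \<psi> v + \<psi> w" for v w
      by (simp add: \<psi>_def plus_fun_apply vec.scale_left_distrib sum.distrib)
    show "\<psi> (kvscale c v) = kvscale c (\<psi> v)" for c v
      by (rule ext) (simp add: \<psi>_def kvscale_def sum_fun_apply vscale_apply kv.scale_sum_right k_scale_mult(1))
  qed
  have "{w + \<phi> s |w s. w \<in> {0} \<and> s \<in> free_piece ((!) a) m e} = J \<inter> hom_piece e"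
  proof (intro equalityI subsetI)
    fix p assume "p \<in> {w + \<phi> s |w s. w \<in> {0} \<and> s \<in> free_piece ((!) a) m e}"
    then obtain s where s: "p = \<phi> s" "s \<in> free_piece ((!) a) m e"
      by auto
    then have "p = hcomp e (\<phi> s)"
      using \<phi>_comp[of s] vcomp_of_vhom[of "(!) a" e s] by (simp add: free_piece_def)
    then have "p \<in> hom_piece e"
      by (metis hcomp_hom_piece)
    then show "p \<in> J \<inter> hom_piece e"
      using s J by (auto simp: free_piece_def)
  next
    fix p assume p: "p \<in> J \<inter> hom_piece e"
    then obtain v where v: "v \<in> free_module m" "p = \<phi> v"
      using J by blast
    have "p = \<phi> (vcomp ((!) a) e v)"
      using p hcomp_of_hom_piece[of p e e] by (simp add: \<phi>_comp flip: v(2))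
    then show "p \<in> {w + \<phi> s |w s. w \<in> {0} \<and> s \<in> free_piece ((!) a) m e}"
      using vcomp_free_piece[OF v(1)] by auto
  qed
  then have 1: "kv.dim (J \<inter> hom_piece e) + kw.dim K = (\<Sum>i<m. mon_count TYPE('x) (a ! i) e)"
    using vp.dim_add_image[OF lin\<phi> free_piece_subspace G(2,1), of "{0}" "{}"]
      dim_free_piece[of "(!) a" m e, where 'x = 'x and 'k = 'k] by (simp add: K_def kv_dim_0)
  have "{w + \<psi> s |w s. w \<in> {0} \<and> s \<in> free_piece ((!) b) r e} = K"
  proof (intro equalityI subsetI)
    fix v assume "v \<in> {w + \<psi> s |w s. w \<in> {0} \<and> s \<in> free_piece ((!) b) r e}"
    then obtain s where s: "v = \<psi> s" "s \<in> free_piece ((!) b) r e"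
      by auto
    then have "v = vcomp ((!) a) e (\<psi> s)"
      using \<psi>_comp[of s] vcomp_of_vhom[of "(!) b" e s] by (simp add: free_piece_def)
    moreover have "\<psi> s \<in> {v \<in> free_module m. \<phi> v = 0}"
      using s ker by (auto simp: free_piece_def)
    ultimately show "v \<in> K"
      using vcomp_free_piece[of "\<psi> s" m "(!) a" e] s(1) by (auto simp: K_def)
  next
    fix v assume v: "v \<in> K"
    then have "v \<in> \<psi> ` free_module r"
      unfolding ker[symmetric] by (auto simp: K_def free_piece_def)
    then obtain w where w: "w \<in> free_module r" "v = \<psi> w"
      by blast
    have "v = \<psi> (vcomp ((!) b) e w)"
      using v vcomp_of_vhom[of "(!) a" e v] by (simp add: \<psi>_comp K_def free_piece_def flip: w(2))
    then show "v \<in> {w + \<psi> s |w s. w \<in> {0} \<and> s \<in> free_piece ((!) b) r e}"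
      using vcomp_free_piece[OF w(1)] by auto
  qed
  moreover have "{s \<in> free_piece ((!) b) r e. \<psi> s \<in> {0}} = {0}"
  proof -
    have z: "(0 :: nat \<Rightarrow> ('x, 'k) mpoly) \<in> free_piece ((!) b) r e"
      by (rule kw.subspace_0[OF free_piece_subspace])
    have \<psi>0: "\<psi> 0 = 0"
      by (simp add: \<psi>_def zero_fun_apply)
    have "s = 0" if "s \<in> free_piece ((!) b) r e" "\<psi> s = 0" for s
      using inj_onD[OF inj, of s 0] that z \<psi>0 by (simp add: free_piece_def)
    then show ?thesis
      using z \<psi>0 by auto
  qed
  ultimately have "kw.dim K = (\<Sum>l<r. mon_count TYPE('x) (b ! l) e)"
    using vq.dim_add_image[OF lin\<psi> free_piece_subspace G'(2,1), of "{0}" "{}"]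
      dim_free_piece[of "(!) b" r e, where 'x = 'x and 'k = 'k] by (simp add: kw_dim_0)
  then show ?thesis
    using 1 by (simp add: m_def r_def)
qed

lemma sum_nth_count_list: "(\<Sum>i<length xs. if xs ! i = j then 1 else 0 :: rat) = of_nat (count_list xs j)"
proof -
  have "(\<Sum>i<length xs. if xs ! i = j then 1 else 0 :: rat) = of_nat (card {i \<in> {..<length xs}. xs ! i = j})"
    by (simp add: sum.If_cases Int_def)
  then show ?thesis
    by (simp add: count_list_eq_length_filter length_filter_conv_card eq_commute[of j])
qed

text \<open>The resolution gives the Hilbert series as 1 minus the powers t^a plus the powers t^b,
  divided by (1 - t)^n. Comparing with the h-vector turns the numerator into the series of
  \<open>h\<close> times (1 - t)^2, whose coefficients are second differences. The values zero of
  \<open>h\<close> at negative arguments settle the degrees 0 and 1.\<close>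

lemma resolution_bdiff2:
  fixes J :: "('x::finite, 'k::field) mpoly set"
  assumes res: "min_graded_resolution J a b g A" and J: "is_ideal J"
    and card: "CARD('x) \<ge> 2" and h: "has_h_vector J h" "\<And>j. j < 0 \<Longrightarrow> h j = 0"
  shows "bdiff2 h (int j) = (if j = 0 then 1 else 0) - int (count_list a j) + int (count_list b j)"
proof -
  define D where "D = mon_series (UNIV :: 'x set)"
  define Q where "Q xs = (\<Sum>i<length xs. fps_X ^ (xs ! i) :: rat fps)" for xs
  define H where "H = Abs_fps (\<lambda>j. rat_of_int (h (int j)))"
  have D_nth: "fps_nth (D * fps_X ^ d) e = of_nat (mon_count TYPE('x) d e)" for d e
    by (simp add: fps_X_power_mult_right_nth mon_count_def D_def mon_series_def)
  have "hilbert_series J = D * (1 - Q a + Q b)"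
  proof (rule fps_ext)
    fix e
    have "fps_nth (D * (1 - Q a + Q b)) e = of_nat (mon_count TYPE('x) 0 e)
        - (\<Sum>i<length a. of_nat (mon_count TYPE('x) (a ! i) e))
        + (\<Sum>i<length b. of_nat (mon_count TYPE('x) (b ! i) e))"
      using D_nth[of 0 e]
      by (simp add: distrib_left right_diff_distrib Q_def sum_distrib_left fps_sum_nth D_nth)
    moreover have "hilbert_function J e + kv.dim (J \<inter> hom_piece e) = mon_count TYPE('x) 0 e"
      using hilbert_function_add[OF J, of e] by (simp add: dim_hom_piece mon_count_def)
    then have "hilbert_function J e + (\<Sum>i<length a. mon_count TYPE('x) (a ! i) e)
        = mon_count TYPE('x) 0 e + (\<Sum>l<length b. mon_count TYPE('x) (b ! l) e)"
      using resolution_dim[OF res, of e] by linarith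
    then have "rat_of_nat (hilbert_function J e + (\<Sum>i<length a. mon_count TYPE('x) (a ! i) e))
        = rat_of_nat (mon_count TYPE('x) 0 e + (\<Sum>l<length b. mon_count TYPE('x) (b ! l) e))"
      by simp
    ultimately show "fps_nth (hilbert_series J) e = fps_nth (D * (1 - Q a + Q b)) e"
      by (simp add: hilbert_series_def)
  qed
  then have "hilbert_series J * (1 - fps_X) ^ CARD('x) = (D * (1 - fps_X) ^ CARD('x)) * (1 - Q a + Q b)"
    by (simp only: ac_simps)
  also have "D * (1 - fps_X) ^ CARD('x) = 1"
    unfolding D_def by (rule mon_series_power) simp
  finally have "hilbert_series J * (1 - fps_X) ^ CARD('x) = 1 - Q a + Q b"
    by simp
  moreover have "(1 - fps_X :: rat fps) ^ CARD('x) = (1 - fps_X) ^ (CARD('x) - 2) * (1 - fps_X) ^ 2"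
    using card by (metis le_add_diff_inverse2 power_add)
  ultimately have "hilbert_series J * (1 - fps_X) ^ (CARD('x) - 2) * (1 - fps_X) ^ 2 = 1 - Q a + Q b"
    by (simp add: mult.assoc)
  then have eq: "H * (1 - fps_X) * (1 - fps_X) = 1 - Q a + Q b"
    unfolding hilbert_series_times_power[OF h(1)] H_def by (simp add: power2_eq_square mult.assoc)
  have nth: "fps_nth (f * (1 - fps_X)) j = fps_nth f j - (if j = 0 then 0 else fps_nth f (j - 1))"
    for f :: "rat fps" and j
    by (simp add: right_diff_distrib)
  have Hd: "fps_nth (H * (1 - fps_X)) j = of_int (bdiff h (int j))" for j
    unfolding nth by (cases j) (simp_all add: H_def bdiff_def h(2))
  have "bdiff h (- 1) = 0"
    by (simp add: bdiff_def h(2))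
  then have "fps_nth (H * (1 - fps_X) * (1 - fps_X)) j = of_int (bdiff2 h (int j))"
    unfolding nth[of "H * (1 - fps_X)"] Hd by (cases j) (simp_all add: bdiff_def[of "bdiff h"])
  moreover have "fps_nth (Q xs) j = of_nat (count_list xs j)" for xs
    by (simp add: Q_def fps_sum_nth fps_X_power_nth sum_nth_count_list[symmetric] eq_commute[of j])
  ultimately have "rat_of_int (bdiff2 h (int j))
      = (if j = 0 then 1 else 0) - of_nat (count_list a j) + of_nat (count_list b j)"
    using arg_cong[OF eq, of "\<lambda>f. fps_nth f j"] by simp
  also have "\<dots> = rat_of_int ((if j = 0 then 1 else 0) - int (count_list a j) + int (count_list b j))"
    by simp
  finally show ?thesis
    by (simp only: of_int_eq_iff)
qed

subsection \<open>O-sequences and Betti numbers\<close>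

lemma O_sequence_nonneg: "O_sequence d s h \<Longrightarrow> 0 \<le> h j"
proof -
  assume O: "O_sequence d s h"
  consider "j < 0 \<or> s < j" | "0 \<le> j" "j \<le> d - 1" | "d \<le> j" "j \<le> s"
    by linarith
  then show ?thesis
    using O unfolding O_sequence_def by cases force+
qed

lemma finite_bdiff2_support:
  assumes "O_sequence d s h"
  shows "finite {j. j \<ge> 1 \<and> bdiff2 h j \<noteq> 0}"
proof (rule finite_subset)
  show "{j. j \<ge> 1 \<and> bdiff2 h j \<noteq> 0} \<subseteq> {1..s + 2}"
    using assms by (auto simp: O_sequence_def bdiff_def)
qed simp

theorem theorem1p1:
  fixes J :: "('x::finite, 'k::field) mpoly set"
    and h :: "int \<Rightarrow> int" and d s :: int and \<I> \<J> :: "int set"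
  assumes "O_sequence d s h"
    and "\<I> = {j. j \<ge> 1 \<and> bdiff2 h j \<le> -1}"
    and "\<J> = {j. j \<ge> 1 \<and> bdiff2 h j \<ge> 1}"
    and "is_ideal J" and "homogeneous_ideal J" and "perfect_height_two J"
    and "has_h_vector J h"
  shows "int (min_num_gens J) \<ge> (\<Sum>i\<in>\<I>. \<bar>bdiff2 h i\<bar>) \<and>
    (int (min_num_gens J) = (\<Sum>i\<in>\<I>. \<bar>bdiff2 h i\<bar>) \<longrightarrow>
      (\<forall>j. int (graded_betti0 J j) = (if int j \<in> \<I> then \<bar>bdiff2 h (int j)\<bar> else 0)) \<and>
      (\<forall>j. int (graded_betti1 J j) = (if int j \<in> \<J> then \<bar>bdiff2 h (int j)\<bar> else 0)))"
proof -
  have height: "ideal_height J = 2" and cm: "cohen_macaulay_quotient J"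
    using assms(6) by (auto simp: perfect_height_two_def)
  have card: "CARD('x) \<ge> 2"
    by (rule card_vars_ge_2[OF height])
  have h0: "h 0 = 1" and hneg: "\<And>j. j < 0 \<Longrightarrow> h j = 0"
    using assms(1) by (auto simp: O_sequence_def)
  have "\<not> slow (CARD('x) - 2) J"
    by (rule not_slow_h_vector[OF assms(7) h0 O_sequence_nonneg[OF assms(1)]])
  then have ex: "\<exists>a b g A. min_graded_resolution J a b g A"
    using resolution_exists[OF assms(5)] koszul_vanishes_cohen_macaulay[OF assms(5) cm] by blast
  have fin: "finite \<I>"
    using finite_bdiff2_support[OF assms(1)] by (rule rev_finite_subset) (auto simp: assms(2))
  have diff: "bdiff2 h (int j) = (if j = 0 then 1 else 0) - int (count_list a j) + int (count_list b j)"
    if "min_graded_resolution J a b g A" for a b g A j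
    by (rule resolution_bdiff2[OF that assms(4) card assms(7) hneg])
  \<comment> \<open>The index set is enlarged so that both sums run over the same set, with
    \<open>k\<close> free to be any degree in which a strict inequality is to be refuted.\<close>
  have len: "int (min_num_gens J) = (\<Sum>j\<in>nat ` \<I> \<union> set a \<union> {k}. int (count_list a j))"
    if "min_graded_resolution J a b g A" for a b g A k
  proof -
    have "(\<Sum>j\<in>nat ` \<I> \<union> set a \<union> {k}. int (count_list a j)) = (\<Sum>j\<in>set a. int (count_list a j))"
      using fin by (intro sum.mono_neutral_right) (auto simp: count_list_0_iff)
    also have "\<dots> = int (length a)"
      using sum_count_set[of a "set a"] by (simp flip: of_nat_sum)
    finally show ?thesis
      by (simp add: min_num_gens_eq_length[OF that])
  qed
  define \<beta> where "\<beta> j = (if int j \<in> \<I> then \<bar>bdiff2 h (int j)\<bar> else 0)" for j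
  have \<beta>_sum: "(\<Sum>i\<in>\<I>. \<bar>bdiff2 h i\<bar>) = (\<Sum>j\<in>nat ` \<I> \<union> B. \<beta> j)" if "finite B" for B
  proof -
    have inj: "inj_on nat \<I>"
      by (rule inj_onI) (auto simp: assms(2))
    have "(\<Sum>j\<in>nat ` \<I> \<union> B. \<beta> j) = (\<Sum>j\<in>nat ` \<I>. \<beta> j)"
    proof (rule sum.mono_neutral_right)
      show "\<forall>j\<in>nat ` \<I> \<union> B - nat ` \<I>. \<beta> j = 0"
        unfolding \<beta>_def by (metis Diff_iff imageI nat_int)
    qed (use fin that in auto)
    also have "\<dots> = (\<Sum>i\<in>\<I>. \<bar>bdiff2 h i\<bar>)"
      unfolding sum.reindex[OF inj] by (rule sum.cong) (auto simp: \<beta>_def assms(2))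
    finally show ?thesis by simp
  qed
  \<comment> \<open>On \<I> the degree is positive, so the absolute value is the count in
    \<open>a\<close> minus the count in \<open>b\<close>.\<close>
  have \<beta>_le: "\<beta> j \<le> int (count_list a j)" if "min_graded_resolution J a b g A" for a b g A j
    using diff[OF that, of j] by (auto simp: \<beta>_def assms(2))
  obtain a0 b0 g0 A0 where res0: "min_graded_resolution J a0 b0 g0 A0"
    using ex by blast
  have ge: "int (min_num_gens J) \<ge> (\<Sum>i\<in>\<I>. \<bar>bdiff2 h i\<bar>)"
    unfolding len[OF res0, of 0] \<beta>_sum[of "set a0 \<union> {0}", unfolded Un_assoc[symmetric], OF finite_UnI[OF finite_set finite.insertI[OF finite.emptyI]]]
    by (rule sum_mono) (rule \<beta>_le[OF res0])
  moreover have "(\<forall>j. int (graded_betti0 J j) = (if int j \<in> \<I> then \<bar>bdiff2 h (int j)\<bar> else 0)) \<and>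
      (\<forall>j. int (graded_betti1 J j) = (if int j \<in> \<J> then \<bar>bdiff2 h (int j)\<bar> else 0))"
    if eq: "int (min_num_gens J) = (\<Sum>i\<in>\<I>. \<bar>bdiff2 h i\<bar>)"
  proof -
    have a_eq: "int (count_list a j) = \<beta> j" if res: "min_graded_resolution J a b g A" for a b g A j
    proof (rule ccontr)
      assume "int (count_list a j) \<noteq> \<beta> j"
      then have less: "\<beta> j < int (count_list a j)"
        using \<beta>_le[OF res, of j] by simp
      have "(\<Sum>j\<in>nat ` \<I> \<union> (set a \<union> {j}). \<beta> j) < (\<Sum>j\<in>nat ` \<I> \<union> (set a \<union> {j}). int (count_list a j))"
        by (rule sum_strict_mono_ex1) (use fin less \<beta>_le[OF res] in auto)
      then show False
        using eq len[OF res, of j] \<beta>_sum[of "set a \<union> {j}"] by (simp add: Un_assoc)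
    qed
    have b_eq: "int (count_list b j) = (if int j \<in> \<J> then \<bar>bdiff2 h (int j)\<bar> else 0)"
      if res: "min_graded_resolution J a b g A" for a b g A j
    \<comment> \<open>Degree 0 has the extra summand 1 in \<open>diff\<close>, which matches
      \<open>bdiff2 h 0 = 1\<close>; hence the count in \<open>b\<close> is zero there, just as in
      \<open>a\<close>.\<close>
    proof (cases "j = 0")
      case True
      have "bdiff2 h 0 = 1"
        by (simp add: bdiff_def h0 hneg)
      then show ?thesis
        using diff[OF res, of j] a_eq[OF res, of j] True by (simp add: \<beta>_def assms(2,3))
    next
      case False
      then show ?thesis
        using diff[OF res, of j] a_eq[OF res, of j] by (auto simp: \<beta>_def assms(2,3) split: if_splits)
    qed
    \<comment> \<open>The counts were computed for an arbitrary minimal resolution, so all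
      resolutions agree and the definite description picks this value.\<close>
    have "graded_betti0 J j = count_list a0 j" for j
      unfolding graded_betti0_def
    proof (rule the_equality)
      show "m = count_list a0 j" if "\<exists>a b g A. min_graded_resolution J a b g A \<and> count_list a j = m" for m
        using that a_eq res0 by (metis of_nat_eq_iff)
    qed (use res0 in blast)
    moreover have "graded_betti1 J j = count_list b0 j" for j
      unfolding graded_betti1_def
    proof (rule the_equality)
      show "m = count_list b0 j" if "\<exists>a b g A. min_graded_resolution J a b g A \<and> count_list b j = m" for m
        using that b_eq res0 by (metis of_nat_eq_iff)
    qed (use res0 in blast)
    ultimately show ?thesis
      using a_eq[OF res0] b_eq[OF res0] by (simp add: \<beta>_def)
  qed
  ultimately show ?thesis
    by blast
qed

end
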